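(* For $n\ge 2$ let $M_n$ be the major index of a permutation chosen uniformly at random in the symmetric group $\mathcal{S}_n$. The sequence $(M_n)$ satisfies a sharp large deviation principle of any order. More precisely, for any $x\in\,]1/4,1/2[$ and for any integer $p\ge1$, there exists a sequence $m_{n,1}(x),\ldots,m_{n,p}(x)$ such that, for $n$ large enough, $$ \mathbb{P}\Big(\frac{M_n}{n^2}\ge x\Big)=\frac{\exp\big(-nI_M(x)+H(t_x)\big)}{\sigma_xt_x\sqrt{2\pi n}}\left[1+\sum_{k=1}^p\frac{m_{n,k}(x)}{n^k}+O\Big(\frac{1}{n^{p+1}}\Big)\right], $$ where $t_x$ is the unique solution of $L_M'(t_x)=x$, $\sigma_x^2=L_M''(t_x)$, and the coefficients $m_{n,1}(x),\ldots,m_{n,p}(x)$ may be explicitly calculated as functions of the derivatives of $L_D$, $L_M$ and $H$ at the point $t_x$. For example, the first coefficient $m_{n,1}(x)$ is given by $$ m_{n,1}(x)=\frac{t_x}{2}-\frac{t_x(1+t_x)}{24}-\{n^2x\}t_x+\frac{t_x\ell_D(1)}{12} $$ $$ \qquad+\frac{1}{\sigma_x^2}\left(-\frac{1}{t_x^2}+\frac{h(1)}{t_x}-\frac{h(2)}{2}-\frac{h(1)^2}{2}-\frac{\ell_M(3)}{2\sigma_x^2t_x}+\frac{\ell_M(4)}{8\sigma_x^2}+\frac{h(1)\ell_M(3)}{2\sigma_x^2}-\frac{5\,\ell_M(3)^2}{24\sigma_x^4}\right), $$ where for $1\le k\le 4$, $\ell_D(k)=L_D^{(k)}(t_x)$,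 $\ell_M(k)=L_M^{(k)}(t_x)$ and $h(k)=H^{(k)}(t_x)$.
   Context: The major index of a permutation $\pi\in\mathcal{S}_n$ (the symmetric group on $\{1,\ldots,n\}$) is the sum of the positions $k\in\{1,\ldots,n-1\}$ of its descents, i.e. those $k$ with $\pi(k)>\pi(k+1)$; thus $M_n=\sum_{k=1}^{n-1}k\,\mathbf{1}_{\{\pi_n(k)>\pi_n(k+1)\}}$ with $\pi_n$ uniform on $\mathcal{S}_n$. For a positive real number $y$, the notation $\{y\}$ means $\{y\}=\lceil y\rceil-y$ (not the usual fractional part). The function $L_D:\mathbb{R}\to\mathbb{R}$ is $L_D(t)=\log\big(\frac{e^t-1}{t}\big)$ for $t\ne0$, with $L_D(0)=0$ (smooth extension). Moreover $L_M(t)=\int_0^1L_D(yt)\,dy$, $I_M(x)=\sup_{t\in\mathbb{R}}\{xt-L_M(t)\}$, and $H(t)=\frac12\big(L_D(t)-t\big)$. Here $\sigma_x$ denotes the positive square root of $\sigma_x^2$. The $O$ term is understood as $n\to\infty$ with $x$ and $p$ fixed. *)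

theory Defs
  imports "HOL-Probability.Probability" "HOL-Combinatorics.Permutations"
begin

definition major_index :: "nat \<Rightarrow> (nat \<Rightarrow> nat) \<Rightarrow> nat" where
  "major_index n \<pi> = (\<Sum>k | k \<in> {1..n-1} \<and> \<pi> k > \<pi> (k + 1). k)"

text \<open>The law of \<open>M\<^sub>n\<close>. Permutations of \<open>{1..n}\<close> are represented as functions on \<open>nat\<close>
  that are the identity outside \<open>{1..n}\<close>.\<close>

definition major_index_pmf :: "nat \<Rightarrow> nat pmf" where
  "major_index_pmf n = map_pmf (major_index n) (pmf_of_set {\<pi>. \<pi> permutes {1..n}})"

text \<open>The quantity written \<open>{y}\<close> in the source: the distance from \<open>y\<close> up to \<open>\<lceil>y\<rceil>\<close>,
  not the usual fractional part.\<close>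

definition upfrac :: "real \<Rightarrow> real" where
  "upfrac y = of_int \<lceil>y\<rceil> - y"

definition L_D :: "real \<Rightarrow> real" where
  "L_D t = (if t = 0 then 0 else ln ((exp t - 1) / t))"

definition L_M :: "real \<Rightarrow> real" where
  "L_M t = integral {0..1} (\<lambda>y. L_D (y * t))"

definition I_M :: "real \<Rightarrow> real" where
  "I_M x = (SUP t. x * t - L_M t)"

definition H :: "real \<Rightarrow> real" where
  "H t = (L_D t - t) / 2"

definition saddle :: "real \<Rightarrow> real" where
  "saddle x = (THE t. (L_M has_real_derivative x) (at t))"

definition sigma_M :: "real \<Rightarrow> real" where
  "sigma_M x = sqrt ((deriv ^^ 2) L_M (saddle x))"

text \<open>Explicit coefficient formulas. A member is a function of a point \<open>t\<close> (to be
  evaluated at \<open>saddle x\<close>) and of a number \<open>\<theta>\<close> (to be evaluated at \<open>upfrac (n\<^sup>2 x)\<close>) that is a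
  polynomial with rational coefficients in \<open>\<theta>\<close>, \<open>t\<close>, \<open>1/t\<close>, the reciprocal of \<open>L_M''(t)\<close>, which is
  \<open>1/\<sigma>\<^sub>x\<^sup>2\<close>, and finitely many derivatives of \<open>L_D\<close>, \<open>L_M\<close> and \<open>H\<close> at \<open>t\<close>.
  The index \<open>n\<close> enters such a formula only through \<open>\<theta>\<close>, which lies in \<open>[0,1)\<close>.\<close>

inductive explicit_formula :: "(real \<Rightarrow> real \<Rightarrow> real) \<Rightarrow> bool" where
  rat_const: "c \<in> \<rat> \<Longrightarrow> explicit_formula (\<lambda>t \<theta>. c)"
| frac_var: "explicit_formula (\<lambda>t \<theta>. \<theta>)"
| point: "explicit_formula (\<lambda>t \<theta>. t)"
| inv_point: "explicit_formula (\<lambda>t \<theta>. 1 / t)"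
| inv_variance: "explicit_formula (\<lambda>t \<theta>. 1 / (deriv ^^ 2) L_M t)"
| deriv_L_D: "1 \<le> j \<Longrightarrow> explicit_formula (\<lambda>t \<theta>. (deriv ^^ j) L_D t)"
| deriv_L_M: "1 \<le> j \<Longrightarrow> explicit_formula (\<lambda>t \<theta>. (deriv ^^ j) L_M t)"
| deriv_H: "1 \<le> j \<Longrightarrow> explicit_formula (\<lambda>t \<theta>. (deriv ^^ j) H t)"
| add: "explicit_formula f \<Longrightarrow> explicit_formula g \<Longrightarrow> explicit_formula (\<lambda>t \<theta>. f t \<theta> + g t \<theta>)"
| mult: "explicit_formula f \<Longrightarrow> explicit_formula g \<Longrightarrow> explicit_formula (\<lambda>t \<theta>. f t \<theta> * g t \<theta>)"

definition first_coeff :: "nat \<Rightarrow> real \<Rightarrow> real" where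
  "first_coeff n x =
    (let t = saddle x; s2 = (sigma_M x)\<^sup>2;
         lD = (\<lambda>k. (deriv ^^ k) L_D t);
         lM = (\<lambda>k. (deriv ^^ k) L_M t);
         h = (\<lambda>k. (deriv ^^ k) H t)
     in t / 2 - t * (1 + t) / 24 - upfrac ((real n)\<^sup>2 * x) * t + t * lD 1 / 12
        + 1 / s2 * (- (1 / t\<^sup>2) + h 1 / t - h 2 / 2 - (h 1)\<^sup>2 / 2
            - lM 3 / (2 * s2 * t) + lM 4 / (8 * s2)
            + h 1 * lM 3 / (2 * s2) - 5 * (lM 3)\<^sup>2 / (24 * s2\<^sup>2)))"

end

theory Submission
  imports Defs "HOL-Complex_Analysis.Complex_Analysis" "HOL-Real_Asymp.Real_Asymp"
begin

text \<open>
  Cyclically shifting the values of a permutation of \<open>{1..n}\<close> lowers the major index by one, except that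
  it raises it by \<open>n - 1\<close> when the last value is \<open>n\<close>. Hence along every orbit the major index runs
  through \<open>n\<close> consecutive integers, and \<open>M\<^sub>n\<close> has the moment generating function of a sum of independent
  uniform variables on \<open>{0..<k}\<close>, \<open>k \<le> n\<close>. With \<open>z = t + \<i>u/\<surd>n\<close> at the saddle point \<open>t\<close> and
  \<open>N = n\<^sup>2x + \<theta>\<close>, \<open>\<theta> = {n\<^sup>2x}\<close>, Fourier inversion expresses \<open>P(M\<^sub>n \<ge> N)\<close> as an integral over \<open>u\<close> of
  \<open>exp (\<Sum>\<^sub>k L(kz/n) - (n + 1) L(z/n) + z/n - Nz/n) / z\<close>, where \<open>L\<close> extends \<open>L\<^sub>D\<close> holomorphically.
  Euler-Maclaurin summation and Taylor expansion turn the integrand into a Gaussian times a power series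
  in \<open>n\<^sup>-\<^sup>1\<^sup>/\<^sup>2\<close> whose coefficients are polynomials in \<open>\<i>u\<close> of the parity of the index, uniformly for
  \<open>|u| \<le> ln n\<close>; the odd coefficients integrate to zero. Outside this range the characteristic function
  is at most \<open>exp (- c (ln n)\<^sup>2)\<close>, which is smaller than every power of \<open>n\<close>.
\<close>

unbundle no vec_syntax

subsection \<open>The major index generating function\<close>

text \<open>The coefficients must be explicit formulas, the same for all \<open>x\<close>, while
  \<open>\<theta>\<close> moves with \<open>n\<close>. The expansion is therefore built as a formal
  series whose coefficients are functions of \<open>t\<close> and \<open>\<theta>\<close>, and the
  estimates run beside it at one fixed \<open>t\<close>. Formulas are polynomial in
  \<open>\<theta>\<close>, hence bounded on [0,1], which keeps the errors uniform in
  \<open>n\<close>; sums, products, powers and the exponential then have to preserve both layers.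
  The denominator of the inversion integral is 1 - exp(-w) = w exp(L(w) - w) with w = z/n, which
  accounts for the factor n + 1 and the term z/n in the exponent. Once n L_M(z) is split off, the
  order n^0 is (L(z) - z)/2 = H(z): the endpoint term of Euler-Maclaurin gives L(z)/2, and n L(z/n)
  gives z/2. Only derivatives of order at least one count as explicit, so the values of L_M and H at
  t must leave the series and go into the prefactor. Derivatives of L_D at 0, brought in by the
  lower endpoint and by the Taylor series of L(z/n), are shown to be rational.\<close>

definition rot :: "nat \<Rightarrow> nat \<Rightarrow> nat" where
  "rot n v = (if v \<in> {1..n} then (if v = n then 1 else v + 1) else v)"

lemma rot_permutes: "rot n permutes {1..n}"
proof (rule bij_imp_permutes)
  have "inj_on (rot n) {1..n}" by (auto simp: inj_on_def rot_def split: if_splits)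
  moreover have "rot n ` {1..n} \<subseteq> {1..n}" by (auto simp: rot_def)
  ultimately show "bij_betw (rot n) {1..n} {1..n}"
    by (metis endo_inj_surj finite_atLeastAtMost bij_betw_def)
qed (auto simp: rot_def)

lemma major_index_alt:
  "int (major_index n \<pi>) = (\<Sum>k=1..<n. if \<pi> k > \<pi> (k + 1) then int k else 0)"
proof -
  have "{k. k \<in> {1..n-1} \<and> \<pi> k > \<pi> (k + 1)} = {k \<in> {1..<n}. \<pi> k > \<pi> (k + 1)}" by auto
  then show ?thesis by (simp add: major_index_def sum.If_cases Int_def of_nat_sum)
qed

text \<open>Only the position \<open>k0\<close> of the maximal value changes its order relative to
  its neighbours: the maximum turns into the minimum. A descent at \<open>k0\<close> is lost, if
  \<open>k0 < n\<close>, and one at \<open>k0 - 1\<close> is gained, so the balance is -1, or n - 1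
  when \<open>k0 = n\<close>.\<close>

lemma major_index_rot:
  assumes p: "\<pi> permutes {1..n}" and n: "n \<ge> 1"
  shows "int (major_index n (rot n \<circ> \<pi>)) =
    int (major_index n \<pi>) + (if \<pi> n = n then int n - 1 else - 1)"
proof -
  obtain k0 where k0: "\<pi> k0 = n" using p by (metis permutes_surj surj_def)
  have k0in: "k0 \<in> {1..n}" using k0 n p by (metis atLeastAtMost_iff order_refl permutes_in_image)
  have inj: "inj \<pi>" using p by (rule permutes_inj)
  have step: "(if (rot n \<circ> \<pi>) k > (rot n \<circ> \<pi>) (k + 1) then int k else 0)
      = (if \<pi> k > \<pi> (k + 1) then int k else 0) + ((if k = k0 - 1 then int k else 0) - (if k = k0 then int k else 0))"
    if k: "k \<in> {1..<n}" for k
  proof -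
    have "k \<in> {1..n}" "k + 1 \<in> {1..n}" using k by auto
    then have a: "\<pi> k \<in> {1..n}" "\<pi> (k+1) \<in> {1..n}" using permutes_in_image[OF p] by blast+
    have b: "\<pi> k \<noteq> \<pi> (k+1)" using injD[OF inj, of k "k + 1"] by auto
    have c: "\<pi> k = n \<longleftrightarrow> k = k0" "\<pi> (k+1) = n \<longleftrightarrow> k + 1 = k0" using inj k0 by (auto simp: inj_def)
    show ?thesis using a b c k by (auto simp: rot_def)
  qed
  have "int (major_index n (rot n \<circ> \<pi>)) = (\<Sum>k=1..<n. (if \<pi> k > \<pi> (k + 1) then int k else 0)
       + ((if k = k0 - 1 then int k else 0) - (if k = k0 then int k else 0)))"
    unfolding major_index_alt by (rule sum.cong[OF refl step])
  also have "\<dots> = int (major_index n \<pi>) + ((\<Sum>k=1..<n. if k = k0 - 1 then int k else 0) - (\<Sum>k=1..<n. if k = k0 then int k else 0))"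
    by (simp only: major_index_alt sum.distrib sum_subtractf)
  \<comment> \<open>For \<open>k0 = 1\<close> there is no descent to gain: the index 0 lies outside
    the range, and the value \<open>k0 - 1 = 0\<close> is still right.\<close>
  also have "(\<Sum>k=1..<n. if k = k0 - 1 then int k else 0) = int k0 - 1"
    using k0in by (auto simp: sum.delta)
  \<comment> \<open>The second branch is just \<open>k0\<close>; the first records that the position
    n carries no descent.\<close>
  also have "(\<Sum>k=1..<n. if k = k0 then int k else 0) = (if k0 = n then 0 else int n - 1 + 1 - (int n - int k0))"
    using k0in by (auto simp: sum.delta)
  also have "(k0 = n) = (\<pi> n = n)" using k0 inj by (auto simp: inj_def)
  finally show ?thesis using \<open>(k0 = n) = (\<pi> n = n)\<close> by (simp only: split: if_splits) auto
qed

lemma rot_funpow_top: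
  assumes "j \<le> n"
  shows "(rot (Suc n) ^^ j) (Suc n) = (if j = 0 then Suc n else j)"
  using assms by (induction j) (auto simp: rot_def)

lemma rot_funpow_permutes: "(rot n ^^ j) permutes {1..n}"
proof (induction j)
  case (Suc j)
  then show ?case using permutes_compose[OF Suc.IH rot_permutes] by (simp only: funpow.simps)
qed (simp add: permutes_id[unfolded id_def])

text \<open>Extending by the fixed point n + 1 creates no descent. The first rotation starts from
  the last value n + 1 and adds n, each later one subtracts 1, so the increments along the orbit are
  0, n, n - 1, ..., 1.\<close>

lemma major_index_rot_funpow:
  assumes p: "\<pi> permutes {1..n}" and j: "j \<le> n"
  shows "int (major_index (Suc n) ((rot (Suc n) ^^ j) \<circ> \<pi>)) =
     int (major_index n \<pi>) + (if j = 0 then 0 else int (Suc n) - int j)"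
  using j
proof (induction j)
  case 0
  have top: "\<pi> (Suc n) = Suc n" using p by (auto simp: permutes_def)
  have "\<pi> n \<le> Suc n" using permutes_in_image[OF p, of n] p by (cases "n \<in> {1..n}") (auto simp: permutes_def)
  then show ?case using top by (simp add: major_index_alt)
next
  case (Suc j)
  have p': "\<pi> permutes {1..Suc n}" using p by (rule permutes_subset) auto
  have top: "\<pi> (Suc n) = Suc n" using p by (auto simp: permutes_def)
  have q: "((rot (Suc n) ^^ j) \<circ> \<pi>) permutes {1..Suc n}"
    by (intro permutes_compose p' rot_funpow_permutes)
  have "int (major_index (Suc n) (rot (Suc n) \<circ> ((rot (Suc n) ^^ j) \<circ> \<pi>))) =
     int (major_index (Suc n) ((rot (Suc n) ^^ j) \<circ> \<pi>)) + (if j = 0 then int (Suc n) - 1 else -1)"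
    using Suc.prems by (subst major_index_rot[OF q]) (auto simp: top rot_funpow_top)
  moreover have "rot (Suc n) ^^ Suc j \<circ> \<pi> = rot (Suc n) \<circ> ((rot (Suc n) ^^ j) \<circ> \<pi>)"
    by (simp add: fun_eq_iff)
  ultimately show ?case using Suc.IH Suc.prems by (simp only:) auto
qed

text \<open>The last value of a rotated permutation identifies \<open>j\<close>, which gives
  injectivity; surjectivity follows by counting, (n + 1) n! = (n + 1)!.\<close>

lemma bij_betw_rot_permutes:
  "bij_betw (\<lambda>(\<pi>, j). (rot (Suc n) ^^ j) \<circ> \<pi>) ({\<pi>. \<pi> permutes {1..n}} \<times> {0..n}) {\<pi>. \<pi> permutes {1..Suc n}}"
  (is "bij_betw ?f ?A ?B")
proof -
  have inj: "inj_on ?f ?A"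
  proof (rule inj_onI, clarify)
    fix \<pi> j \<pi>' j'
    assume p: "\<pi> permutes {1..n}" "\<pi>' permutes {1..n}" and j: "j \<in> {0..n}" "j' \<in> {0..n}"
      and eq: "(rot (Suc n) ^^ j) \<circ> \<pi> = (rot (Suc n) ^^ j') \<circ> \<pi>'"
    have "\<pi> (Suc n) = Suc n" "\<pi>' (Suc n) = Suc n" using p by (auto simp: permutes_def)
    with fun_cong[OF eq, of "Suc n"] j have jj: "j = j'" by (auto simp: rot_funpow_top split: if_splits)
    have "inj (rot (Suc n) ^^ j)" by (rule permutes_inj[OF rot_funpow_permutes])
    with eq jj show "\<pi> = \<pi>' \<and> j = j'" by (auto simp: fun_eq_iff inj_def)
  qed
  moreover have "?f ` ?A \<subseteq> ?B"
    by (auto intro!: permutes_compose rot_funpow_permutes intro: permutes_subset)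
  moreover have "card ?A = card ?B"
    by (simp add: card_cartesian_product card_permutations[OF refl])
  ultimately show ?thesis
    using card_image[OF inj] card_subset_eq[OF finite_permutations[of "{1..Suc n}"], of "?f ` ?A"]
    unfolding bij_betw_def by simp
qed

text \<open>Induction on n: every orbit of the rotation contributes the same new factor. The
  coefficient type is general because \<open>q\<close> will be the complex number
  \<open>exp z\<close>.\<close>

lemma major_index_gf:
  fixes q :: "'a :: comm_semiring_1"
  shows "(\<Sum>\<pi> | \<pi> permutes {1..n}. q ^ major_index n \<pi>) = (\<Prod>k=1..n. \<Sum>j<k. q ^ j)"
proof (induction n)
  case 0
  then show ?case by (simp add: major_index_def)
next
  case (Suc n)
  have inner: "(\<Sum>j\<in>{0..n}. q ^ major_index (Suc n) ((rot (Suc n) ^^ j) \<circ> \<pi>))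
      = q ^ major_index n \<pi> * (\<Sum>j<Suc n. q ^ j)" if p: "\<pi> permutes {1..n}" for \<pi>
  proof -
    have e: "major_index (Suc n) ((rot (Suc n) ^^ j) \<circ> \<pi>) = major_index n \<pi> + (if j = 0 then 0 else Suc n - j)"
      if "j \<in> {0..n}" for j
      using major_index_rot_funpow[OF p, of j] that by (auto split: if_splits simp: of_nat_diff)
    have "(\<Sum>j\<in>{0..n}. q ^ major_index (Suc n) ((rot (Suc n) ^^ j) \<circ> \<pi>))
       = (\<Sum>j\<in>{0..n}. q ^ major_index n \<pi> * q ^ (if j = 0 then 0 else Suc n - j))"
      by (rule sum.cong) (simp_all add: e power_add)
    also have "\<dots> = q ^ major_index n \<pi> * (\<Sum>j\<in>{0..n}. q ^ (if j = 0 then 0 else Suc n - j))"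
      by (simp add: sum_distrib_left)
    \<comment> \<open>The increments run through 0, n, ..., 1; the involution that sends j to n + 1
      - j and fixes 0 puts them in order.\<close>
    also have "(\<Sum>j\<in>{0..n}. q ^ (if j = 0 then 0 else Suc n - j)) = (\<Sum>j<Suc n. q ^ j)"
      by (rule sum.reindex_bij_witness[where i = "\<lambda>j. if j = 0 then 0 else Suc n - j"
            and j = "\<lambda>j. if j = 0 then 0 else Suc n - j"]) (auto split: if_splits)
    finally show ?thesis .
  qed
  have "(\<Sum>\<pi> | \<pi> permutes {1..Suc n}. q ^ major_index (Suc n) \<pi>)
     = (\<Sum>(\<pi>, j) \<in> {\<pi>. \<pi> permutes {1..n}} \<times> {0..n}. q ^ major_index (Suc n) ((rot (Suc n) ^^ j) \<circ> \<pi>))"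
    by (subst sum.reindex_bij_betw[OF bij_betw_rot_permutes, symmetric]) (simp add: case_prod_unfold)
  also have "\<dots> = (\<Sum>\<pi> | \<pi> permutes {1..n}. q ^ major_index n \<pi> * (\<Sum>j<Suc n. q ^ j))"
    by (subst sum.cartesian_product[symmetric]) (simp add: inner del: sum.lessThan_Suc)
  also have "\<dots> = (\<Prod>k=1..Suc n. \<Sum>j<k. q ^ j)"
    by (simp only: sum_distrib_right[symmetric] Suc.IH) (simp del: sum.lessThan_Suc)
  finally show ?case .
qed

text \<open>The moment generating function of M_n, with the factors kept separate so that each can
  be estimated, or replaced by the exponential of a logarithm.\<close>

definition maj_mgf :: "nat \<Rightarrow> complex \<Rightarrow> complex" where
  "maj_mgf n z = (\<Prod>k=1..n. (\<Sum>j<k. exp z ^ j) / of_nat k)"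

lemma maj_mgf_eq: "maj_mgf n z = (\<Sum>\<pi> | \<pi> permutes {1..n}. exp (of_nat (major_index n \<pi>) * z)) / fact n"
proof -
  have "maj_mgf n z = (\<Prod>k=1..n. \<Sum>j<k. exp z ^ j) / fact n"
    unfolding maj_mgf_def by (simp add: prod_dividef fact_prod)
  also have "(\<Prod>k=1..n. \<Sum>j<k. exp z ^ j) = (\<Sum>\<pi> | \<pi> permutes {1..n}. exp z ^ major_index n \<pi>)"
    by (rule major_index_gf[symmetric])
  finally show ?thesis by (simp add: exp_of_nat_mult)
qed

lemma prob_major_index:
  "measure_pmf.prob (major_index_pmf n) {M. N \<le> M} = (\<Sum>\<pi> | \<pi> permutes {1..n}. of_bool (N \<le> major_index n \<pi>)) / fact n"
proof -
  let ?S = "{\<pi>. \<pi> permutes {1..n}}"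
  have fin: "finite ?S" "?S \<noteq> {}" by (auto intro: finite_permutations permutes_id)
  have "measure_pmf.prob (major_index_pmf n) {M. N \<le> M} = real (card (?S \<inter> (major_index n -` {M. N \<le> M}))) / real (card ?S)"
    unfolding major_index_pmf_def measure_map_pmf using fin by (subst measure_pmf_of_set) auto
  also have "card ?S = fact n" by (simp add: card_permutations[OF refl])
  also have "real (card (?S \<inter> (major_index n -` {M. N \<le> M}))) = (\<Sum>\<pi>\<in>?S. of_bool (N \<le> major_index n \<pi>))"
    using fin by (subst sum_of_bool_eq) (auto simp: Int_def)
  finally show ?thesis by simp
qed

section \<open>Fourier inversion for the tail probability\<close>

lemma integral_exp_int:
  fixes m :: int
  shows "integral {-pi..pi} (\<lambda>a. exp (\<i> * (of_int m * complex_of_real a))) = (if m = 0 then 2 * pi else 0)"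
proof (cases "m = 0")
  case False
  let ?F = "\<lambda>a. exp (\<i> * (of_int m * complex_of_real a)) / (\<i> * of_int m)"
  have "((\<lambda>a. exp (\<i> * (of_int m * complex_of_real a))) has_integral (?F pi - ?F (-pi))) {-pi..pi}"
    by (rule fundamental_theorem_of_calculus)
      (use False in \<open>auto intro!: derivative_eq_intros has_vector_derivative_real_field simp: field_simps\<close>)
  moreover have "exp (\<i> * (of_int m * complex_of_real pi)) = exp (\<i> * (of_int m * complex_of_real (-pi)))"
    by (subst exp_eq) (rule exI[of _ m], simp)
  ultimately show ?thesis using False by (auto dest: integral_unique)
qed (simp add: scaleR_conv_of_real)

text \<open>Only the terms of the geometric series with \<open>m - N = j\<close> survive the integration.\<close>

lemma integral_tail_kernel:
  fixes m N :: nat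
  assumes "\<tau> > 0"
  shows "((\<lambda>a. exp ((of_nat m - of_nat N) * Complex \<tau> a) / (1 - exp (- Complex \<tau> a)))
      has_integral of_real (2 * pi * of_bool (N \<le> m))) {-pi..pi}"
proof -
  define g where "g = (\<lambda>j a. exp ((of_nat m - of_nat N - of_nat j) * Complex \<tau> a))"
  have g_int: "(g j has_integral of_real (2 * pi * of_bool (m = N + j))) {-pi..pi}" for j
  proof -
    have geq: "g j a = exp (of_int (int m - int N - int j) * of_real \<tau>) * exp (\<i> * (of_int (int m - int N - int j) * complex_of_real a))" for a
      by (simp add: g_def Complex_eq exp_add[symmetric] algebra_simps)
    have "integral {-pi..pi} (g j) = exp (of_int (int m - int N - int j) * of_real \<tau>) * complex_of_real (if int m - int N - int j = 0 then 2 * pi else 0)"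
      unfolding geq integral_mult_right integral_exp_int by simp
    also have "\<dots> = of_real (2 * pi * of_bool (m = N + j))"
    proof (cases "m = N + j")
      case False
      then have "int m - int N - int j \<noteq> 0" by linarith
      then show ?thesis using False by (simp only: if_False) simp
    next
      case True
      then have "int m - int N - int j = 0" by simp
      then show ?thesis using True by (simp only: if_True of_int_0) simp
    qed
    finally have "integral {-pi..pi} (g j) = of_real (2 * pi * of_bool (m = N + j))" .
    moreover have "g j integrable_on {-pi..pi}" unfolding geq
      by (intro integrable_continuous_real continuous_intros)
    ultimately show ?thesis by (metis has_integral_integral)
  qed
  \<comment> \<open>Partial sums of the geometric series of 1/(1 - exp(-w)), w =
    \<open>Complex \<tau> a\<close>, which converges because Re w is positive.\<close>
  define f where "f = (\<lambda>J a. \<Sum>j<J. g j a)"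
  have f_int: "(f J has_integral of_real (2 * pi * of_bool (N \<le> m \<and> m < N + J))) {-pi..pi}" for J
  proof -
    have "(f J has_integral (\<Sum>j<J. of_real (2 * pi * of_bool (m = N + j)))) {-pi..pi}"
      unfolding f_def by (intro has_integral_sum g_int) auto
    also have "(\<Sum>j<J. of_real (2 * pi * of_bool (m = N + j))) = (of_real (2 * pi * of_bool (N \<le> m \<and> m < N + J)) :: complex)"
    proof (cases "N \<le> m")
      case True
      then have "(m = N + j) = (j = m - N)" for j by auto
      then show ?thesis using True by (simp add: sum.delta' of_bool_def if_distrib cong: if_cong) auto
    qed simp
    finally show ?thesis .
  qed
  define q where "q = (\<lambda>a. exp (- Complex \<tau> a))"
  have nq: "cmod (q a) = exp (-\<tau>)" for a by (simp add: q_def norm_exp_eq_Re)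
  have q1: "exp (-\<tau>) < 1" using assms by simp
  define G where "G = (\<lambda>a. exp ((of_nat m - of_nat N) * Complex \<tau> a))"
  have geo: "f J a = G a * (1 - q a ^ J) / (1 - q a)" for J a
  proof -
    have "q a \<noteq> 1" using nq[of a] q1 by force
    moreover have "g j a = G a * q a ^ j" for j
      by (simp add: g_def G_def q_def exp_of_nat_mult[symmetric] exp_add[symmetric] algebra_simps)
    ultimately show ?thesis by (simp add: f_def sum_distrib_left[symmetric] sum_gp_strict)
  qed
  have qc: "1 - q a \<noteq> 0" for a using nq[of a] q1 by force
  have cont: "continuous_on {-pi..pi} (\<lambda>a. G a / (1 - q a))"
    unfolding G_def q_def Complex_eq by (intro continuous_intros) (use qc in \<open>auto simp: q_def Complex_eq\<close>)
  \<comment> \<open>Bounds the partial sums independently of \<open>J\<close>: |1 - q^J| is at most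
    2 and the denominator at least 1 - exp(-\<tau>). This provides the dominating constant.\<close>
  define K where "K = exp (\<bar>of_nat m - of_nat N\<bar> * \<tau>) / (1 - exp (-\<tau>))"
  have bound: "cmod (f J a) \<le> 2 * K" for J a
  proof -
    have a1: "cmod (G a) \<le> exp (\<bar>of_nat m - of_nat N\<bar> * \<tau>)"
      using assms by (auto simp: G_def norm_exp_eq_Re intro!: mult_right_mono)
    have a2: "cmod (1 - q a ^ J) \<le> 2"
      using norm_triangle_ineq4[of 1 "q a ^ J"] power_le_one[of "exp (-\<tau>)" J] q1 by (simp add: norm_power nq)
    have a3: "1 - exp (-\<tau>) \<le> cmod (1 - q a)"
      using norm_triangle_ineq2[of 1 "q a"] by (simp add: nq)
    have "cmod (f J a) = cmod (G a) * cmod (1 - q a ^ J) / cmod (1 - q a)"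
      by (simp add: geo norm_mult norm_divide)
    also have "\<dots> \<le> (exp (\<bar>of_nat m - of_nat N\<bar> * \<tau>) * 2) / (1 - exp (-\<tau>))"
      using q1 a1 a2 a3 by (intro frac_le mult_mono) auto
    finally show ?thesis by (simp add: K_def mult.commute)
  qed
  have lim: "(\<lambda>J. f J a) \<longlonglongrightarrow> G a / (1 - q a)" for a
  proof -
    have "(\<lambda>J. q a ^ J) \<longlonglongrightarrow> 0" by (rule LIMSEQ_power_zero) (use q1 nq in simp)
    then have "(\<lambda>J. G a * (1 - q a ^ J) / (1 - q a)) \<longlonglongrightarrow> G a * (1 - 0) / (1 - q a)"
      using qc by (intro tendsto_divide tendsto_mult tendsto_diff tendsto_const) auto
    then show ?thesis by (simp add: geo)
  qed
  have dom: "(\<lambda>J. integral {-pi..pi} (f J)) \<longlonglongrightarrow> integral {-pi..pi} (\<lambda>a. G a / (1 - q a))"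
  proof (rule dominated_convergence(2)[where h="\<lambda>_. 2 * K"])
    show "f J integrable_on {-pi..pi}" for J using f_int by blast
    show "(\<lambda>_. 2 * K) integrable_on {-pi..pi}" by (rule integrable_const_ivl)
    show "norm (f J a) \<le> 2 * K" for J a by (rule bound)
    show "(\<lambda>J. f J a) \<longlonglongrightarrow> G a / (1 - q a)" for a by (rule lim)
  qed
  have "eventually (\<lambda>J. integral {-pi..pi} (f J) = of_real (2 * pi * of_bool (N \<le> m))) sequentially"
    using eventually_gt_at_top[of m] by eventually_elim (simp add: f_int[THEN integral_unique] trans_less_add2)
  then have "(\<lambda>J. integral {-pi..pi} (f J)) \<longlonglongrightarrow> of_real (2 * pi * of_bool (N \<le> m))"
    by (rule tendsto_eventually)
  with dom have "integral {-pi..pi} (\<lambda>a. G a / (1 - q a)) = of_real (2 * pi * of_bool (N \<le> m))"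
    by (rule LIMSEQ_unique)
  then show ?thesis using integrable_continuous_real[OF cont]
    by (simp add: G_def q_def has_integral_iff)
qed

text \<open>The kernel identity averaged over all permutations. The real part \<open>\<tau>\<close>
  of the contour is still free; it will be the saddle point divided by n.\<close>

lemma prob_major_index_integral:
  assumes "\<tau> > 0"
  shows "((\<lambda>a. maj_mgf n (Complex \<tau> a) * exp (- of_nat N * Complex \<tau> a) / (1 - exp (- Complex \<tau> a)))
      has_integral of_real (2 * pi * measure_pmf.prob (major_index_pmf n) {M. N \<le> M})) {-pi..pi}"
proof -
  have "((\<lambda>a. (\<Sum>\<pi> | \<pi> permutes {1..n}. exp ((of_nat (major_index n \<pi>) - of_nat N) * Complex \<tau> a) / (1 - exp (- Complex \<tau> a))) / fact n)
      has_integral (\<Sum>\<pi> | \<pi> permutes {1..n}. of_real (2 * pi * of_bool (N \<le> major_index n \<pi>))) / fact n) {-pi..pi}"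
    by (intro has_integral_divide has_integral_sum integral_tail_kernel assms finite_permutations) auto
  also have "(\<lambda>a. (\<Sum>\<pi> | \<pi> permutes {1..n}. exp ((of_nat (major_index n \<pi>) - of_nat N) * Complex \<tau> a) / (1 - exp (- Complex \<tau> a))) / fact n)
     = (\<lambda>a. maj_mgf n (Complex \<tau> a) * exp (- of_nat N * Complex \<tau> a) / (1 - exp (- Complex \<tau> a)))"
  proof (rule ext)
    fix a
    have "exp ((of_nat (major_index n \<pi>) - of_nat N) * Complex \<tau> a) = exp (of_nat (major_index n \<pi>) * Complex \<tau> a) * exp (- of_nat N * Complex \<tau> a)" for \<pi>
      by (simp add: exp_add[symmetric] left_diff_distrib)
    then show "(\<Sum>\<pi> | \<pi> permutes {1..n}. exp ((of_nat (major_index n \<pi>) - of_nat N) * Complex \<tau> a) / (1 - exp (- Complex \<tau> a))) / fact n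
     = maj_mgf n (Complex \<tau> a) * exp (- of_nat N * Complex \<tau> a) / (1 - exp (- Complex \<tau> a))"
      by (simp only: maj_mgf_eq sum_divide_distrib[symmetric] sum_distrib_right[symmetric]) simp
  qed
  also have "(\<Sum>\<pi> | \<pi> permutes {1..n}. of_real (2 * pi * of_bool (N \<le> major_index n \<pi>))) / fact n
     = complex_of_real (2 * pi * measure_pmf.prob (major_index_pmf n) {M. N \<le> M})"
    by (simp add: prob_major_index sum_distrib_left)
  finally show ?thesis .
qed

section \<open>Decay of the characteristic function away from the saddle point\<close>

lemma jordan_sin_lower:
  assumes "0 \<le> y" "y \<le> pi / 2"
  shows "2 / pi * y \<le> sin y"
proof -
  \<comment> \<open>Concavity of sin on this interval puts its graph above the chord from 0 to
    pi/2.\<close>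
  have "convex_on {0..pi/2} (\<lambda>y. - sin y)"
  proof (rule f''_ge0_imp_convex[where f' = "\<lambda>y. - cos y" and f'' = sin])
    fix y :: real assume "y \<in> {0..pi/2}"
    then show "sin y \<ge> 0" by (intro sin_ge_zero) auto
  qed (auto intro!: derivative_eq_intros)
  from convex_onD[OF this, of "2 / pi * y" 0 "pi / 2"] assms show ?thesis
    by (simp add: field_simps)
qed

lemma one_minus_cos_lower:
  assumes "\<bar>x\<bar> \<le> pi"
  shows "2 / pi\<^sup>2 * x\<^sup>2 \<le> 1 - cos x"
proof -
  have "2 / pi * (\<bar>x\<bar> / 2) \<le> sin (\<bar>x\<bar> / 2)" using assms by (intro jordan_sin_lower) auto
  then have "(\<bar>x\<bar> / pi)\<^sup>2 \<le> (sin (\<bar>x\<bar> / 2))\<^sup>2" by (intro power_mono) auto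
  moreover have "1 - cos x = 2 * (sin (\<bar>x\<bar> / 2))\<^sup>2"
    using cos_double_sin[of "\<bar>x\<bar> / 2"] by simp
  ultimately show ?thesis by (simp add: power_divide)
qed

text \<open>In this form the square of the total weight exceeds the squared modulus by a double sum
  of weights times 1 - cos \<ge> 0, so two systems of weights can be compared term by term.\<close>

lemma cmod_trig_sum_square:
  fixes p :: "nat \<Rightarrow> real"
  shows "(cmod (\<Sum>j<k. of_real (p j) * exp (\<i> * of_real (real j * a))))\<^sup>2 = (\<Sum>i<k. \<Sum>j<k. p i * p j * cos ((real i - real j) * a))"
proof -
  have re: "Re (\<Sum>j<k. of_real (p j) * exp (\<i> * of_real (real j * a))) = (\<Sum>j<k. p j * cos (real j * a))"
    and im: "Im (\<Sum>j<k. of_real (p j) * exp (\<i> * of_real (real j * a))) = (\<Sum>j<k. p j * sin (real j * a))"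
    by (simp_all add: Re_exp Im_exp)
  have "(cmod (\<Sum>j<k. of_real (p j) * exp (\<i> * of_real (real j * a))))\<^sup>2
      = (\<Sum>j<k. p j * cos (real j * a)) * (\<Sum>j<k. p j * cos (real j * a)) + (\<Sum>j<k. p j * sin (real j * a)) * (\<Sum>j<k. p j * sin (real j * a))"
    unfolding cmod_power2 re im by (simp add: power2_eq_square)
  also have "\<dots> = (\<Sum>i<k. \<Sum>j<k. p i * p j * (cos (real i * a) * cos (real j * a) + sin (real i * a) * sin (real j * a)))"
    by (simp only: sum_product sum.distrib[symmetric]) (intro sum.cong refl, simp add: algebra_simps)
  also have "\<dots> = (\<Sum>i<k. \<Sum>j<k. p i * p j * cos ((real i - real j) * a))"
    by (simp add: left_diff_distrib cos_diff)
  finally show ?thesis .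
qed

text \<open>This is k times the modulus of the characteristic function of the uniform law on
  {0..<k}.\<close>

definition dirichlet_norm :: "nat \<Rightarrow> real \<Rightarrow> real" where
  "dirichlet_norm k a = cmod (\<Sum>j<k. exp (\<i> * of_real (real j * a)))"

lemma dirichlet_norm_square: "(dirichlet_norm k a)\<^sup>2 = (\<Sum>i<k. \<Sum>j<k. cos ((real i - real j) * a))"
  using cmod_trig_sum_square[where p = "\<lambda>_. 1" and k = k and a = a] unfolding dirichlet_norm_def by (simp only: mult_1_left of_real_1)

lemma dirichlet_norm_le: "dirichlet_norm k a \<le> real k"
  unfolding dirichlet_norm_def by (rule order_trans[OF norm_sum]) simp

lemma square_minus_dirichlet: "(real k)\<^sup>2 - (dirichlet_norm k a)\<^sup>2 = (\<Sum>i<k. \<Sum>j<k. 1 - cos ((real i - real j) * a))"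
  by (simp add: dirichlet_norm_square sum_subtractf) (simp add: power2_eq_square)

lemma sum_square_differences: "(\<Sum>i<k. \<Sum>j<k. (real i - real j)\<^sup>2) = (real k)\<^sup>2 * ((real k)\<^sup>2 - 1) / 6"
proof -
  have 1: "(\<Sum>i<k. real i) = real k * (real k - 1) / 2" by (induction k) (auto simp: field_simps)
  have 2: "(\<Sum>i<k. (real i)\<^sup>2) = (real k - 1) * real k * (2 * real k - 1) / 6"
    by (induction k) (auto simp: field_simps power2_eq_square)
  have "(\<Sum>i<k. \<Sum>j<k. (real i - real j)\<^sup>2) = (\<Sum>i<k. \<Sum>j<k. (real i)\<^sup>2 + (real j)\<^sup>2 - 2 * (real i * real j))"
    by (simp add: power2_diff mult.assoc)
  also have "\<dots> = 2 * real k * (\<Sum>i<k. (real i)\<^sup>2) - 2 * ((\<Sum>i<k. real i) * (\<Sum>i<k. real i))"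
    by (simp add: sum_subtractf sum.distrib sum_distrib_left[symmetric] sum_distrib_right[symmetric])
  finally show ?thesis unfolding 1 2 by (simp add: field_simps power2_eq_square)
qed

text \<open>All phases (i - j) a lie in [-pi, pi], where 1 - cos has a quadratic lower
  bound.\<close>

lemma dirichlet_small:
  assumes "2 \<le> k" "real k * \<bar>a\<bar> \<le> pi"
  shows "1 - (dirichlet_norm k a / real k)\<^sup>2 \<ge> (real k * a)\<^sup>2 / 80"
proof -
  have "2 / pi\<^sup>2 * a\<^sup>2 * ((real k)\<^sup>2 * ((real k)\<^sup>2 - 1) / 6) = (\<Sum>i<k. \<Sum>j<k. 2 / pi\<^sup>2 * ((real i - real j) * a)\<^sup>2)"
    unfolding sum_square_differences[symmetric] by (simp add: sum_distrib_left power_mult_distrib mult_ac sum_divide_distrib)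
  also have "\<dots> \<le> (\<Sum>i<k. \<Sum>j<k. 1 - cos ((real i - real j) * a))"
  proof (intro sum_mono one_minus_cos_lower)
    fix i j assume "i \<in> {..<k}" "j \<in> {..<k}"
    then have "\<bar>(real i - real j) * a\<bar> \<le> real k * \<bar>a\<bar>" unfolding abs_mult by (intro mult_right_mono) auto
    then show "\<bar>(real i - real j) * a\<bar> \<le> pi" using assms by simp
  qed
  also have "\<dots> = (real k)\<^sup>2 - (dirichlet_norm k a)\<^sup>2" by (rule square_minus_dirichlet[symmetric])
  finally have m: "2 / pi\<^sup>2 * a\<^sup>2 * ((real k)\<^sup>2 * ((real k)\<^sup>2 - 1) / 6) \<le> (real k)\<^sup>2 - (dirichlet_norm k a)\<^sup>2" .
  \<comment> \<open>With pi < 4 and k \<ge> 2 the constant is (2/16)(3/4)/6 = 1/64; the stated 1/80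
    leaves slack.\<close>
  have pi: "pi\<^sup>2 \<le> 16" using pi_less_4 pi_ge_zero power_mono[of pi 4 2] by simp
  have k4: "(real k)\<^sup>2 - 1 \<ge> 3/4 * (real k)\<^sup>2" using assms(1) power_mono[of 2 "real k" 2] by simp
  have "(real k)\<^sup>2 * ((real k * a)\<^sup>2 / 80) \<le> 2 / 16 * a\<^sup>2 * ((real k)\<^sup>2 * (3/4 * (real k)\<^sup>2) / 6)"
  proof -
    have "(real k)\<^sup>2 * ((real k * a)\<^sup>2 / 80) = (a\<^sup>2 * ((real k)\<^sup>2 * (real k)\<^sup>2)) * (1 / 80)"
      by (simp add: power_mult_distrib)
    also have "\<dots> \<le> (a\<^sup>2 * ((real k)\<^sup>2 * (real k)\<^sup>2)) * (1 / 64)"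
      by (intro mult_left_mono) auto
    finally show ?thesis by simp
  qed
  also have "\<dots> \<le> 2 / pi\<^sup>2 * a\<^sup>2 * ((real k)\<^sup>2 * ((real k)\<^sup>2 - 1) / 6)"
    using pi k4 assms(1) by (intro mult_mono divide_left_mono divide_right_mono) auto
  also note m
  finally have "(real k * a)\<^sup>2 / 80 \<le> ((real k)\<^sup>2 - (dirichlet_norm k a)\<^sup>2) / (real k)\<^sup>2"
    using assms(1) by (simp add: pos_le_divide_eq mult.commute)
  also have "\<dots> = 1 - (dirichlet_norm k a / real k)\<^sup>2" using assms(1) by (simp add: diff_divide_distrib power_divide)
  finally show ?thesis .
qed

text \<open>The geometric sum has modulus at most 2/|exp(ia) - 1| \<le> pi/|a|, so the normalised
  modulus is at most 2/3 and the gap at least 5/9.\<close>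

lemma dirichlet_large:
  assumes "real k * \<bar>a\<bar> \<ge> 3 * pi / 2" "\<bar>a\<bar> \<le> pi"
  shows "1 - (dirichlet_norm k a / real k)\<^sup>2 \<ge> 1 / 2"
proof -
  have a0: "a \<noteq> 0" and k0: "k > 0" using assms pi_gt_zero by (auto intro!: Nat.gr0I simp del: pi_gt_zero)
  have "2 / pi * (\<bar>a\<bar> / 2) \<le> sin (\<bar>a\<bar> / 2)" using assms by (intro jordan_sin_lower) auto
  then have s: "\<bar>a\<bar> / pi \<le> \<bar>sin (a / 2)\<bar>" by (cases "a \<ge> 0") auto
  then have n: "cmod (exp (\<i> * of_real a) - 1) \<ge> 2 * \<bar>a\<bar> / pi" unfolding dist_exp_i_1 by simp
  have pos: "2 * \<bar>a\<bar> / pi > 0" using a0 by simp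
  have ne: "exp (\<i> * of_real a) \<noteq> 1" using n pos by fastforce
  have "(\<Sum>j<k. exp (\<i> * of_real (real j * a))) = (\<Sum>j<k. exp (\<i> * of_real a) ^ j)"
    by (intro sum.cong refl) (simp add: exp_of_nat_mult[symmetric] mult_ac)
  also have "\<dots> = (exp (\<i> * of_real a) ^ k - 1) / (exp (\<i> * of_real a) - 1)"
    using geometric_sum[OF ne] by simp
  finally have "dirichlet_norm k a = cmod (exp (\<i> * of_real a) ^ k - 1) / cmod (exp (\<i> * of_real a) - 1)"
    by (simp add: dirichlet_norm_def norm_divide)
  also have "\<dots> \<le> 2 / (2 * \<bar>a\<bar> / pi)"
  proof (rule frac_le)
    show "cmod (exp (\<i> * of_real a) ^ k - 1) \<le> 2"
      using norm_triangle_ineq4[of "exp (\<i> * of_real a) ^ k" 1] by (simp add: norm_power)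
  qed (use n pos in auto)
  also have "\<dots> = pi / \<bar>a\<bar>" using a0 by simp
  finally have "dirichlet_norm k a / real k \<le> pi / \<bar>a\<bar> / real k" using k0 by (intro divide_right_mono) auto
  also have "\<dots> = pi / (real k * \<bar>a\<bar>)" by (simp add: mult.commute)
  also have "\<dots> \<le> pi / (3 * pi / 2)" using assms by (intro divide_left_mono) (auto intro: mult_pos_pos simp: a0 k0)
  finally have "dirichlet_norm k a / real k \<le> 2 / 3" by simp
  moreover have "0 \<le> dirichlet_norm k a / real k" by (simp add: dirichlet_norm_def)
  ultimately have "(dirichlet_norm k a / real k)\<^sup>2 \<le> (2/3)\<^sup>2" by (intro power_mono)
  then show ?thesis by (simp add: power2_eq_square)
qed

text \<open>Tilting by weights in \<open>[1, e\<^sup>t]\<close> costs at most a factor \<open>e\<^sup>2\<^sup>t\<close> in the gap \<open>1 - |\<phi>|\<^sup>2\<close> of the characteristic function.\<close>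

lemma tilted_sum_bound:
  assumes \<tau>: "0 \<le> \<tau>" "real k * \<tau> \<le> t" and k: "k \<ge> 1"
  shows "cmod (\<Sum>j<k. exp (Complex \<tau> a) ^ j) \<le> cmod (\<Sum>j<k. exp (of_real \<tau>) ^ j) * exp (- (exp (- 2 * t) * (1 - (dirichlet_norm k a / real k)\<^sup>2)) / 2)"
proof -
  define p where "p = (\<lambda>j::nat. exp (real j * \<tau>))"
  define A where "A = (\<Sum>j<k. p j)"
  define q where "q = exp (- 2 * t) * (1 - (dirichlet_norm k a / real k)\<^sup>2)"
  have p1: "p j \<ge> 1" for j using \<tau> by (simp add: p_def)
  have pt: "p j \<le> exp t" if "j < k" for j
  proof -
    have "real j * \<tau> \<le> real k * \<tau>" using that \<tau> by (intro mult_right_mono) auto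
    then show ?thesis using \<tau> by (simp add: p_def)
  qed
  have e1: "(\<Sum>j<k. exp (Complex \<tau> a) ^ j) = (\<Sum>j<k. of_real (p j) * exp (\<i> * of_real (real j * a)))"
    by (intro sum.cong refl) (simp add: p_def Complex_eq exp_of_nat_mult[symmetric] exp_of_real[symmetric] exp_add[symmetric] algebra_simps)
  have "(\<Sum>j<k. exp (of_real \<tau>) ^ j) = complex_of_real A"
    by (simp add: A_def p_def exp_of_nat_mult exp_of_real[symmetric])
  moreover have A0: "A \<ge> 0" unfolding A_def by (intro sum_nonneg) (use p1 in \<open>auto intro: order_trans[of 0 1]\<close>)
  ultimately have e2: "cmod (\<Sum>j<k. exp (of_real \<tau>) ^ j) = A" by simp
  have Ak: "A \<le> real k * exp t" unfolding A_def using sum_bounded_above[of "{..<k}" p "exp t"] pt by simp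
  \<comment> \<open>The total tilted weight is at most k exp t; the factor exp(-2t) in
    \<open>q\<close> compensates for its square.\<close>
  have "A\<^sup>2 * q \<le> (real k * exp t)\<^sup>2 * q"
  proof (intro mult_right_mono power_mono Ak A0)
    have "(dirichlet_norm k a / real k)\<^sup>2 \<le> 1\<^sup>2"
      using dirichlet_norm_le[of k a] k by (intro power_mono) (auto simp: dirichlet_norm_def)
    then show "q \<ge> 0" by (simp add: q_def)
  qed
  also have "\<dots> = (real k)\<^sup>2 - (dirichlet_norm k a)\<^sup>2"
    using k by (simp add: q_def power_mult_distrib power_divide exp_minus field_simps exp_double[symmetric])
  also have "\<dots> = (\<Sum>i<k. \<Sum>j<k. 1 - cos ((real i - real j) * a))" by (rule square_minus_dirichlet)
  \<comment> \<open>Every weight is at least 1 and every 1 - cos is nonnegative, so tilting can only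
    enlarge the unnormalised gap.\<close>
  also have "\<dots> \<le> (\<Sum>i<k. \<Sum>j<k. p i * p j * (1 - cos ((real i - real j) * a)))"
  proof (intro sum_mono)
    fix i j
    have "1 * (1 - cos ((real i - real j) * a)) \<le> p i * p j * (1 - cos ((real i - real j) * a))"
      using mult_mono[OF p1[of i] p1[of j]] p1[of i] by (intro mult_right_mono) auto
    then show "1 - cos ((real i - real j) * a) \<le> p i * p j * (1 - cos ((real i - real j) * a))" by simp
  qed
  also have "\<dots> = A\<^sup>2 - (cmod (\<Sum>j<k. exp (Complex \<tau> a) ^ j))\<^sup>2"
    unfolding e1 cmod_trig_sum_square by (simp add: A_def power2_eq_square sum_product right_diff_distrib sum_subtractf)
  finally have "(cmod (\<Sum>j<k. exp (Complex \<tau> a) ^ j))\<^sup>2 \<le> A\<^sup>2 * (1 - q)" by (simp add: algebra_simps)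
  \<comment> \<open>Here 1 - q \<le> exp(-q) is used; the square root taken next halves the
    exponent.\<close>
  also have "\<dots> \<le> A\<^sup>2 * exp (- q)" using exp_ge_add_one_self[of "- q"] by (intro mult_left_mono) auto
  also have "\<dots> = (A * exp (- q / 2))\<^sup>2" by (simp add: power_mult_distrib exp_double[symmetric])
  finally show ?thesis unfolding e2 q_def[symmetric] using A0 by (simp add: power2_le_iff_abs_le)
qed

text \<open>A fixed proportion of the factors contracts. If n|a| \<le> 2 pi, those with n/4 < k
  \<le> n/2 satisfy k|a| \<le> pi; otherwise those with k \<ge> 3n/4 satisfy k|a| \<ge> 3 pi/2.
  These are the cases of \<open>dirichlet_small\<close> and \<open>dirichlet_large\<close>.\<close>

lemma maj_mgf_tail_bound:
  assumes t: "t > 0"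
  shows "\<exists>c>0. \<forall>n\<ge>8. \<forall>a. \<bar>a\<bar> \<le> pi \<longrightarrow>
    cmod (maj_mgf n (Complex (t / real n) a)) \<le> cmod (maj_mgf n (of_real (t / real n))) * exp (- c * real n * min 1 ((real n * a)\<^sup>2))"
proof (intro exI conjI allI impI)
  \<comment> \<open>The factor 1/2 is the halved exponent of \<open>tilted_sum_bound\<close>, 1/8
    the proportion of useful factors. The number 2000 exceeds 16 times 80: passing from ka to na
    with k \<ge> n/4 costs 16, and 80 is the constant of \<open>dirichlet_small\<close>.\<close>
  show "exp (- 2 * t) / 2 / 8 / 2000 > 0" by simp
  fix n :: nat and a :: real assume n: "8 \<le> n" and a: "\<bar>a\<bar> \<le> pi"
  define q where "q = (\<lambda>k. exp (- 2 * t) * (1 - (dirichlet_norm k a / real k)\<^sup>2) / 2)"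
  have q0: "q k \<ge> 0" if "k \<ge> 1" for k
  proof -
    have "(dirichlet_norm k a / real k)\<^sup>2 \<le> 1\<^sup>2"
      using dirichlet_norm_le[of k a] that by (intro power_mono) (auto simp: dirichlet_norm_def)
    then show ?thesis by (simp add: q_def)
  qed
  define m where "m = min 1 ((real n * a)\<^sup>2)"
  have m: "0 \<le> m" "m \<le> 1" "m \<le> (real n * a)\<^sup>2" by (auto simp: m_def)
  have "cmod (maj_mgf n (Complex (t / real n) a)) = (\<Prod>k=1..n. cmod (\<Sum>j<k. exp (Complex (t / real n) a) ^ j) / real k)"
    by (simp add: maj_mgf_def prod_norm[symmetric] norm_divide)
  also have "\<dots> \<le> (\<Prod>k=1..n. (cmod (\<Sum>j<k. exp (of_real (t / real n)) ^ j) * exp (- q k)) / real k)"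
  proof (rule prod_mono, intro conjI)
    fix k assume k: "k \<in> {1..n}"
    have "real k * (t / real n) \<le> t" using k t n by (simp add: field_simps)
    from tilted_sum_bound[OF _ this, of a] k t
    show "cmod (\<Sum>j<k. exp (Complex (t / real n) a) ^ j) / real k \<le> cmod (\<Sum>j<k. exp (of_real (t / real n)) ^ j) * exp (- q k) / real k"
      by (intro divide_right_mono) (auto simp: q_def)
  qed auto
  also have "\<dots> = cmod (maj_mgf n (of_real (t / real n))) * exp (- (\<Sum>k=1..n. q k))"
    by (simp add: maj_mgf_def prod_norm[symmetric] norm_divide prod_dividef prod.distrib exp_sum sum_negf[symmetric])
  also have "\<dots> \<le> cmod (maj_mgf n (of_real (t / real n))) * exp (- (exp (- 2 * t) / 2 / 8 / 2000) * real n * m)"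
  proof -
    have qlow: "q k \<ge> exp (- 2 * t) / 2 * (m / 2000)" if "1 - (dirichlet_norm k a / real k)\<^sup>2 \<ge> m / 2000" for k
      using that by (simp add: q_def)
    have low: "(\<Sum>k=1..n. q k) \<ge> real (card I) * (exp (- 2 * t) / 2 * (m / 2000))"
      if I: "I \<subseteq> {1..n}" and "\<And>k. k \<in> I \<Longrightarrow> 1 - (dirichlet_norm k a / real k)\<^sup>2 \<ge> m / 2000" for I
    proof -
      have "real (card I) * (exp (- 2 * t) / 2 * (m / 2000)) \<le> (\<Sum>k\<in>I. q k)"
        using sum_bounded_below[of I "exp (- 2 * t) / 2 * (m / 2000)" q] qlow that(2) by simp
      also have "\<dots> \<le> (\<Sum>k=1..n. q k)" using I q0 by (intro sum_mono2) auto
      finally show ?thesis .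
    qed
    have "\<exists>I. I \<subseteq> {1..n} \<and> real (card I) \<ge> real n / 8 \<and> (\<forall>k\<in>I. 1 - (dirichlet_norm k a / real k)\<^sup>2 \<ge> m / 2000)"
    proof (cases "real n * \<bar>a\<bar> \<le> 2 * pi")
      case True
      show ?thesis
      proof (intro exI[of _ "{Suc (n div 4)..n div 2}"] conjI ballI)
        show "real (card {Suc (n div 4)..n div 2}) \<ge> real n / 8" using n by auto
        fix k assume k: "k \<in> {Suc (n div 4)..n div 2}"
        have k1: "2 * real k \<le> real n" "4 * real k \<ge> real n" and k2: "k \<ge> 2" using k n by auto
        have "2 * (real k * \<bar>a\<bar>) \<le> real n * \<bar>a\<bar>" using k1 mult_right_mono[of "2 * real k" "real n" "\<bar>a\<bar>"] by simp
        then have "1 - (dirichlet_norm k a / real k)\<^sup>2 \<ge> (real k * a)\<^sup>2 / 80" using True k2 by (intro dirichlet_small) auto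
        moreover have "(real n * a)\<^sup>2 \<le> 16 * (real k * a)\<^sup>2"
        proof -
          have "\<bar>real n * a\<bar> \<le> \<bar>4 * real k * a\<bar>" unfolding abs_mult using k1 by (intro mult_right_mono) auto
          then have "(real n * a)\<^sup>2 \<le> (4 * real k * a)\<^sup>2" by (simp only: abs_le_square_iff)
          then show ?thesis by (simp add: power_mult_distrib)
        qed
        moreover have "(real k * a)\<^sup>2 \<ge> 0" by simp
        ultimately show "m / 2000 \<le> 1 - (dirichlet_norm k a / real k)\<^sup>2" using m by linarith
      qed (use n in auto)
    next
      case False
      show ?thesis
      proof (intro exI[of _ "{n - n div 4..n}"] conjI ballI)
        show "real (card {n - n div 4..n}) \<ge> real n / 8" using n by auto
        fix k assume k: "k \<in> {n - n div 4..n}"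
        then have k1: "4 * real k \<ge> 3 * real n" by auto
        have "3 * (real n * \<bar>a\<bar>) \<le> 4 * (real k * \<bar>a\<bar>)" using k1 mult_right_mono[of "3 * real n" "4 * real k" "\<bar>a\<bar>"] by simp
        then have "1 - (dirichlet_norm k a / real k)\<^sup>2 \<ge> 1 / 2" using False a by (intro dirichlet_large) auto
        then show "m / 2000 \<le> 1 - (dirichlet_norm k a / real k)\<^sup>2" using m by linarith
      qed (use n in auto)
    qed
    then obtain I where I: "I \<subseteq> {1..n}" "real (card I) \<ge> real n / 8" "\<forall>k\<in>I. 1 - (dirichlet_norm k a / real k)\<^sup>2 \<ge> m / 2000" by blast
    have "(exp (- 2 * t) / 2 / 8 / 2000) * real n * m = real n / 8 * (exp (- 2 * t) / 2 * (m / 2000))" by simp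
    also have "\<dots> \<le> real (card I) * (exp (- 2 * t) / 2 * (m / 2000))" using I(2) m by (intro mult_right_mono) auto
    also have "\<dots> \<le> (\<Sum>k=1..n. q k)" using I by (intro low) auto
    finally show ?thesis by (intro mult_left_mono) auto
  qed
  finally show "cmod (maj_mgf n (Complex (t / real n) a)) \<le> cmod (maj_mgf n (of_real (t / real n))) * exp (- (exp (- 2 * t) / 2 / 8 / 2000) * real n * min 1 ((real n * a)\<^sup>2))"
    unfolding m_def .
qed

subsection \<open>The cumulant functions in the complex plane\<close>

definition expm1q :: "complex \<Rightarrow> complex" where
  "expm1q z = (if z = 0 then 1 else (exp z - 1) / z)"

text \<open>The half-width pi is what keeps cos(Im z / 2) positive, on which the choice of the
  logarithm rests.\<close>

definition strip :: "complex set" where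
  "strip = {z. \<bar>Im z\<bar> < pi}"

text \<open>The holomorphic extension of \<open>L_D\<close>. Dividing by exp(z/2) leaves
  sinh(z/2)/(z/2), whose real part is positive on \<open>strip\<close>, so the principal logarithm
  stays away from its branch cut.\<close>

definition L_c :: "complex \<Rightarrow> complex" where
  "L_c z = z / 2 + Ln (exp (- z / 2) * expm1q z)"

lemma expm1q_mult: "z * expm1q z = exp z - 1"
  by (simp add: expm1q_def)

lemma deriv_exp_complex: "deriv exp = (exp :: complex \<Rightarrow> complex)"
  by (rule ext) (rule DERIV_imp_deriv[OF DERIV_exp])

text \<open>It is the difference quotient of exp at 0 with the derivative filled in, so the
  singularity is removable.\<close>

lemma expm1q_holomorphic: "expm1q holomorphic_on S"
proof -
  have "expm1q = (\<lambda>z. if z = 0 then deriv exp 0 else (exp z - exp 0) / (z - 0))"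
    by (auto simp: expm1q_def fun_eq_iff deriv_exp_complex)
  then show ?thesis using pole_lemma_open[of exp UNIV 0] holomorphic_on_subset[of _ UNIV S]
    by (simp add: holomorphic_on_exp)
qed

lemma strip_open: "open strip" and strip_convex: "convex strip"
proof -
  have eq: "strip = {z. Im z < pi} \<inter> {z. Im z > - pi}" by (auto simp: strip_def)
  show "open strip" unfolding eq by (intro open_Int open_halfspace_Im_lt open_halfspace_Im_gt)
  show "convex strip" unfolding eq by (intro convex_Int convex_halfspace_Im_lt convex_halfspace_Im_gt)
qed

lemma of_real_in_strip [simp]: "complex_of_real t \<in> strip"
  by (simp add: strip_def)

lemma mult_in_strip: "z \<in> strip \<Longrightarrow> 0 \<le> y \<Longrightarrow> y \<le> 1 \<Longrightarrow> of_real y * z \<in> strip"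
  by (auto simp: strip_def abs_mult intro: le_less_trans[OF mult_left_le_one_le])

text \<open>With z/2 = w = x + iy, multiplication by the conjugate of w reduces the claim to 2 x
  sinh x cos y + 2 y sin y cosh x > 0. For |y| < pi/2 both terms are nonnegative, and they vanish
  together only at w = 0.\<close>

lemma Re_expm1q_pos:
  assumes "z \<in> strip"
  shows "Re (exp (- z / 2) * expm1q z) > 0"
proof (cases "z = 0")
  case False
  define x y where "x = Re z / 2" and "y = Im z / 2"
  define w where "w = Complex x y"
  have z: "z = 2 * w" by (simp add: w_def x_def y_def complex_eq_iff)
  have w0: "w \<noteq> 0" using False z by auto
  have y: "\<bar>y\<bar> < pi / 2" using assms by (auto simp: strip_def y_def)
  have "exp (- z / 2) * expm1q z = (exp w - exp (- w)) / (2 * w)"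
    using False by (simp add: expm1q_def z right_diff_distrib exp_add[symmetric])
  also have "\<dots> = (exp w - exp (- w)) * cnj w / of_real (2 * (cmod w)\<^sup>2)"
    using w0 by (simp only: of_real_mult complex_norm_square) simp
  finally have eq: "Re (exp (- z / 2) * expm1q z) = Re ((exp w - exp (- w)) * cnj w) / (2 * (cmod w)\<^sup>2)"
    by (simp only: Re_divide_of_real)
  have "Re ((exp w - exp (- w)) * cnj w) = x * (exp x - exp (- x)) * cos y + y * sin y * (exp x + exp (- x))"
    by (simp add: w_def Re_exp Im_exp algebra_simps)
  also have "\<dots> > 0"
  proof -
    have c: "cos y > 0" using y by (intro cos_gt_zero_pi) auto
    have s: "y * sin y > 0" if "y \<noteq> 0"
    proof (cases "y > 0")
      case True then show ?thesis using y by (intro mult_pos_pos sin_gt_zero) auto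
    next
      case False then have "sin (- y) > 0" using y that by (intro sin_gt_zero) auto
      then show ?thesis using False that by (intro mult_neg_neg) auto
    qed
    have e: "x * (exp x - exp (- x)) > 0" if "x \<noteq> 0"
      using that by (cases "x > 0") (auto intro!: mult_pos_pos mult_neg_neg)
    have ep: "exp x + exp (- x) > 0" by (intro add_pos_pos) auto
    show ?thesis
    proof (cases "x = 0")
      case True
      then have "y \<noteq> 0" using w0 by (auto simp: w_def complex_eq_iff)
      then show ?thesis using s True by simp
    next
      case xn: False
      have "y * sin y \<ge> 0" using s by (cases "y = 0") (auto intro: less_imp_le)
      then show ?thesis using mult_pos_pos[OF e[OF xn] c] mult_nonneg_nonneg[OF \<open>y * sin y \<ge> 0\<close> less_imp_le[OF ep]]
        by (rule_tac add_pos_nonneg)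
    qed
  qed
  finally show ?thesis using eq w0 by simp
qed (simp add: expm1q_def)

lemma L_c_holomorphic: "L_c holomorphic_on strip"
proof -
  have "exp (- z / 2) * expm1q z \<notin> \<real>\<^sub>\<le>\<^sub>0" if "z \<in> strip" for z
    using Re_expm1q_pos[OF that] by (metis complex_nonpos_Reals_iff not_le)
  then show ?thesis unfolding L_c_def
    by (intro holomorphic_intros expm1q_holomorphic) auto
qed

lemma exp_L_c: "z \<in> strip \<Longrightarrow> exp (L_c z) = expm1q z"
proof -
  assume "z \<in> strip"
  then have "exp (- z / 2) * expm1q z \<noteq> 0" using Re_expm1q_pos by fastforce
  then have "exp (L_c z) = exp (z / 2) * (exp (- z / 2) * expm1q z)"
    by (simp add: L_c_def exp_add)
  also have "\<dots> = expm1q z" by (simp add: mult.assoc[symmetric] exp_add[symmetric])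
  finally show ?thesis .
qed

lemma L_c_of_real: "L_c (of_real t) = of_real (L_D t)"
proof (cases "t = 0")
  case False
  define a where "a = (exp t - 1) / t"
  have a: "a > 0" using False by (cases "t > 0") (auto simp: a_def intro: divide_neg_neg)
  have "exp (- of_real t / 2) * expm1q (of_real t) = complex_of_real (exp (- t / 2) * a)"
    using False by (simp add: expm1q_def a_def exp_of_real[symmetric])
  then have "Ln (exp (- of_real t / 2) * expm1q (of_real t)) = complex_of_real (ln (exp (- t / 2) * a))"
    using a by (simp only: Ln_of_real mult_pos_pos exp_gt_zero)
  also have "ln (exp (- t / 2) * a) = - t / 2 + ln a" using a by (simp add: ln_mult)
  finally show ?thesis using False by (simp add: L_c_def L_D_def a_def)
qed (simp add: L_c_def L_D_def expm1q_def)

section \<open>Derivatives on the real axis and at the origin\<close>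

lemma real_derivative_of_complex:
  fixes g :: "real \<Rightarrow> real"
  assumes "(f has_field_derivative f') (at (of_real t))" and fg: "\<And>t. f (of_real t) = of_real (g t)"
  shows "(g has_real_derivative Re f') (at t)" and "f' = of_real (Re f')"
proof -
  have v: "((\<lambda>x. complex_of_real (g x)) has_vector_derivative f') (at t)"
    using has_vector_derivative_real_field[OF assms(1)] by (simp add: fg)
  then have 1: "(g has_vector_derivative Re f') (at t)" and 2: "((\<lambda>x. 0 :: real) has_vector_derivative Im f') (at t)"
    unfolding has_vector_derivative_complex_iff by (simp_all add: has_real_derivative_iff_has_vector_derivative)
  show "(g has_real_derivative Re f') (at t)" using 1 by (simp add: has_real_derivative_iff_has_vector_derivative)
  have "Im f' = 0" using vector_derivative_unique_at[OF 2 has_vector_derivative_const] .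
  then show "f' = of_real (Re f')" by (simp add: complex_eq_iff)
qed

text \<open>The theorem speaks of iterated real derivatives, the estimates use complex ones. This
  transfers values between the two and also shows that the real function is smooth.\<close>

lemma higher_deriv_of_real:
  fixes g :: "real \<Rightarrow> real"
  assumes f: "f holomorphic_on S" and S: "open S" "\<And>t. complex_of_real t \<in> S"
    and fg: "\<And>t. f (of_real t) = of_real (g t)"
  shows "(deriv ^^ k) f (of_real t) = of_real ((deriv ^^ k) g t)"
    and "((deriv ^^ k) g has_real_derivative (deriv ^^ Suc k) g t) (at t)"
proof -
  have d: "((deriv ^^ k) f has_field_derivative (deriv ^^ Suc k) f (of_real t)) (at (of_real t))" for k t
    using holomorphic_derivI[OF holomorphic_higher_deriv[OF f S(1)] S(1) S(2)] by simp
  have a: "(deriv ^^ k) f (of_real t) = of_real ((deriv ^^ k) g t)" for k t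
  proof (induction k arbitrary: t)
    case (Suc k)
    have "((deriv ^^ k) g has_real_derivative Re ((deriv ^^ Suc k) f (of_real t))) (at t)"
      by (rule real_derivative_of_complex(1)[OF d Suc.IH])
    then have "(deriv ^^ Suc k) g t = Re ((deriv ^^ Suc k) f (of_real t))"
      by (simp add: DERIV_imp_deriv)
    then show ?case using real_derivative_of_complex(2)[OF d Suc.IH, of t] by simp
  qed (simp add: fg)
  show "(deriv ^^ k) f (of_real t) = of_real ((deriv ^^ k) g t)" by (rule a)
  show "((deriv ^^ k) g has_real_derivative (deriv ^^ Suc k) g t) (at t)"
    using real_derivative_of_complex(1)[OF d a, of k t] by (simp only: a Re_complex_of_real)
qed

lemmas L_c_higher_deriv = higher_deriv_of_real(1)[OF L_c_holomorphic strip_open of_real_in_strip L_c_of_real]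
lemmas L_D_higher_deriv = higher_deriv_of_real(2)[OF L_c_holomorphic strip_open of_real_in_strip L_c_of_real]

text \<open>Leibniz rule for z expm1q(z) = exp z - 1: at 0 every derivative of the identity vanishes
  except the first.\<close>

lemma expm1q_higher_deriv_0: "(deriv ^^ n) expm1q 0 = 1 / of_nat (Suc n)"
proof -
  have "(deriv ^^ Suc n) (\<lambda>z. z * expm1q z) 0
     = (\<Sum>i=0..Suc n. of_nat (Suc n choose i) * (deriv ^^ i) (\<lambda>z. z) 0 * (deriv ^^ (Suc n - i)) expm1q 0)"
    by (rule higher_deriv_mult[of _ UNIV]) (auto intro: holomorphic_intros expm1q_holomorphic)
  also have "\<dots> = (\<Sum>i\<in>{1}. of_nat (Suc n choose i) * (deriv ^^ i) (\<lambda>z. z) 0 * (deriv ^^ (Suc n - i)) expm1q 0)"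
    by (rule sum.mono_neutral_right) auto
  also have "\<dots> = of_nat (Suc n) * (deriv ^^ n) expm1q 0" by simp
  also have "(\<lambda>z. z * expm1q z) = (\<lambda>z. exp z - 1)" by (simp add: expm1q_mult)
  also have "(deriv ^^ Suc n) (\<lambda>z. exp z - 1) 0 = (1 :: complex)"
  proof -
    have "deriv (\<lambda>z. exp z - 1 :: complex) = exp"
      by (rule ext) (auto intro!: DERIV_imp_deriv derivative_eq_intros)
    moreover have "(deriv ^^ n) exp = (exp :: complex \<Rightarrow> complex)" by (induction n) (auto simp: deriv_exp_complex)
    ultimately show ?thesis by (simp add: funpow_Suc_right del: funpow.simps)
  qed
  finally show ?thesis by (simp add: field_simps del: of_nat_Suc)
qed

text \<open>Leibniz rule at 0 for the derivative expm1q L_c' of expm1q = exp(L_c). The recursion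
  determines all derivatives of \<open>L_D\<close> at 0.\<close>

lemma L_D_deriv_0_rec:
  "1 / real (Suc (Suc n)) = (\<Sum>i=0..n. real (n choose i) / real (Suc i) * (deriv ^^ Suc (n - i)) L_D 0)"
proof -
  have "(deriv ^^ Suc n) expm1q 0 = (deriv ^^ n) (\<lambda>z. expm1q z * deriv L_c z) 0"
  proof -
    have "deriv expm1q z = expm1q z * deriv L_c z" if "z \<in> strip" for z
    proof -
      have "((\<lambda>z. exp (L_c z)) has_field_derivative exp (L_c z) * deriv L_c z) (at z)"
        using holomorphic_derivI[OF L_c_holomorphic strip_open that] by (auto intro!: derivative_eq_intros)
      then have "(expm1q has_field_derivative exp (L_c z) * deriv L_c z) (at z)"
        by (rule has_field_derivative_transform_within_open[OF _ strip_open that]) (simp add: exp_L_c)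
      then show ?thesis using that by (simp add: exp_L_c DERIV_imp_deriv)
    qed
    then have "(deriv ^^ n) (deriv expm1q) 0 = (deriv ^^ n) (\<lambda>z. expm1q z * deriv L_c z) 0"
      by (intro higher_deriv_cong_ev eventually_nhds_in_open[THEN eventually_mono, OF strip_open])
        (auto simp: strip_def)
    then show ?thesis by (simp add: funpow_Suc_right del: funpow.simps)
  qed
  also have "\<dots> = (\<Sum>i=0..n. of_nat (n choose i) * (deriv ^^ i) expm1q 0 * (deriv ^^ (n - i)) (deriv L_c) 0)"
    by (rule higher_deriv_mult[of _ strip])
      (auto simp: strip_def[symmetric] strip_open intro!: expm1q_holomorphic holomorphic_deriv L_c_holomorphic strip_open, simp add: strip_def)
  also have "\<dots> = (\<Sum>i=0..n. of_real (real (n choose i) / real (Suc i) * (deriv ^^ Suc (n - i)) L_D 0))"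
  proof (intro sum.cong refl)
    fix i
    have "(deriv ^^ (n - i)) (deriv L_c) 0 = of_real ((deriv ^^ Suc (n - i)) L_D 0)"
      using L_c_higher_deriv[of "Suc (n - i)" 0] by (simp add: funpow_Suc_right del: funpow.simps)
    then show "of_nat (n choose i) * (deriv ^^ i) expm1q 0 * (deriv ^^ (n - i)) (deriv L_c) 0 =
       of_real (real (n choose i) / real (Suc i) * (deriv ^^ Suc (n - i)) L_D 0)"
      by (simp add: expm1q_higher_deriv_0 del: funpow.simps)
  qed
  finally have "complex_of_real (1 / real (Suc (Suc n))) = of_real (\<Sum>i=0..n. real (n choose i) / real (Suc i) * (deriv ^^ Suc (n - i)) L_D 0)"
    unfolding expm1q_higher_deriv_0 by simp
  then show ?thesis by (simp only: of_real_eq_iff)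
qed

lemma L_D_deriv_0_1: "(deriv ^^ 1) L_D 0 = 1/2"
  using L_D_deriv_0_rec[of 0] by simp

lemma L_D_deriv_0_2: "(deriv ^^ 2) L_D 0 = 1/12"
  using L_D_deriv_0_rec[of 1] L_D_deriv_0_1 by (simp add: numeral_2_eq_2)

text \<open>Needed because \<open>explicit_formula\<close> admits only rational constants, while
  these values enter the Euler-Maclaurin terms.\<close>

lemma L_D_deriv_0_Rats: "(deriv ^^ j) L_D 0 \<in> \<rat>"
proof (induction j rule: less_induct)
  case (less j)
  show ?case
  proof (cases j)
    case 0
    then show ?thesis by (simp add: L_D_def)
  next
    case (Suc n)
    \<comment> \<open>The summand i = 0 of the recursion is the highest derivative, with coefficient
      1.\<close>
    have "(deriv ^^ Suc n) L_D 0 = 1 / real (Suc (Suc n)) - (\<Sum>i=1..n. real (n choose i) / real (Suc i) * (deriv ^^ Suc (n - i)) L_D 0)"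
      unfolding L_D_deriv_0_rec[of n] by (subst sum.atLeast_Suc_atMost) simp_all
    also have "\<dots> \<in> \<rat>"
      by (intro Rats_diff Rats_sum Rats_mult Rats_divide Rats_of_nat Rats_1 less.IH) (use Suc in auto)
    finally show ?thesis using Suc by simp
  qed
qed

text \<open>From L_D'(t) = exp t/(exp t - 1) - 1/t. After integration this shows that L_M' reaches
  every x < 1/2.\<close>

lemma L_D_deriv_pos:
  assumes "t > 0"
  shows "(deriv ^^ 1) L_D t \<ge> 1 - 1 / t"
proof -
  have "(L_D has_real_derivative (exp t / (exp t - 1) - 1 / t)) (at t)"
  proof (rule has_field_derivative_transform_within_open)
    show "((\<lambda>t. ln (exp t - 1) - ln t) has_real_derivative (exp t / (exp t - 1) - 1 / t)) (at t)"
      using assms by (auto intro!: derivative_eq_intros)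
    show "ln (exp s - 1) - ln s = L_D s" if "s \<in> {0<..}" for s :: real
      using that by (simp add: L_D_def ln_div)
  qed (use assms in auto)
  then have "(deriv ^^ 1) L_D t = exp t / (exp t - 1) - 1 / t" by (simp add: DERIV_imp_deriv)
  moreover have "exp t / (exp t - 1) \<ge> 1" using assms by simp
  ultimately show ?thesis by simp
qed

text \<open>Away from 0 the second derivative equals 1/t^2 - 1/(2 sinh(t/2))^2, positive because
  sinh s > s for s > 0; at 0 it is 1/12.\<close>

lemma L_D_deriv2_pos: "(deriv ^^ 2) L_D t > 0"
proof (cases "t = 0")
  case False
  have d1: "(L_D has_real_derivative (exp s / (exp s - 1) - 1 / s)) (at s)" if "s \<noteq> 0" for s
  proof (rule has_field_derivative_transform_within_open)
    have "(exp s - 1) / s > 0" using that by (cases "s > 0") (auto intro: divide_neg_neg)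
    then show "((\<lambda>t. ln ((exp t - 1) / t)) has_real_derivative (exp s / (exp s - 1) - 1 / s)) (at s)"
      using that by (auto intro!: derivative_eq_intros simp: field_simps)
    show "ln ((exp r - 1) / r) = L_D r" if "r \<in> - {0}" for r :: real
      using that by (simp add: L_D_def)
  qed (use that in auto)
  have "(deriv L_D has_real_derivative (exp t * (exp t - 1) - exp t * exp t) / (exp t - 1)\<^sup>2 + 1 / t\<^sup>2) (at t)"
  proof (rule has_field_derivative_transform_within_open)
    show "((\<lambda>s. exp s / (exp s - 1) - 1 / s) has_real_derivative (exp t * (exp t - 1) - exp t * exp t) / (exp t - 1)\<^sup>2 + 1 / t\<^sup>2) (at t)"
      using False by (auto intro!: derivative_eq_intros simp: power2_eq_square)
    show "exp s / (exp s - 1) - 1 / s = deriv L_D s" if "s \<in> - {0}" for s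
      using d1[of s] that by (simp add: DERIV_imp_deriv)
  qed (use False in auto)
  then have "(deriv ^^ 2) L_D t = (exp t * (exp t - 1) - exp t * exp t) / (exp t - 1)\<^sup>2 + 1 / t\<^sup>2"
    by (simp add: numeral_2_eq_2 DERIV_imp_deriv)
  also have "\<dots> = 1 / t\<^sup>2 - exp t / (exp t - 1)\<^sup>2" by (simp add: algebra_simps diff_divide_distrib)
  also have "\<dots> > 0"
  proof -
    have half: "exp t = exp (t/2) * exp (t/2)" by (simp add: exp_add[symmetric])
    have "exp t - 1 = exp (t/2) * (2 * sinh (t/2))"
      by (simp add: sinh_field_def exp_minus half field_simps)
    then have "(exp t - 1)\<^sup>2 = exp t * (2 * sinh (t/2))\<^sup>2"
      by (simp add: power2_eq_square half)
    then have e: "exp t / (exp t - 1)\<^sup>2 = 1 / (2 * sinh (t/2))\<^sup>2" by simp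
    have pos: "s < sinh s" if "s > 0" for s :: real
    proof -
      have "\<exists>z. 0 < z \<and> z < s \<and> sinh s - sinh 0 = (s - 0) * cosh z"
        by (rule MVT2) (use that in \<open>auto intro!: derivative_eq_intros\<close>)
      then obtain z where "z > 0" "sinh s = s * cosh z" by auto
      moreover have "cosh z > 1" using \<open>z > 0\<close> cosh_real_strict_mono[of 0 z] by simp
      ultimately show ?thesis using that by simp
    qed
    have "\<bar>t/2\<bar> < sinh \<bar>t/2\<bar>" using pos[of "\<bar>t/2\<bar>"] False by simp
    then have "t\<^sup>2 < (2 * sinh (t/2))\<^sup>2"
      using False by (intro power2_strict_mono) (auto simp: abs_if split: if_splits)
    then show ?thesis using False unfolding e by (simp add: frac_less2)
  qed
  finally show ?thesis .
qed (use L_D_deriv_0_2 in simp)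

section \<open>The function \<open>L_M\<close> and its saddle point\<close>

definition LM_c :: "complex \<Rightarrow> complex" where
  "LM_c z = integral {0..1} (\<lambda>y. L_c (of_real y * z))"

lemma L_c_continuous_on [continuous_intros]:
  assumes "continuous_on A f" "\<And>x. x \<in> A \<Longrightarrow> f x \<in> strip"
  shows "continuous_on A (\<lambda>x. (deriv ^^ k) L_c (f x))"
  by (rule continuous_on_compose2[OF holomorphic_on_imp_continuous_on[OF holomorphic_higher_deriv[OF L_c_holomorphic strip_open]] assms(1)])
    (use assms(2) in auto)

text \<open>Differentiation under the integral sign, for all k at once: k = 0 gives holomorphy of
  \<open>LM_c\<close>, and iteration gives the integral formula for every derivative.\<close>

lemma LM_c_deriv_aux:
  assumes z: "z \<in> strip"
  shows "((\<lambda>z. integral {0..1} (\<lambda>y. of_real y ^ k * (deriv ^^ k) L_c (of_real y * z))) has_field_derivative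
     integral {0..1} (\<lambda>y. of_real y ^ Suc k * (deriv ^^ Suc k) L_c (of_real y * z))) (at z)"
proof -
  have "((\<lambda>z. integral (cbox 0 1) (\<lambda>y. of_real y ^ k * (deriv ^^ k) L_c (of_real y * z))) has_field_derivative
     integral (cbox 0 1) (\<lambda>y. of_real y ^ Suc k * (deriv ^^ Suc k) L_c (of_real y * z))) (at z within strip)"
  proof (rule leibniz_rule_field_derivative)
    fix z and y :: real assume "z \<in> strip" and "y \<in> cbox 0 1"
    then have s: "of_real y * z \<in> strip" by (simp add: mult_in_strip)
    have "((deriv ^^ k) L_c has_field_derivative (deriv ^^ Suc k) L_c (of_real y * z)) (at (of_real y * z))"
      using holomorphic_derivI[OF holomorphic_higher_deriv[OF L_c_holomorphic strip_open] strip_open s] by simp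
    then have d: "((\<lambda>z. (deriv ^^ k) L_c (of_real y * z)) has_field_derivative (deriv ^^ Suc k) L_c (of_real y * z) * of_real y) (at z)"
      by (rule DERIV_chain2) (auto intro!: derivative_eq_intros)
    have eq: "of_real y ^ k * (d * of_real y) = of_real y ^ Suc k * d" for d :: complex
      by (simp add: mult_ac)
    from DERIV_cmult[OF d, of "of_real y ^ k"]
    show "((\<lambda>z. of_real y ^ k * (deriv ^^ k) L_c (of_real y * z)) has_field_derivative of_real y ^ Suc k * (deriv ^^ Suc k) L_c (of_real y * z)) (at z within strip)"
      unfolding eq by (rule has_field_derivative_at_within)
  next
    fix z assume "z \<in> strip"
    then show "(\<lambda>y. of_real y ^ k * (deriv ^^ k) L_c (of_real y * z)) integrable_on cbox 0 1"
      by (intro integrable_continuous continuous_intros) (auto simp: mult_in_strip)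
  next
    show "continuous_on (strip \<times> cbox 0 1) (\<lambda>(z, y). of_real y ^ Suc k * (deriv ^^ Suc k) L_c (complex_of_real y * z))"
    proof -
      have "continuous_on (strip \<times> cbox 0 1) (\<lambda>p. complex_of_real (snd p) * fst p)"
        by (intro continuous_intros)
      then have "continuous_on (strip \<times> cbox 0 1) (\<lambda>p. (deriv ^^ Suc k) L_c (complex_of_real (snd p) * fst p))"
        by (rule L_c_continuous_on) (auto simp: mult_in_strip)
      then show ?thesis unfolding split_beta by (intro continuous_on_mult continuous_on_power continuous_on_of_real continuous_on_snd continuous_on_id)
    qed
  qed (use z strip_convex in auto)
  then show ?thesis unfolding at_within_open[OF z strip_open] cbox_interval .
qed

lemma LM_c_holomorphic: "LM_c holomorphic_on strip"
  unfolding holomorphic_on_def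
proof
  fix z assume "z \<in> strip"
  from LM_c_deriv_aux[OF this, of 0] have "LM_c field_differentiable at z"
    unfolding LM_c_def[abs_def] field_differentiable_def by auto
  then show "LM_c field_differentiable at z within strip" by (rule field_differentiable_at_within)
qed

lemma LM_c_of_real: "LM_c (of_real t) = of_real (L_M t)"
proof -
  have "(\<lambda>y. L_D (y * t)) integrable_on {0..1}"
  proof (intro integrable_continuous_real continuous_at_imp_continuous_on ballI)
    fix y :: real
    have "((\<lambda>y. L_D (y * t)) has_real_derivative ((deriv ^^ Suc 0) L_D (y * t) * t)) (at y)"
      by (rule DERIV_chain2[OF L_D_higher_deriv[of 0, simplified funpow_0]]) (auto intro!: derivative_eq_intros)
    then show "isCont (\<lambda>y. L_D (y * t)) y" by (rule DERIV_isCont)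
  qed
  then have "((\<lambda>y. complex_of_real (L_D (y * t))) has_integral of_real (L_M t)) {0..1}"
    unfolding L_M_def by (intro has_integral_of_real integrable_integral)
  then show ?thesis unfolding LM_c_def by (simp add: L_c_of_real[symmetric] integral_unique)
qed

lemmas LM_c_higher_deriv = higher_deriv_of_real(1)[OF LM_c_holomorphic strip_open of_real_in_strip LM_c_of_real]
lemmas L_M_higher_deriv = higher_deriv_of_real(2)[OF LM_c_holomorphic strip_open of_real_in_strip LM_c_of_real]

lemma L_M_deriv_integral:
  "((\<lambda>y. y ^ k * (deriv ^^ k) L_D (y * t)) has_integral (deriv ^^ k) L_M t) {0..1}"
proof -
  have c: "(deriv ^^ k) LM_c z = integral {0..1} (\<lambda>y. of_real y ^ k * (deriv ^^ k) L_c (of_real y * z))" if "z \<in> strip" for z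
    using that
  proof (induction k arbitrary: z)
    case (Suc k)
    have "((deriv ^^ k) LM_c has_field_derivative integral {0..1} (\<lambda>y. of_real y ^ Suc k * (deriv ^^ Suc k) L_c (of_real y * z))) (at z)"
      by (rule has_field_derivative_transform_within_open[OF LM_c_deriv_aux[OF Suc.prems] strip_open Suc.prems]) (simp add: Suc.IH)
    then show ?case by (simp add: DERIV_imp_deriv)
  qed (simp add: LM_c_def)
  have cont: "continuous_on {0..1} (\<lambda>y. of_real y ^ k * (deriv ^^ k) L_c (of_real y * of_real t))"
    by (intro continuous_intros) (simp flip: of_real_mult)
  have "((\<lambda>y. of_real y ^ k * (deriv ^^ k) L_c (of_real y * of_real t)) has_integral (deriv ^^ k) LM_c (of_real t)) {0..1}"
    using integrable_integral[OF integrable_continuous_real[OF cont]] c[of "of_real t"] by simp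
  then have "((\<lambda>y. complex_of_real (y ^ k * (deriv ^^ k) L_D (y * t))) has_integral of_real ((deriv ^^ k) L_M t)) {0..1}"
    unfolding LM_c_higher_deriv of_real_mult[symmetric] L_c_higher_deriv by (simp flip: of_real_mult of_real_power)
  then show ?thesis by (drule_tac has_integral_Re) simp
qed

text \<open>The integrand is continuous and nonnegative; a vanishing integral would force it to be
  zero at y = 1, where it equals L_D''(t) > 0.\<close>

lemma L_M_deriv2_pos: "(deriv ^^ 2) L_M t > 0"
proof -
  let ?f = "\<lambda>y. y ^ 2 * (deriv ^^ 2) L_D (y * t)"
  have cont: "continuous_on {0..1} ?f"
  proof -
    have "isCont (\<lambda>y. (deriv ^^ 2) L_D (y * t)) y" for y
      by (rule isCont_o2[OF _ DERIV_isCont[OF L_D_higher_deriv]]) (auto intro!: continuous_intros)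
    then show ?thesis by (intro continuous_intros continuous_at_imp_continuous_on) auto
  qed
  have nn: "?f y \<ge> 0" for y using less_imp_le[OF L_D_deriv2_pos] by simp
  have i: "integral {0..1} ?f = (deriv ^^ 2) L_M t" using L_M_deriv_integral[of 2 t] by (rule integral_unique)
  have "integral {0..1} ?f \<ge> 0" using nn by (intro integral_nonneg integrable_continuous_real cont) auto
  moreover have "integral {0..1} ?f \<noteq> 0"
  proof
    assume "integral {0..1} ?f = 0"
    then have "?f 1 = 0"
      using integral_eq_0_iff[OF cont, of] nn by auto
    then show False using L_D_deriv2_pos[of t] by simp
  qed
  ultimately show ?thesis using i by simp
qed

lemma L_M_deriv_strict_mono: "strict_mono ((deriv ^^ 1) L_M)"
proof (rule strict_monoI)
  fix s t :: real assume "s < t"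
  then show "(deriv ^^ 1) L_M s < (deriv ^^ 1) L_M t"
    using L_M_higher_deriv[of 1] L_M_deriv2_pos
    by (metis DERIV_pos_imp_increasing numeral_2_eq_2 One_nat_def)
qed

lemma L_M_deriv_0: "(deriv ^^ 1) L_M 0 = 1/4"
proof -
  have "((\<lambda>y. y ^ 1 * (1/2)) has_integral (deriv ^^ 1) L_M 0) {0..1}"
    using L_M_deriv_integral[of 1 0] by (simp only: mult_zero_right L_D_deriv_0_1)
  moreover have "((\<lambda>y. y ^ 1 * (1/2)) has_integral (1\<^sup>2/4 - 0\<^sup>2/4)) {0..1::real}"
    by (rule fundamental_theorem_of_calculus)
      (auto intro!: derivative_eq_intros simp flip: has_real_derivative_iff_has_vector_derivative)
  ultimately have "(deriv ^^ 1) L_M 0 = 1\<^sup>2/4 - 0\<^sup>2/4" by (rule has_integral_unique)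
  then show ?thesis by simp
qed

text \<open>Integrate y L_D'(yt) \<ge> y (1 - 1/(yt)) = y - 1/t over [0,1].\<close>

lemma L_M_deriv_lower:
  assumes "t > 0"
  shows "(deriv ^^ 1) L_M t \<ge> 1/2 - 1/t"
proof -
  have "((\<lambda>y. y - 1/t) has_integral ((1\<^sup>2/2 - 1/t) - (0\<^sup>2/2 - 0/t))) {0..1::real}"
    by (rule fundamental_theorem_of_calculus)
      (use assms in \<open>auto intro!: derivative_eq_intros simp flip: has_real_derivative_iff_has_vector_derivative\<close>)
  then have "((\<lambda>y. y - 1/t) has_integral (1/2 - 1/t)) {0..1}" by simp
  then show ?thesis
  proof (rule has_integral_le[OF _ L_M_deriv_integral[of 1 t]])
    fix y :: real assume y: "y \<in> {0..1}"
    show "y - 1/t \<le> y ^ 1 * (deriv ^^ 1) L_D (y * t)"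
    proof (cases "y = 0")
      case False
      then have yt: "y > 0" "y * t > 0" using y assms by auto
      have "y - 1/t = y * (1 - 1/(y*t))" using yt assms by (simp add: field_simps)
      also have "\<dots> \<le> y * (deriv ^^ 1) L_D (y * t)"
        using L_D_deriv_pos[OF yt(2)] yt by (intro mult_left_mono) auto
      finally show ?thesis by simp
    qed (use assms in simp)
  qed
qed

lemma has_deriv_L_M_iff: "(L_M has_real_derivative x) (at t) \<longleftrightarrow> (deriv ^^ 1) L_M t = x"
  using L_M_higher_deriv[of 0 t] DERIV_imp_deriv[of L_M x t] by auto

lemma saddle_exists:
  assumes "1/4 < x" "x < 1/2"
  shows "\<exists>t>0. (deriv ^^ 1) L_M t = x"
proof -
  \<comment> \<open>Chosen so that 1/2 - 1/b = x in \<open>L_M_deriv_lower\<close>.\<close>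
  define b where "b = 1 / (1/2 - x)"
  have b: "b > 0" using assms by (simp add: b_def)
  have "(deriv ^^ 1) L_M b \<ge> x" using L_M_deriv_lower[OF b] by (simp add: b_def)
  moreover have "continuous_on {0..b} ((deriv ^^ 1) L_M)"
    using DERIV_isCont[OF L_M_higher_deriv] by (intro continuous_at_imp_continuous_on) blast
  ultimately obtain t where t: "0 \<le> t" "(deriv ^^ 1) L_M t = x"
    using IVT'[of "(deriv ^^ 1) L_M" 0 x b] L_M_deriv_0 assms b by auto
  moreover have "t \<noteq> 0" using t L_M_deriv_0 assms by auto
  ultimately show ?thesis by (intro exI[of _ t]) auto
qed

lemma ex1_saddle:
  assumes "1/4 < x" "x < 1/2"
  shows "\<exists>!t. (L_M has_real_derivative x) (at t)"
proof -
  have "inj ((deriv ^^ 1) L_M)" using L_M_deriv_strict_mono by (rule strict_mono_imp_inj_on)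
  then show ?thesis unfolding has_deriv_L_M_iff using saddle_exists[OF assms] by (auto simp: inj_def)
qed

lemma saddle_props:
  assumes "1/4 < x" "x < 1/2"
  shows "saddle x > 0" and "(deriv ^^ 1) L_M (saddle x) = x"
proof -
  have "(L_M has_real_derivative x) (at (saddle x))"
    unfolding saddle_def by (rule theI'[OF ex1_saddle[OF assms]])
  then show e: "(deriv ^^ 1) L_M (saddle x) = x" by (simp only: has_deriv_L_M_iff)
  show "saddle x > 0"
    using saddle_exists[OF assms] e strict_mono_imp_inj_on[OF L_M_deriv_strict_mono]
    by (metis UNIV_I inj_on_def)
qed

text \<open>The saddle point attains the supremum: L_M' is increasing, so by the mean value theorem
  moving away from t in either direction cannot increase x s - L_M(s).\<close>

lemma I_M_eq:
  assumes "(deriv ^^ 1) L_M t = x"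
  shows "I_M x = x * t - L_M t"
proof -
  have le: "x * s - L_M s \<le> x * t - L_M t" for s
  proof (cases "s = t")
    case False
    have d: "\<And>r. (L_M has_real_derivative (deriv ^^ 1) L_M r) (at r)"
      using has_deriv_L_M_iff by blast
    show ?thesis
    proof (cases "s < t")
      case True
      obtain z where z: "s < z" "z < t" "L_M t - L_M s = (t - s) * (deriv ^^ 1) L_M z"
        using MVT2[OF True d] by blast
      have "(deriv ^^ 1) L_M z \<le> x" using strict_monoD[OF L_M_deriv_strict_mono z(2)] assms by simp
      then have "(t - s) * (deriv ^^ 1) L_M z \<le> (t - s) * x" using True by (intro mult_left_mono) auto
      then show ?thesis using z(3) by (simp add: algebra_simps)
    next
      case f: False
      with False have True: "t < s" by simp
      obtain z where z: "t < z" "z < s" "L_M s - L_M t = (s - t) * (deriv ^^ 1) L_M z"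
        using MVT2[OF True d] by blast
      have "x \<le> (deriv ^^ 1) L_M z" using strict_monoD[OF L_M_deriv_strict_mono z(1)] assms by simp
      then have "(s - t) * x \<le> (s - t) * (deriv ^^ 1) L_M z" using True by (intro mult_left_mono) auto
      then show ?thesis using z(3) by (simp add: algebra_simps)
    qed
  qed simp
  show ?thesis unfolding I_M_def
    by (rule cSup_eq_maximum) (use le in auto)
qed

definition H_c :: "complex \<Rightarrow> complex" where "H_c z = (L_c z - z) / 2"

lemma H_c_holomorphic: "H_c holomorphic_on strip"
  unfolding H_c_def by (intro holomorphic_intros L_c_holomorphic) simp

lemma H_c_of_real: "H_c (of_real t) = of_real (H t)"
  by (simp add: H_c_def H_def L_c_of_real)

subsection \<open>Euler-Maclaurin summation\<close>

text \<open>The Taylor coefficients of w/(1 - exp(-w)), that is, Bernoulli numbers with B_1 = +1/2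
  divided by factorials; the sign of B_1 goes with sums over k = 1, ..., n. The recursion is the
  form in which they arise in the proof of \<open>euler_maclaurin\<close>.\<close>

fun em_coeff :: "nat \<Rightarrow> real" where
  "em_coeff 0 = 1"
| "em_coeff (Suc m) = (\<Sum>i\<le>m. (-1) ^ i / fact (i + 2) * em_coeff (m - i))"

lemma em_coeff_Rats: "em_coeff m \<in> \<rat>"
proof (induction m rule: less_induct)
  case (less m)
  have "fact k \<in> (\<rat> :: real set)" for k
    by (metis Rats_of_nat of_nat_fact)
  then show ?case using less by (cases m) (auto intro!: Rats_sum Rats_mult Rats_divide Rats_power)
qed

text \<open>\<open>G 1\<close> is the summand and \<open>G 0\<close> its primitive. Expand
  \<open>G 0\<close> backwards from kw to (k - 1)w and sum over k: the differences telescope, and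
  sums of the same kind for \<open>G (i + 2)\<close> remain, to which the statement of order P - 1 -
  i applies. All data except P are quantified after C, so the constant is uniform in step, domain
  and function.\<close>

lemma euler_maclaurin:
  "\<exists>C\<ge>0. \<forall>(S :: complex set) G w n B. convex S \<longrightarrow> (\<forall>k\<le>n. of_nat k * w \<in> S) \<longrightarrow>
     (\<forall>i. \<forall>x\<in>S. (G i has_field_derivative G (Suc i) x) (at x within S)) \<longrightarrow>
     (\<forall>x\<in>S. cmod (G (P + 2) x) \<le> B) \<longrightarrow>
     cmod (w * (\<Sum>k=1..n. G 1 (of_nat k * w)) - (\<Sum>j\<le>P. of_real (em_coeff j) * w ^ j * (G j (of_nat n * w) - G j 0)))
       \<le> C * B * real n * cmod w ^ (P + 2)"
proof (induction P rule: less_induct)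
  case (less P)
  let ?err = "\<lambda>P n w (G :: nat \<Rightarrow> complex \<Rightarrow> complex). w * (\<Sum>k=1..n. G 1 (of_nat k * w)) - (\<Sum>j\<le>P. of_real (em_coeff j) * w ^ j * (G j (of_nat n * w) - G j 0))"
  define good where "good = (\<lambda>Q C. 0 \<le> C \<and> (\<forall>(S :: complex set) G w n B. convex S \<longrightarrow> (\<forall>k\<le>n. of_nat k * w \<in> S) \<longrightarrow>
     (\<forall>i. \<forall>x\<in>S. (G i has_field_derivative G (Suc i) x) (at x within S)) \<longrightarrow>
     (\<forall>x\<in>S. cmod (G (Q + 2) x) \<le> B) \<longrightarrow> cmod (?err Q n w G) \<le> C * B * real n * cmod w ^ (Q + 2)))"
  have "\<forall>Q. \<exists>C. Q < P \<longrightarrow> good Q C" using less.IH unfolding good_def by blast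
  then obtain C where good: "\<And>Q. Q < P \<Longrightarrow> good Q (C Q)" by metis
  have C: "C Q \<ge> 0" if "Q < P" for Q using good[OF that] by (simp add: good_def)
  have IH: "cmod (?err Q n w G) \<le> C Q * B * real n * cmod w ^ (Q + 2)"
    if "Q < P" "convex S" "\<forall>k\<le>n. of_nat k * w \<in> S"
     "\<forall>i. \<forall>x\<in>S. (G i has_field_derivative G (Suc i) x) (at x within S)"
     "\<forall>x\<in>S. cmod (G (Q + 2) x) \<le> B" for Q S G w n B
    using good[OF that(1)] that(2-) unfolding good_def by blast
  \<comment> \<open>The 1 is for the Taylor error, the sum for the inner sums of lower
    order.\<close>
  define K where "K = 1 + (\<Sum>i<P. C (P - 1 - i))"
  show ?case
  proof (intro exI[of _ K] conjI allI impI)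
    show "K \<ge> 0" unfolding K_def using C by (auto intro!: add_nonneg_nonneg sum_nonneg)
    fix S :: "complex set" and G w n B
    assume S: "convex S" and wS: "\<forall>k\<le>n. of_nat k * w \<in> S"
      and dG: "\<forall>i. \<forall>x\<in>S. (G i has_field_derivative G (Suc i) x) (at x within S)"
      and BG: "\<forall>x\<in>S. cmod (G (P + 2) x) \<le> B"
    define D where "D = (\<lambda>j. G j (of_nat n * w) - G j 0)"
    define T where "T = (\<lambda>i. \<Sum>k=1..n. G i (of_nat k * w))"
    have B0: "B \<ge> 0" using BG wS norm_ge_zero order_trans by blast
    define g where "g = (\<lambda>i j. (-1) ^ i * w ^ (i + 1) / fact (i + 2) * (of_real (em_coeff j) * w ^ j * D (i + 1 + j)))"

    have taylor: "cmod (G 0 ((of_nat k - 1) * w) - (\<Sum>i\<le>P+1. G i (of_nat k * w) * (-w) ^ i / fact i)) \<le> B * cmod w ^ (P + 2)"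
      if k: "k \<in> {1..n}" for k
    proof -
      have "(of_nat k - 1) * w \<in> S" using wS k by (auto dest!: spec[of _ "k - 1"] simp: of_nat_diff)
      then have "cmod (G 0 ((of_nat k - 1) * w) - (\<Sum>i\<le>P+1. G i (of_nat k * w) * ((of_nat k - 1) * w - of_nat k * w) ^ i / fact i))
         \<le> B * cmod ((of_nat k - 1) * w - of_nat k * w) ^ Suc (P + 1) / fact (P + 1)"
        using wS k dG BG by (intro complex_Taylor[OF S]) auto
      also have "(of_nat k - 1) * w - of_nat k * w = -w" by (simp add: algebra_simps)
      also have "B * cmod (-w) ^ Suc (P + 1) / fact (P + 1) \<le> B * cmod w ^ (P + 2)"
      proof -
        have "B * cmod w ^ (P + 2) / fact (P + 1) \<le> B * cmod w ^ (P + 2) / 1"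
          using B0 fact_ge_1[of "P + 1", where 'a=real] by (intro divide_left_mono) (auto simp del: fact_Suc)
        then show ?thesis by simp
      qed
      finally show ?thesis .
    qed
    have tele: "(\<Sum>k=1..n. G 0 (of_nat k * w) - G 0 ((of_nat k - 1) * w)) = D 0"
      unfolding D_def by (induction n) auto
    have "cmod (\<Sum>k=1..n. G 0 ((of_nat k - 1) * w) - (\<Sum>i\<le>P+1. G i (of_nat k * w) * (-w) ^ i / fact i))
       \<le> (\<Sum>k=1..n. B * cmod w ^ (P + 2))"
      by (intro order_trans[OF norm_sum] sum_mono taylor)
    also have "(\<Sum>k=1..n. G 0 ((of_nat k - 1) * w) - (\<Sum>i\<le>P+1. G i (of_nat k * w) * (-w) ^ i / fact i))
       = w * T 1 - D 0 - (\<Sum>i<P. (-1) ^ i * w ^ (i + 1) / fact (i + 2) * (w * T (i + 2)))"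
    proof -
      have "(\<Sum>k=1..n. \<Sum>i\<le>P+1. G i (of_nat k * w) * (-w) ^ i / fact i) = (\<Sum>i\<le>P+1. (-w) ^ i / fact i * T i)"
        unfolding T_def sum_distrib_left by (subst sum.swap) (simp add: mult_ac)
      also have "\<dots> = T 0 - w * T 1 + (\<Sum>i<P. (-w) ^ (i + 2) / fact (i + 2) * T (i + 2))"
        by (simp only: Suc_eq_plus1[symmetric] lessThan_Suc_atMost[symmetric] sum.lessThan_Suc_shift)
          (simp add: numeral_2_eq_2)
      also have "(\<Sum>i<P. (-w) ^ (i + 2) / fact (i + 2) * T (i + 2)) = (\<Sum>i<P. (-1) ^ i * w ^ (i + 1) / fact (i + 2) * (w * T (i + 2)))"
        by (intro sum.cong refl) (simp add: power_minus[of w] mult_ac)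
      finally have e: "(\<Sum>k=1..n. \<Sum>i\<le>P+1. G i (of_nat k * w) * (-w) ^ i / fact i) = T 0 - w * T 1 + (\<Sum>i<P. (-1) ^ i * w ^ (i + 1) / fact (i + 2) * (w * T (i + 2)))" .
      have t: "(\<Sum>k=1..n. G 0 ((of_nat k - 1) * w)) = T 0 - D 0"
        using tele by (simp add: sum_subtractf T_def diff_eq_eq eq_diff_eq add.commute)
      show ?thesis by (simp only: sum_subtractf e t) simp
    qed
    finally have main: "cmod (w * T 1 - D 0 - (\<Sum>i<P. (-1) ^ i * w ^ (i + 1) / fact (i + 2) * (w * T (i + 2))))
      \<le> real n * (B * cmod w ^ (P + 2))" by simp
    \<comment> \<open>The exponents add up: w^(i+1) in front and order P - 1 - i + 2 from the
      induction hypothesis make P + 2.\<close>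
    have inner: "cmod ((-1) ^ i * w ^ (i + 1) / fact (i + 2) * (w * T (i + 2)) - (\<Sum>j\<le>P-1-i. g i j))
       \<le> C (P - 1 - i) * B * real n * cmod w ^ (P + 2)" if i: "i < P" for i
    proof -
      have b: "cmod (w * T (i + 2) - (\<Sum>j\<le>P-1-i. of_real (em_coeff j) * w ^ j * D (i + 1 + j)))
         \<le> C (P - 1 - i) * B * real n * cmod w ^ (P - 1 - i + 2)"
        \<comment> \<open>Shifting the sequence by i + 1 makes \<open>G (i + 2)\<close> the summand
          and leaves \<open>G (P + 2)\<close> as the derivative to be bounded.\<close>
        using IH[of "P - 1 - i" S n w "\<lambda>j. G (i + 1 + j)" B] S wS dG BG i
        by (simp add: T_def D_def)
      have "cmod ((-1) ^ i * w ^ (i + 1) / fact (i + 2)) * cmod (w * T (i + 2) - (\<Sum>j\<le>P-1-i. of_real (em_coeff j) * w ^ j * D (i + 1 + j)))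
         \<le> cmod w ^ (i + 1) * (C (P - 1 - i) * B * real n * cmod w ^ (P - 1 - i + 2))"
      proof (rule mult_mono[OF _ b])
        have "cmod w ^ (i + 1) / fact (i + 2) \<le> cmod w ^ (i + 1) / 1"
          using fact_ge_1[of "i + 2", where 'a=real] by (intro divide_left_mono) (auto simp del: fact_Suc)
        then show "cmod ((-1) ^ i * w ^ (i + 1) / fact (i + 2)) \<le> cmod w ^ (i + 1)"
          by (simp add: norm_mult norm_divide norm_power del: fact_Suc)
      qed auto
      also have "\<dots> = C (P - 1 - i) * B * real n * (cmod w ^ (i + 1) * cmod w ^ (P - 1 - i + 2))" by simp
      also have "cmod w ^ (i + 1) * cmod w ^ (P - 1 - i + 2) = cmod w ^ (P + 2)"
        using i by (simp only: power_add[symmetric]) simp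
      finally show ?thesis
        by (simp only: norm_mult[symmetric] g_def right_diff_distrib sum_distrib_left)
    qed
    \<comment> \<open>Collecting the terms with i + j = m reproduces the recursion of
      \<open>em_coeff\<close>.\<close>
    have tri: "(\<Sum>i<P. \<Sum>j\<le>P-1-i. g i j) = (\<Sum>m<P. of_real (em_coeff (Suc m)) * w ^ Suc m * D (Suc m))"
    proof -
      have "(\<Sum>i<P. \<Sum>j\<le>P-1-i. g i j) = (\<Sum>(i,j)\<in>(SIGMA i:{..<P}. {..P-1-i}). g i j)"
        by (rule sum.Sigma) auto
      also have "(SIGMA i:{..<P}. {..P-1-i}) = {(i,j). i + j < P}" by auto
      also have "(\<Sum>(i,j)\<in>{(i,j). i + j < P}. g i j) = (\<Sum>m<P. \<Sum>i\<le>m. g i (m - i))"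
        by (rule sum.triangle_reindex)
      also have "\<dots> = (\<Sum>m<P. of_real (em_coeff (Suc m)) * w ^ Suc m * D (Suc m))"
      proof (rule sum.cong[OF refl])
        fix m
        have "g i (m - i) = of_real ((-1) ^ i / fact (i + 2) * em_coeff (m - i)) * (w ^ Suc m * D (Suc m))" if "i \<le> m" for i
        proof -
          have "w ^ Suc m = w ^ (i + 1) * w ^ (m - i)" using that by (simp only: power_add[symmetric]) simp
          then show ?thesis using that by (auto simp: g_def)
        qed
        then show "(\<Sum>i\<le>m. g i (m - i)) = of_real (em_coeff (Suc m)) * w ^ Suc m * D (Suc m)"
          by (simp add: sum_distrib_right mult.assoc)
      qed
      finally show ?thesis .
    qed
    have eq: "?err P n w G = (w * T 1 - D 0 - (\<Sum>i<P. (-1) ^ i * w ^ (i + 1) / fact (i + 2) * (w * T (i + 2))))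
       + (\<Sum>i<P. (-1) ^ i * w ^ (i + 1) / fact (i + 2) * (w * T (i + 2)) - (\<Sum>j\<le>P-1-i. g i j))"
      unfolding sum_subtractf tri T_def D_def[symmetric]
      by (simp add: lessThan_Suc_atMost[symmetric] sum.lessThan_Suc_shift del: sum.lessThan_Suc em_coeff.simps(2)) (simp add: D_def)
    have "cmod (?err P n w G) \<le> real n * (B * cmod w ^ (P + 2)) + (\<Sum>i<P. C (P - 1 - i) * B * real n * cmod w ^ (P + 2))"
      unfolding eq by (rule order_trans[OF norm_triangle_ineq add_mono[OF main order_trans[OF norm_sum sum_mono[OF inner]]]]) simp
    also have "\<dots> = K * B * real n * cmod w ^ (P + 2)"
    proof -
      define Z where "Z = (\<Sum>i<P. C (P - 1 - i))"
      have "(\<Sum>i<P. C (P - 1 - i) * B * real n * cmod w ^ (P + 2)) = Z * B * real n * cmod w ^ (P + 2)"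
        unfolding Z_def by (simp only: sum_distrib_right)
      moreover have "K = 1 + Z" by (simp add: K_def Z_def)
      ultimately show ?thesis by (simp add: distrib_right)
    qed
    finally show "cmod (?err P n w G) \<le> K * B * real n * cmod w ^ (P + 2)" .
  qed
qed

subsection \<open>Asymptotic expansions with explicit coefficients\<close>

text \<open>The type is complex because the series are evaluated at \<i>u, but the values are real;
  this is what later makes the expansion coefficients real.\<close>

definition explicit_coeff :: "(real \<Rightarrow> real \<Rightarrow> complex) \<Rightarrow> bool" where
  "explicit_coeff f \<longleftrightarrow> (\<exists>g. explicit_formula g \<and> f = (\<lambda>t \<theta>. of_real (g t \<theta>)))"

lemma explicit_coeffI: "explicit_formula g \<Longrightarrow> explicit_coeff (\<lambda>t \<theta>. of_real (g t \<theta>))"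
  by (auto simp: explicit_coeff_def)

lemma explicit_coeff_of_rat: "c \<in> \<rat> \<Longrightarrow> explicit_coeff (\<lambda>t \<theta>. of_real c)"
  by (rule explicit_coeffI[OF rat_const])

lemma explicit_coeff_0 [simp]: "explicit_coeff (\<lambda>t \<theta>. 0)" and explicit_coeff_1 [simp]: "explicit_coeff (\<lambda>t \<theta>. 1)"
  using explicit_coeff_of_rat[of 0] explicit_coeff_of_rat[of 1] by simp_all

lemma explicit_coeff_add:
  assumes "explicit_coeff f" "explicit_coeff g" shows "explicit_coeff (\<lambda>t \<theta>. f t \<theta> + g t \<theta>)"
proof -
  obtain f' g' where "explicit_formula f'" "explicit_formula g'" "f = (\<lambda>t \<theta>. of_real (f' t \<theta>))" "g = (\<lambda>t \<theta>. of_real (g' t \<theta>))"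
    using assms by (auto simp: explicit_coeff_def)
  then show ?thesis using explicit_coeffI[OF explicit_formula.add[of f' g']] by simp
qed

lemma explicit_coeff_mult:
  assumes "explicit_coeff f" "explicit_coeff g" shows "explicit_coeff (\<lambda>t \<theta>. f t \<theta> * g t \<theta>)"
proof -
  obtain f' g' where "explicit_formula f'" "explicit_formula g'" "f = (\<lambda>t \<theta>. of_real (f' t \<theta>))" "g = (\<lambda>t \<theta>. of_real (g' t \<theta>))"
    using assms by (auto simp: explicit_coeff_def)
  then show ?thesis using explicit_coeffI[OF explicit_formula.mult[of f' g']] by simp
qed

lemma explicit_coeff_power: "explicit_coeff f \<Longrightarrow> explicit_coeff (\<lambda>t \<theta>. f t \<theta> ^ k)"
  by (induction k) (auto intro: explicit_coeff_mult)

lemma explicit_coeff_sum: "finite I \<Longrightarrow> (\<And>i. i \<in> I \<Longrightarrow> explicit_coeff (f i)) \<Longrightarrow> explicit_coeff (\<lambda>t \<theta>. \<Sum>i\<in>I. f i t \<theta>)"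
  by (induction I rule: finite_induct) (auto intro: explicit_coeff_add)

lemma explicit_coeff_cmult: "explicit_coeff f \<Longrightarrow> c \<in> \<rat> \<Longrightarrow> explicit_coeff (\<lambda>t \<theta>. of_real c * f t \<theta>)"
  by (intro explicit_coeff_mult explicit_coeff_of_rat)

text \<open>At fixed t only \<theta> varies with n, so a bound on [0,1] is a bound uniform in
  n.\<close>

lemma explicit_formula_bounded: "explicit_formula g \<Longrightarrow> \<exists>C. \<forall>\<theta>. 0 \<le> \<theta> \<and> \<theta> \<le> 1 \<longrightarrow> \<bar>g t \<theta>\<bar> \<le> C"
proof (induction rule: explicit_formula.induct)
  case (add f g)
  then obtain C D where C: "\<forall>\<theta>. 0 \<le> \<theta> \<and> \<theta> \<le> 1 \<longrightarrow> \<bar>f t \<theta>\<bar> \<le> C" and D: "\<forall>\<theta>. 0 \<le> \<theta> \<and> \<theta> \<le> 1 \<longrightarrow> \<bar>g t \<theta>\<bar> \<le> D" by blast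
  have "\<bar>f t \<theta> + g t \<theta>\<bar> \<le> C + D" if "0 \<le> \<theta> \<and> \<theta> \<le> 1" for \<theta>
    using C[rule_format, OF that] D[rule_format, OF that] by linarith
  then show ?case by blast
next
  case (mult f g)
  from mult.IH obtain C D where C: "\<forall>\<theta>. 0 \<le> \<theta> \<and> \<theta> \<le> 1 \<longrightarrow> \<bar>f t \<theta>\<bar> \<le> C" and D: "\<forall>\<theta>. 0 \<le> \<theta> \<and> \<theta> \<le> 1 \<longrightarrow> \<bar>g t \<theta>\<bar> \<le> D" by blast
  have "\<bar>f t \<theta> * g t \<theta>\<bar> \<le> C * D" if \<theta>: "0 \<le> \<theta> \<and> \<theta> \<le> 1" for \<theta>
  proof -
    have "\<bar>f t \<theta>\<bar> \<le> C" "\<bar>g t \<theta>\<bar> \<le> D" using C D \<theta> by blast+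
    moreover from this have "0 \<le> C" by linarith
    ultimately show ?thesis unfolding abs_mult by (intro mult_mono) simp_all
  qed
  then show ?case by blast
next
  case frac_var
  then show ?case by (intro exI[of _ 1]) auto
qed auto

lemma explicit_coeff_bounded:
  assumes "explicit_coeff f" shows "\<exists>C. \<forall>\<theta>. 0 \<le> \<theta> \<and> \<theta> \<le> 1 \<longrightarrow> cmod (f t \<theta>) \<le> C"
  using assms explicit_formula_bounded[of _ t] by (fastforce simp: explicit_coeff_def)

text \<open>The parity condition makes the coefficients at odd \<open>k\<close> integrate to zero, and the degree bound, stable
  under multiplication, is attained by the powers of the cubic Taylor term of the phase.\<close>

definition graded :: "(real \<Rightarrow> real \<Rightarrow> complex poly fps) \<Rightarrow> bool" where
  "graded A \<longleftrightarrow> (\<forall>k m. explicit_coeff (\<lambda>t \<theta>. poly.coeff (A t \<theta> $ k) m) \<and>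
     (\<not> (m \<le> 3 * k \<and> even (k + m)) \<longrightarrow> (\<forall>t \<theta>. poly.coeff (A t \<theta> $ k) m = 0)))"

lemma gradedI:
  assumes "\<And>k m. explicit_coeff (\<lambda>t \<theta>. poly.coeff (A t \<theta> $ k) m)"
    and "\<And>k m t \<theta>. poly.coeff (A t \<theta> $ k) m \<noteq> 0 \<Longrightarrow> m \<le> 3 * k \<and> even (k + m)"
  shows "graded A"
  using assms unfolding graded_def by blast

lemma gradedD1: "graded A \<Longrightarrow> explicit_coeff (\<lambda>t \<theta>. poly.coeff (A t \<theta> $ k) m)"
  and gradedD2: "graded A \<Longrightarrow> poly.coeff (A t \<theta> $ k) m \<noteq> 0 \<Longrightarrow> m \<le> 3 * k \<and> even (k + m)"
  unfolding graded_def by blast+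

lemma graded_poly_eq:
  assumes "graded A"
  shows "poly (A t \<theta> $ k) s = (\<Sum>m\<le>3*k. poly.coeff (A t \<theta> $ k) m * s ^ m)"
proof -
  have "degree (A t \<theta> $ k) \<le> 3 * k"
    by (rule degree_le) (use gradedD2[OF assms] in force)
  then show ?thesis unfolding poly_altdef
    by (intro sum.mono_neutral_left) (auto simp: coeff_eq_0)
qed

lemma graded_add:
  assumes A: "graded A" and B: "graded B"
  shows "graded (\<lambda>t \<theta>. A t \<theta> + B t \<theta>)"
proof (rule gradedI)
  fix k m
  have eq: "poly.coeff ((A t \<theta> + B t \<theta>) $ k) m = poly.coeff (A t \<theta> $ k) m + poly.coeff (B t \<theta> $ k) m" for t \<theta>
    by simp
  show "explicit_coeff (\<lambda>t \<theta>. poly.coeff ((A t \<theta> + B t \<theta>) $ k) m)"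
    unfolding eq by (intro explicit_coeff_add gradedD1 A B)
  fix t \<theta> assume "poly.coeff ((A t \<theta> + B t \<theta>) $ k) m \<noteq> 0"
  then have "poly.coeff (A t \<theta> $ k) m \<noteq> 0 \<or> poly.coeff (B t \<theta> $ k) m \<noteq> 0" unfolding eq by force
  then show "m \<le> 3 * k \<and> even (k + m)" using gradedD2[OF A] gradedD2[OF B] by blast
qed

lemma graded_mult:
  assumes A: "graded A" and B: "graded B"
  shows "graded (\<lambda>t \<theta>. A t \<theta> * B t \<theta>)"
proof (rule gradedI)
  have eq: "poly.coeff ((A t \<theta> * B t \<theta>) $ k) m =
    (\<Sum>i=0..k. \<Sum>a\<le>m. poly.coeff (A t \<theta> $ i) a * poly.coeff (B t \<theta> $ (k - i)) (m - a))" for t \<theta> k m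
    by (simp add: fps_mult_nth coeff_sum coeff_mult)
  fix k m
  show "explicit_coeff (\<lambda>t \<theta>. poly.coeff ((A t \<theta> * B t \<theta>) $ k) m)"
    unfolding eq by (intro explicit_coeff_sum explicit_coeff_mult gradedD1 A B) auto
  fix t \<theta> assume "poly.coeff ((A t \<theta> * B t \<theta>) $ k) m \<noteq> 0"
  then obtain i a where ia: "i \<le> k" "a \<le> m" "poly.coeff (A t \<theta> $ i) a * poly.coeff (B t \<theta> $ (k - i)) (m - a) \<noteq> 0"
    unfolding eq by (metis (no_types, lifting) atLeastAtMost_iff atMost_iff sum.not_neutral_contains_not_neutral)
  then have "poly.coeff (A t \<theta> $ i) a \<noteq> 0" "poly.coeff (B t \<theta> $ (k - i)) (m - a) \<noteq> 0" by auto
  then have ab: "a \<le> 3 * i \<and> even (i + a)" "m - a \<le> 3 * (k - i) \<and> even ((k - i) + (m - a))"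
    using gradedD2[OF A] gradedD2[OF B] by blast+
  then have "even ((i + a) + ((k - i) + (m - a)))" using dvd_add[of 2 "i + a" "(k - i) + (m - a)"] by blast
  moreover have "k + m = (i + a) + ((k - i) + (m - a))" using ia by simp
  ultimately have "even (k + m)" by (simp only:)
  moreover have "m \<le> 3 * k" using ab ia by linarith
  ultimately show "m \<le> 3 * k \<and> even (k + m)" by simp
qed

lemma graded_const: "explicit_coeff c \<Longrightarrow> graded (\<lambda>t \<theta>. fps_const [:c t \<theta>:])"
proof (rule gradedI)
  assume c: "explicit_coeff c"
  fix k m
  show "explicit_coeff (\<lambda>t \<theta>. poly.coeff (fps_const [:c t \<theta>:] $ k) m)"
    using c by (cases k; cases m) auto
  show "m \<le> 3 * k \<and> even (k + m)" if "poly.coeff (fps_const [:c t \<theta>:] $ k) m \<noteq> 0" for t \<theta>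
    using that by (cases k; cases m) auto
qed

text \<open>The sum of infinitely many series, meant for families where \<open>A j\<close> has no
  terms below order j, so that only j \<le> k can contribute to order k.\<close>

definition fps_diagonal :: "(nat \<Rightarrow> 'a :: comm_monoid_add fps) \<Rightarrow> 'a fps" where
  "fps_diagonal A = Abs_fps (\<lambda>k. \<Sum>j\<le>k. A j $ k)"

lemma graded_diagonal: "(\<And>j. graded (A j)) \<Longrightarrow> graded (\<lambda>t \<theta>. fps_diagonal (\<lambda>j. A j t \<theta>))"
proof (rule gradedI)
  assume A: "\<And>j. graded (A j)"
  fix k m
  have eq: "poly.coeff (fps_diagonal (\<lambda>j. A j t \<theta>) $ k) m = (\<Sum>j\<le>k. poly.coeff (A j t \<theta> $ k) m)" for t \<theta>
    by (simp add: fps_diagonal_def coeff_sum)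
  show "explicit_coeff (\<lambda>t \<theta>. poly.coeff (fps_diagonal (\<lambda>j. A j t \<theta>) $ k) m)"
    unfolding eq by (intro explicit_coeff_sum gradedD1 A) auto
  fix t \<theta> assume "poly.coeff (fps_diagonal (\<lambda>j. A j t \<theta>) $ k) m \<noteq> 0"
  then obtain j where "poly.coeff (A j t \<theta> $ k) m \<noteq> 0"
    unfolding eq by (metis (no_types, lifting) sum.not_neutral_contains_not_neutral)
  then show "m \<le> 3 * k \<and> even (k + m)" using gradedD2[OF A] by blast
qed

text \<open>Errors are measured in powers of \<open>\<delta> = n\<^sup>-\<^sup>1\<^sup>/\<^sup>4\<close>, the square root of the expansion parameter
  \<open>n\<^sup>-\<^sup>1\<^sup>/\<^sup>2\<close>: one factor \<open>\<delta>\<close> absorbs any polynomial in \<open>u\<close> on the range \<open>|u| \<le> ln n\<close>.\<close>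

definition dl :: "nat \<Rightarrow> real" where "dl n = real n powr (-1/4)"

lemma dl_pos: "n \<ge> 1 \<Longrightarrow> dl n > 0" and dl_le_1: "n \<ge> 1 \<Longrightarrow> dl n \<le> 1"
  using ge_one_powr_ge_zero[of "real n" "1/4"] by (auto simp: dl_def powr_minus divide_le_eq inverse_le_1_iff)

lemma dl_power2: "n \<ge> 1 \<Longrightarrow> dl n ^ 2 = 1 / sqrt (real n)"
  by (simp add: dl_def powr_powr[symmetric] powr_half_sqrt[symmetric] powr_minus_divide powr_power field_simps)

lemma dl_power4: "n \<ge> 1 \<Longrightarrow> dl n ^ 4 = 1 / real n"
proof -
  assume n: "n \<ge> 1"
  have "dl n ^ 4 = (dl n ^ 2) ^ 2" by (simp add: power_mult[symmetric])
  then show ?thesis using n by (simp add: dl_power2 power_divide)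
qed

lemma ln_power_dl: "((\<lambda>n. C * ln (real n) ^ m * dl n) \<longlongrightarrow> 0) sequentially"
  unfolding dl_def by real_asymp

lemma eventually_ln_power_dl: "\<forall>\<^sub>F n in sequentially. C * ln (real n) ^ m * dl n \<le> 1"
  using order_tendstoD(2)[OF ln_power_dl[of C m], of 1] by (auto elim: eventually_mono)


section \<open>Calculus of expansions uniform on |u| \<le> ln n\<close>

abbreviation partial_expansion :: "real \<Rightarrow> (nat \<Rightarrow> real) \<Rightarrow> (real \<Rightarrow> real \<Rightarrow> complex poly fps) \<Rightarrow> nat \<Rightarrow> nat \<Rightarrow> real \<Rightarrow> complex" where
  "partial_expansion t \<theta> A K n u \<equiv> (\<Sum>k\<le>K. of_real (dl n) ^ (2 * k) * poly (A t (\<theta> n) $ k) (\<i> * of_real u))"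

text \<open>\<open>graded\<close> controls the formal coefficients for all t and \<theta>, the
  estimate concerns one t and one sequence \<theta>. The error at order K need only be of the size
  of the last power kept: this weak form survives the loss to polynomials in u, and K is
  arbitrary.\<close>

definition expands :: "real \<Rightarrow> (nat \<Rightarrow> real) \<Rightarrow> (nat \<Rightarrow> real \<Rightarrow> complex) \<Rightarrow> (real \<Rightarrow> real \<Rightarrow> complex poly fps) \<Rightarrow> bool" where
  "expands t \<theta> f A \<longleftrightarrow> graded A \<and> (\<forall>K. \<exists>C. \<forall>\<^sub>F n in sequentially. \<forall>u. \<bar>u\<bar> \<le> ln (real n) \<longrightarrow>
     cmod (f n u - partial_expansion t \<theta> A K n u) \<le> C * dl n ^ (2 * K))"

lemma expandsD:
  assumes "expands t \<theta> f A"
  obtains C where "C \<ge> 0" "\<forall>\<^sub>F n in sequentially. \<forall>u. \<bar>u\<bar> \<le> ln (real n) \<longrightarrow>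
     cmod (f n u - partial_expansion t \<theta> A K n u) \<le> C * dl n ^ (2 * K)"
proof -
  obtain C where C: "\<forall>\<^sub>F n in sequentially. \<forall>u. \<bar>u\<bar> \<le> ln (real n) \<longrightarrow>
     cmod (f n u - partial_expansion t \<theta> A K n u) \<le> C * dl n ^ (2 * K)"
    using assms by (auto simp: expands_def)
  show ?thesis
  proof (rule that[of "\<bar>C\<bar>"])
    show "\<forall>\<^sub>F n in sequentially. \<forall>u. \<bar>u\<bar> \<le> ln (real n) \<longrightarrow>
     cmod (f n u - partial_expansion t \<theta> A K n u) \<le> \<bar>C\<bar> * dl n ^ (2 * K)"
      using C
    proof eventually_elim
      case (elim n)
      have "C * dl n ^ (2 * K) \<le> \<bar>C\<bar> * dl n ^ (2 * K)" by (intro mult_right_mono) auto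
      then show ?case using elim by force
    qed
  qed auto
qed

lemma expands_graded: "expands t \<theta> f A \<Longrightarrow> graded A"
  by (simp add: expands_def)

text \<open>Coefficients may be as large as 1/d, so a product of two costs d^(-2), one step of the
  expansion; hence both factors are expanded to order K + 1. The constant collects the error of f
  times g, the partial sum of f times the error of g, and at most (K + 2)^2 products of order above
  K.\<close>

lemma product_expansion_error:
  fixes a b :: "nat \<Rightarrow> complex" and d C D :: real
  assumes d: "0 < d" "d \<le> 1"
    and a: "\<And>k. k \<le> Suc K \<Longrightarrow> cmod (a k) \<le> 1 / d" and b: "\<And>k. k \<le> Suc K \<Longrightarrow> cmod (b k) \<le> 1 / d"
    and f: "cmod (f - (\<Sum>k\<le>Suc K. of_real d ^ (2 * k) * a k)) \<le> C * d ^ (2 * Suc K)" "C \<ge> 0"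
    and g: "cmod (g - (\<Sum>k\<le>Suc K. of_real d ^ (2 * k) * b k)) \<le> D * d ^ (2 * Suc K)" "D \<ge> 0"
  shows "cmod (f * g - (\<Sum>k\<le>K. of_real d ^ (2 * k) * (\<Sum>i\<le>k. a i * b (k - i))))
     \<le> (C * (real K + 2 + D) + D * (real K + 2) + (real K + 2)\<^sup>2) * d ^ (2 * K)"
proof -
  define P Q where "P = (\<Sum>k\<le>Suc K. of_real d ^ (2 * k) * a k)" and "Q = (\<Sum>k\<le>Suc K. of_real d ^ (2 * k) * b k)"
  have tm: "cmod (of_real d ^ (2 * k) * c) \<le> 1 / d" if "cmod c \<le> 1 / d" for k c
  proof -
    have "cmod (of_real d ^ (2 * k) * c) = d ^ (2 * k) * cmod c" using d by (simp add: norm_mult norm_power)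
    also have "\<dots> \<le> 1 * (1 / d)" using d that by (intro mult_mono power_le_one) auto
    finally show ?thesis by simp
  qed
  have P: "cmod P \<le> (real K + 2) / d"
    unfolding P_def using sum_norm_bound[of "{..Suc K}" "\<lambda>k. of_real d ^ (2 * k) * a k" "1 / d"] tm a by (simp add: add.commute del: sum.atMost_Suc)
  have Q: "cmod Q \<le> (real K + 2) / d"
    unfolding Q_def using sum_norm_bound[of "{..Suc K}" "\<lambda>k. of_real d ^ (2 * k) * b k" "1 / d"] tm b by (simp add: add.commute del: sum.atMost_Suc)
  have dK: "d ^ (2 * Suc K) / d \<le> d ^ (2 * K)"
    using d by (simp add: mult_left_le_one_le)
  have dK1: "d ^ (2 * Suc K) \<le> 1 / d"
    using d power_le_one[of d "2 * Suc K"] by (simp add: pos_le_divide_eq mult_le_one)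
  have gb: "cmod g \<le> (real K + 2 + D) / d"
  proof -
    have "cmod g \<le> cmod Q + cmod (g - Q)" using norm_triangle_sub by blast
    also have "\<dots> \<le> (real K + 2) / d + D * (1 / d)"
      using Q order_trans[OF g(1) mult_left_mono[OF dK1 g(2)]] unfolding Q_def[symmetric] by (rule add_mono)
    finally show ?thesis by (simp add: add_divide_distrib)
  qed
  have e1: "cmod ((f - P) * g) \<le> C * (real K + 2 + D) * d ^ (2 * K)"
  proof -
    have "cmod ((f - P) * g) \<le> (C * d ^ (2 * Suc K)) * ((real K + 2 + D) / d)"
      unfolding norm_mult using f gb d g by (intro mult_mono) (auto simp: P_def)
    also have "\<dots> = C * (real K + 2 + D) * (d ^ (2 * Suc K) / d)" by simp
    also have "\<dots> \<le> C * (real K + 2 + D) * d ^ (2 * K)" using dK f g by (intro mult_left_mono) auto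
    finally show ?thesis .
  qed
  have e2: "cmod (P * (g - Q)) \<le> D * (real K + 2) * d ^ (2 * K)"
  proof -
    have "cmod (P * (g - Q)) \<le> ((real K + 2) / d) * (D * d ^ (2 * Suc K))"
      unfolding norm_mult using P g d by (intro mult_mono) (auto simp: Q_def)
    also have "\<dots> = D * (real K + 2) * (d ^ (2 * Suc K) / d)" by simp
    also have "\<dots> \<le> D * (real K + 2) * d ^ (2 * K)" using dK g by (intro mult_left_mono) auto
    finally show ?thesis .
  qed
  define h where "h = (\<lambda>(i, j). of_real d ^ (2 * (i + j)) * (a i * b j))"
  define R where "R = {..Suc K} \<times> {..Suc K} - {(i, j). i + j \<le> K}"
  have sub: "{(i, j). i + j \<le> K} \<subseteq> {..Suc K} \<times> {..Suc K}" by auto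
  have PQ: "P * Q = sum h ({..Suc K} \<times> {..Suc K})"
    unfolding P_def Q_def sum_product sum.cartesian_product h_def
    by (intro sum.cong) (auto simp: power_add distrib_left)
  have tri: "(\<Sum>k\<le>K. of_real d ^ (2 * k) * (\<Sum>i\<le>k. a i * b (k - i))) = sum h {(i, j). i + j \<le> K}"
  proof -
    have "sum h {(i, j). i + j \<le> K} = (\<Sum>k\<le>K. \<Sum>i\<le>k. h (i, k - i))"
      using sum.triangle_reindex_eq[of "\<lambda>i j. h (i, j)" K] by (simp add: case_prod_unfold)
    also have "\<dots> = (\<Sum>k\<le>K. of_real d ^ (2 * k) * (\<Sum>i\<le>k. a i * b (k - i)))"
      unfolding sum_distrib_left
    proof (intro sum.cong refl)
      fix k i :: nat assume "i \<in> {..k}"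
      then have "i + (k - i) = k" by simp
      then show "h (i, k - i) = of_real d ^ (2 * k) * (a i * b (k - i))" by (simp only: h_def prod.case)
    qed
    finally show ?thesis by simp
  qed
  have e3: "cmod (P * Q - (\<Sum>k\<le>K. of_real d ^ (2 * k) * (\<Sum>i\<le>k. a i * b (k - i)))) \<le> (real K + 2)\<^sup>2 * d ^ (2 * K)"
  proof -
    have "P * Q - (\<Sum>k\<le>K. of_real d ^ (2 * k) * (\<Sum>i\<le>k. a i * b (k - i))) = sum h R"
      unfolding PQ tri R_def using sub by (subst sum_diff) auto
    also have "cmod \<dots> \<le> real (card R) * d ^ (2 * K)"
    proof (rule sum_norm_bound)
      fix p assume "p \<in> R"
      then obtain i j where p: "p = (i, j)" "i \<le> Suc K" "j \<le> Suc K" "K < i + j" by (auto simp: R_def)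
      have "cmod (h p) = d ^ (2 * (i + j)) * (cmod (a i) * cmod (b j))"
        using d by (simp add: h_def p norm_mult norm_power)
      also have "\<dots> \<le> d ^ (2 * Suc K) * ((1 / d) * (1 / d))"
        using d p a b by (intro mult_mono power_decreasing) auto
      also have "\<dots> = d ^ (2 * K)" using d by simp
      finally show "cmod (h p) \<le> d ^ (2 * K)" .
    qed
    also have "real (card R) \<le> real (card ({..Suc K} \<times> {..Suc K}))"
      unfolding R_def by (intro of_nat_mono card_mono) auto
    also have "\<dots> = (real K + 2)\<^sup>2" by (simp add: card_cartesian_product power2_eq_square algebra_simps)
    finally show ?thesis using d by (simp add: mult_right_mono)
  qed
  have "f * g - (\<Sum>k\<le>K. of_real d ^ (2 * k) * (\<Sum>i\<le>k. a i * b (k - i))) =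
     (f - P) * g + P * (g - Q) + (P * Q - (\<Sum>k\<le>K. of_real d ^ (2 * k) * (\<Sum>i\<le>k. a i * b (k - i))))"
    by (simp add: algebra_simps)
  also have "cmod \<dots> \<le> C * (real K + 2 + D) * d ^ (2 * K) + D * (real K + 2) * d ^ (2 * K) + (real K + 2)\<^sup>2 * d ^ (2 * K)"
    by (intro order_trans[OF norm_triangle_ineq] add_mono e1 e2 e3)
  finally show ?thesis by (simp only: distrib_right)
qed

context
  fixes t :: real and \<theta> :: "nat \<Rightarrow> real"
  assumes \<theta>: "\<And>n. 0 \<le> \<theta> n" "\<And>n. \<theta> n \<le> 1"
begin

text \<open>On |u| \<le> ln n a polynomial of degree 3k with bounded coefficients grows like a power
  of ln n, which n^(1/4) eventually exceeds.\<close>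

lemma graded_eventually_small:
  assumes "graded A"
  shows "\<forall>\<^sub>F n in sequentially. \<forall>u. \<bar>u\<bar> \<le> ln (real n) \<longrightarrow> cmod (poly (A t (\<theta> n) $ k) (\<i> * of_real u)) \<le> 1 / dl n"
proof -
  have "\<exists>C. \<forall>\<theta>. 0 \<le> \<theta> \<and> \<theta> \<le> 1 \<longrightarrow> cmod (poly.coeff (A t \<theta> $ k) m) \<le> C" for m
    by (rule explicit_coeff_bounded[OF gradedD1[OF assms]])
  then obtain C where C: "\<And>m \<theta>. 0 \<le> \<theta> \<Longrightarrow> \<theta> \<le> 1 \<Longrightarrow> cmod (poly.coeff (A t \<theta> $ k) m) \<le> C m" by metis
  have C0: "0 \<le> C m" for m using C[of 0 m] norm_ge_zero order_trans by (metis order_refl zero_le_one)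
  have lim: "((\<lambda>n. \<Sum>m\<le>3*k. C m * ln (real n) ^ m * dl n) \<longlongrightarrow> (\<Sum>m\<le>3*k. 0)) sequentially"
    by (intro tendsto_sum ln_power_dl)
  have "\<forall>\<^sub>F n in sequentially. (\<Sum>m\<le>3*k. C m * ln (real n) ^ m * dl n) < 1"
    by (rule order_tendstoD(2)[OF lim]) simp
  then show ?thesis using eventually_ge_at_top[of 1]
  proof eventually_elim
    case (elim n)
    show ?case
    proof (intro allI impI)
      fix u assume u: "\<bar>u\<bar> \<le> ln (real n)"
      have "cmod (poly (A t (\<theta> n) $ k) (\<i> * of_real u)) \<le> (\<Sum>m\<le>3*k. cmod (poly.coeff (A t (\<theta> n) $ k) m * (\<i> * of_real u) ^ m))"
        unfolding graded_poly_eq[OF assms] by (rule norm_sum)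
      also have "\<dots> \<le> (\<Sum>m\<le>3*k. C m * ln (real n) ^ m)"
        unfolding norm_mult norm_power using u \<theta> C C0
        by (intro sum_mono mult_mono power_mono) auto
      finally have "cmod (poly (A t (\<theta> n) $ k) (\<i> * of_real u)) * dl n \<le> (\<Sum>m\<le>3*k. C m * ln (real n) ^ m) * dl n"
        using dl_pos[of n] elim by (intro mult_right_mono) auto
      also have "\<dots> \<le> 1" using elim by (simp add: sum_distrib_right)
      finally show "cmod (poly (A t (\<theta> n) $ k) (\<i> * of_real u)) \<le> 1 / dl n"
        using dl_pos[of n] elim by (simp add: pos_le_divide_eq)
    qed
  qed
qed

lemma graded_eventually_small_upto:
  assumes "graded A"
  shows "\<forall>\<^sub>F n in sequentially. \<forall>u. \<bar>u\<bar> \<le> ln (real n) \<longrightarrow> (\<forall>k\<le>K. cmod (poly (A t (\<theta> n) $ k) (\<i> * of_real u)) \<le> 1 / dl n)"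
proof -
  have "\<forall>\<^sub>F n in sequentially. \<forall>k\<in>{..K}. \<forall>u. \<bar>u\<bar> \<le> ln (real n) \<longrightarrow> cmod (poly (A t (\<theta> n) $ k) (\<i> * of_real u)) \<le> 1 / dl n"
    by (intro eventually_ball_finite ballI graded_eventually_small assms) auto
  then show ?thesis by eventually_elim auto
qed

lemma expands_mult:
  assumes A: "expands t \<theta> f A" and B: "expands t \<theta> g B"
  shows "expands t \<theta> (\<lambda>n u. f n u * g n u) (\<lambda>t \<theta>. A t \<theta> * B t \<theta>)"
  unfolding expands_def
proof (intro conjI allI)
  show "graded (\<lambda>t \<theta>. A t \<theta> * B t \<theta>)" using A B by (intro graded_mult expands_graded)
  fix K
  obtain C where C: "C \<ge> 0" "\<forall>\<^sub>F n in sequentially. \<forall>u. \<bar>u\<bar> \<le> ln (real n) \<longrightarrow>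
     cmod (f n u - partial_expansion t \<theta> A (Suc K) n u) \<le> C * dl n ^ (2 * Suc K)"
    by (rule expandsD[OF A])
  obtain D where D: "D \<ge> 0" "\<forall>\<^sub>F n in sequentially. \<forall>u. \<bar>u\<bar> \<le> ln (real n) \<longrightarrow>
     cmod (g n u - partial_expansion t \<theta> B (Suc K) n u) \<le> D * dl n ^ (2 * Suc K)"
    by (rule expandsD[OF B])
  have "\<forall>\<^sub>F n in sequentially. \<forall>u. \<bar>u\<bar> \<le> ln (real n) \<longrightarrow>
     cmod (f n u * g n u - (\<Sum>k\<le>K. of_real (dl n) ^ (2 * k) * poly ((A t (\<theta> n) * B t (\<theta> n)) $ k) (\<i> * of_real u)))
     \<le> (C * (real K + 2 + D) + D * (real K + 2) + (real K + 2)\<^sup>2) * dl n ^ (2 * K)"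
    using C(2) D(2) graded_eventually_small_upto[OF expands_graded[OF A], of "Suc K"]
      graded_eventually_small_upto[OF expands_graded[OF B], of "Suc K"] eventually_ge_at_top[of 1]
  proof eventually_elim
    case (elim n)
    show ?case
    proof (intro allI impI)
      fix u assume u: "\<bar>u\<bar> \<le> ln (real n)"
      have "poly ((A t (\<theta> n) * B t (\<theta> n)) $ k) (\<i> * of_real u) =
         (\<Sum>i\<le>k. poly (A t (\<theta> n) $ i) (\<i> * of_real u) * poly (B t (\<theta> n) $ (k - i)) (\<i> * of_real u))" for k
        by (simp add: fps_mult_nth poly_sum atMost_atLeast0)
      then show "cmod (f n u * g n u - (\<Sum>k\<le>K. of_real (dl n) ^ (2 * k) * poly ((A t (\<theta> n) * B t (\<theta> n)) $ k) (\<i> * of_real u)))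
     \<le> (C * (real K + 2 + D) + D * (real K + 2) + (real K + 2)\<^sup>2) * dl n ^ (2 * K)"
        using elim u C(1) D(1) dl_pos[of n] dl_le_1[of n] by (simp only:) (intro product_expansion_error, auto)
    qed
  qed
  then show "\<exists>C. \<forall>\<^sub>F n in sequentially. \<forall>u. \<bar>u\<bar> \<le> ln (real n) \<longrightarrow>
     cmod (f n u * g n u - (\<Sum>k\<le>K. of_real (dl n) ^ (2 * k) * poly ((A t (\<theta> n) * B t (\<theta> n)) $ k) (\<i> * of_real u)))
     \<le> C * dl n ^ (2 * K)" by blast
qed

lemma expands_add:
  assumes A: "expands t \<theta> f A" and B: "expands t \<theta> g B"
  shows "expands t \<theta> (\<lambda>n u. f n u + g n u) (\<lambda>t \<theta>. A t \<theta> + B t \<theta>)"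
  unfolding expands_def
proof (intro conjI allI)
  show "graded (\<lambda>t \<theta>. A t \<theta> + B t \<theta>)" using A B by (intro graded_add expands_graded)
  fix K
  obtain C where C: "C \<ge> 0" "\<forall>\<^sub>F n in sequentially. \<forall>u. \<bar>u\<bar> \<le> ln (real n) \<longrightarrow>
     cmod (f n u - partial_expansion t \<theta> A K n u) \<le> C * dl n ^ (2 * K)"
    by (rule expandsD[OF A])
  obtain D where D: "D \<ge> 0" "\<forall>\<^sub>F n in sequentially. \<forall>u. \<bar>u\<bar> \<le> ln (real n) \<longrightarrow>
     cmod (g n u - partial_expansion t \<theta> B K n u) \<le> D * dl n ^ (2 * K)"
    by (rule expandsD[OF B])
  have "\<forall>\<^sub>F n in sequentially. \<forall>u. \<bar>u\<bar> \<le> ln (real n) \<longrightarrow>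
     cmod (f n u + g n u - (\<Sum>k\<le>K. of_real (dl n) ^ (2 * k) * poly ((A t (\<theta> n) + B t (\<theta> n)) $ k) (\<i> * of_real u)))
     \<le> (C + D) * dl n ^ (2 * K)"
    using C(2) D(2)
  proof eventually_elim
    case (elim n)
    show ?case
    proof (intro allI impI)
      fix u assume u: "\<bar>u\<bar> \<le> ln (real n)"
      have "f n u + g n u - (\<Sum>k\<le>K. of_real (dl n) ^ (2 * k) * poly ((A t (\<theta> n) + B t (\<theta> n)) $ k) (\<i> * of_real u))
        = (f n u - partial_expansion t \<theta> A K n u) +
          (g n u - partial_expansion t \<theta> B K n u)"
        by (simp add: distrib_left sum.distrib)
      also have "cmod \<dots> \<le> C * dl n ^ (2 * K) + D * dl n ^ (2 * K)"
        using elim u by (intro order_trans[OF norm_triangle_ineq] add_mono) blast+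
      finally show "cmod (f n u + g n u - (\<Sum>k\<le>K. of_real (dl n) ^ (2 * k) * poly ((A t (\<theta> n) + B t (\<theta> n)) $ k) (\<i> * of_real u)))
         \<le> (C + D) * dl n ^ (2 * K)" by (simp only: distrib_right)
    qed
  qed
  then show "\<exists>C. \<forall>\<^sub>F n in sequentially. \<forall>u. \<bar>u\<bar> \<le> ln (real n) \<longrightarrow>
     cmod (f n u + g n u - (\<Sum>k\<le>K. of_real (dl n) ^ (2 * k) * poly ((A t (\<theta> n) + B t (\<theta> n)) $ k) (\<i> * of_real u)))
     \<le> C * dl n ^ (2 * K)" by blast
qed

end

context
  fixes t :: real and \<theta> :: "nat \<Rightarrow> real"
  assumes \<theta>: "\<And>n. 0 \<le> \<theta> n" "\<And>n. \<theta> n \<le> 1"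
begin

lemma expands_const:
  assumes "explicit_coeff c"
  shows "expands t \<theta> (\<lambda>n u. c t (\<theta> n)) (\<lambda>t \<theta>. fps_const [:c t \<theta>:])"
  unfolding expands_def
proof (intro conjI allI)
  show "graded (\<lambda>t \<theta>. fps_const [:c t \<theta>:])" by (rule graded_const[OF assms])
  fix K
  have "(\<Sum>k\<le>K. of_real (dl n) ^ (2 * k) * poly (fps_const [:c t (\<theta> n):] $ k) (\<i> * of_real u)) = c t (\<theta> n)" for n u
    by (subst sum.atMost_shift) simp
  then show "\<exists>C. \<forall>\<^sub>F n in sequentially. \<forall>u. \<bar>u\<bar> \<le> ln (real n) \<longrightarrow>
     cmod (c t (\<theta> n) - (\<Sum>k\<le>K. of_real (dl n) ^ (2 * k) * poly (fps_const [:c t (\<theta> n):] $ k) (\<i> * of_real u))) \<le> C * dl n ^ (2 * K)"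
    by (intro exI[of _ 0]) simp
qed

text \<open>\<open>fps_X\<close> stands for \<epsilon> = n^(-1/2).\<close>

lemma expands_inverse_n: "expands t \<theta> (\<lambda>n u. 1 / of_nat n) (\<lambda>t \<theta>. fps_X ^ 2)"
  unfolding expands_def
proof (intro conjI allI)
  have c: "poly.coeff ((fps_X ^ 2 :: complex poly fps) $ k) m = (if k = 2 \<and> m = 0 then 1 else 0)" for k m
    by simp
  show "graded (\<lambda>t \<theta>. fps_X ^ 2)"
    by (rule gradedI) (auto simp: c split: if_splits)
  fix K
  show "\<exists>C. \<forall>\<^sub>F n in sequentially. \<forall>u. \<bar>u\<bar> \<le> ln (real n) \<longrightarrow>
     cmod (1 / of_nat n - (\<Sum>k\<le>K. of_real (dl n) ^ (2 * k) * poly ((fps_X ^ 2) $ k) (\<i> * of_real u))) \<le> C * dl n ^ (2 * K)"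
  proof (intro exI[of _ 1] eventually_mono[OF eventually_ge_at_top[of 1]] allI impI)
    fix n :: nat and u :: real assume n: "1 \<le> n"
    have s: "(\<Sum>k\<le>K. of_real (dl n) ^ (2 * k) * poly ((fps_X ^ 2) $ k) (\<i> * of_real u)) = (if 2 \<le> K then of_real (dl n ^ 4) else 0)"
      by (simp add: if_distrib[of "\<lambda>p. poly p _"] if_distrib[of "(*) _"] sum.delta cong: if_cong)
    have "dl n ^ 4 \<le> dl n ^ (2 * K)" if "K < 2"
      using that dl_pos[OF n] dl_le_1[OF n] by (intro power_decreasing) auto
    then show "cmod (1 / of_nat n - (\<Sum>k\<le>K. of_real (dl n) ^ (2 * k) * poly ((fps_X ^ 2) $ k) (\<i> * of_real u))) \<le> 1 * dl n ^ (2 * K)"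
      using n dl_pos[OF n] unfolding s by (auto simp: dl_power4 norm_divide)
  qed
qed

text \<open>At v = u/sqrt n the Taylor term of order k is \<epsilon>^k (\<i>u)^k up to its
  coefficient. For s = 1 the factor n = \<epsilon>^(-2) lowers every order by two: Taylor orders 0
  and 1 must vanish to avoid negative powers, and order 2 because degree k + 2 \<le> 3k fails at k =
  0.\<close>

lemma expands_local:
  assumes s: "s = 0 \<or> s = 1 \<and> (\<forall>t'. c 0 t' = 0 \<and> c 1 t' = 0 \<and> c 2 t' = 0)"
    and c: "\<And>k. explicit_coeff (\<lambda>t \<theta>. c k t)"
    and g: "\<And>K. \<exists>C r. r > 0 \<and> (\<forall>v. \<bar>v\<bar> \<le> r \<longrightarrow> cmod (g v - (\<Sum>k\<le>K. c k t * (\<i> * of_real v) ^ k)) \<le> C * \<bar>v\<bar> ^ Suc K)"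
  shows "expands t \<theta> (\<lambda>n u. of_nat n ^ s * g (u / sqrt (real n))) (\<lambda>t \<theta>. Abs_fps (\<lambda>k. monom (c (k + 2 * s) t) (k + 2 * s)))"
  unfolding expands_def
proof (intro conjI allI)
  have cm: "poly.coeff (Abs_fps (\<lambda>k. monom (c (k + 2 * s) t) (k + 2 * s)) $ k) m = (if m = k + 2 * s then c (k + 2 * s) t else 0)" for t k m
    by simp
  show "graded (\<lambda>t \<theta>. Abs_fps (\<lambda>k. monom (c (k + 2 * s) t) (k + 2 * s)))"
  proof (rule gradedI)
    fix k m
    show "explicit_coeff (\<lambda>t \<theta>. poly.coeff (Abs_fps (\<lambda>k. monom (c (k + 2 * s) t) (k + 2 * s)) $ k) m)"
      unfolding cm using c by (cases "m = k + 2 * s") auto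
    fix t assume "poly.coeff (Abs_fps (\<lambda>k. monom (c (k + 2 * s) t) (k + 2 * s)) $ k) m \<noteq> 0"
    then have m: "m = k + 2 * s" "c (k + 2 * s) t \<noteq> 0" unfolding cm by (auto split: if_splits)
    moreover have "k \<ge> 1" if "s = 1" using s m that by (cases "k = 0") (auto simp: numeral_2_eq_2)
    ultimately show "m \<le> 3 * k \<and> even (k + m)" using s by auto
  qed
  fix K
  obtain C r where r: "r > 0" and C: "\<And>v. \<bar>v\<bar> \<le> r \<Longrightarrow> cmod (g v - (\<Sum>k\<le>K + 2 * s. c k t * (\<i> * of_real v) ^ k)) \<le> C * \<bar>v\<bar> ^ Suc (K + 2 * s)"
    using g[of "K + 2 * s"] by blast
  have C0: "C \<ge> 0"
  proof (rule ccontr)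
    assume "\<not> C \<ge> 0"
    then have "C * \<bar>r\<bar> ^ Suc (K + 2 * s) < 0" using r by (intro mult_neg_pos) auto
    then show False using order_trans[OF norm_ge_zero C[of r]] r by simp
  qed
  show "\<exists>C. \<forall>\<^sub>F n in sequentially. \<forall>u. \<bar>u\<bar> \<le> ln (real n) \<longrightarrow>
     cmod (of_nat n ^ s * g (u / sqrt (real n)) - (\<Sum>k\<le>K. of_real (dl n) ^ (2 * k) * poly (Abs_fps (\<lambda>k. monom (c (k + 2 * s) t) (k + 2 * s)) $ k) (\<i> * of_real u)))
       \<le> C * dl n ^ (2 * K)"
  proof (rule exI[of _ C])
    show "\<forall>\<^sub>F n in sequentially. \<forall>u. \<bar>u\<bar> \<le> ln (real n) \<longrightarrow>
     cmod (of_nat n ^ s * g (u / sqrt (real n)) - (\<Sum>k\<le>K. of_real (dl n) ^ (2 * k) * poly (Abs_fps (\<lambda>k. monom (c (k + 2 * s) t) (k + 2 * s)) $ k) (\<i> * of_real u)))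
       \<le> C * dl n ^ (2 * K)"
      \<comment> \<open>The first condition puts v inside the radius r; the second lets one factor
        \<open>dl n\<close> absorb the power of |u| in the Taylor remainder.\<close>
      using eventually_ln_power_dl[of "1 / r" 1] eventually_ln_power_dl[of 1 "Suc (K + 2 * s)"] eventually_ge_at_top[of 1]
    proof eventually_elim
      case (elim n)
      note d = dl_pos[OF elim(3)] dl_le_1[OF elim(3)]
      show ?case
      proof (intro allI impI)
        fix u assume u: "\<bar>u\<bar> \<le> ln (real n)"
        define v where "v = u / sqrt (real n)"
        have v: "v = dl n ^ 2 * u" using dl_power2[OF elim(3)] by (simp add: v_def)
        have ns: "real n ^ s * dl n ^ (4 * s) = 1"
          using elim(3) by (simp add: power_mult dl_power4 flip: power_mult_distrib)
        have "\<bar>v\<bar> \<le> ln (real n) * dl n ^ 2" unfolding v abs_mult using u by (simp add: mult.commute mult_right_mono)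
        also have "\<dots> \<le> ln (real n) * dl n" using d elim(3) by (intro mult_left_mono) (auto simp: power2_eq_square mult_left_le_one_le)
        also have "\<dots> \<le> r" using elim(1) r by (simp add: divide_le_eq)
        finally have "\<bar>v\<bar> \<le> r" .
        note Cv = C[OF this]
        have vk: "of_nat n ^ s * (\<i> * of_real v) ^ (k + 2 * s) = of_real (dl n) ^ (2 * k) * (\<i> * of_real u) ^ (k + 2 * s)" for k
        proof -
          have "of_nat n ^ s * (\<i> * of_real v) ^ (k + 2 * s) = of_real (real n ^ s * dl n ^ (2 * (k + 2 * s))) * (\<i> * of_real u) ^ (k + 2 * s)"
            by (simp only: v of_real_mult of_real_power of_real_of_nat_eq power_mult_distrib power_mult[of _ 2] mult_ac)
          also have "real n ^ s * dl n ^ (2 * (k + 2 * s)) = (real n ^ s * dl n ^ (4 * s)) * dl n ^ (2 * k)"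
            by (simp add: power_add)
          finally show ?thesis unfolding ns by simp
        qed
        have "(\<Sum>k\<le>K + 2 * s. c k t * (\<i> * of_real v) ^ k) = (\<Sum>k\<le>K. c (k + 2 * s) t * (\<i> * of_real v) ^ (k + 2 * s))"
          using s
        proof
          assume s1: "s = 1 \<and> (\<forall>t'. c 0 t' = 0 \<and> c 1 t' = 0 \<and> c 2 t' = 0)"
          then have "c 0 t = 0" "c (Suc 0) t = 0" by auto
          then show ?thesis using s1
            by (simp add: lessThan_Suc_atMost[symmetric] sum.lessThan_Suc_shift del: sum.lessThan_Suc)
        qed simp
        then have e: "(\<Sum>k\<le>K. of_real (dl n) ^ (2 * k) * poly (Abs_fps (\<lambda>k. monom (c (k + 2 * s) t) (k + 2 * s)) $ k) (\<i> * of_real u))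
           = of_nat n ^ s * (\<Sum>k\<le>K + 2 * s. c k t * (\<i> * of_real v) ^ k)"
          by (simp add: sum_distrib_left poly_monom mult.left_commute[of "of_nat n ^ s"] vk) (simp add: mult_ac)
        have "cmod (of_nat n ^ s * g v - of_nat n ^ s * (\<Sum>k\<le>K + 2 * s. c k t * (\<i> * of_real v) ^ k))
            = real n ^ s * cmod (g v - (\<Sum>k\<le>K + 2 * s. c k t * (\<i> * of_real v) ^ k))"
          by (simp add: right_diff_distrib[symmetric] norm_mult norm_power)
        also have "\<dots> \<le> real n ^ s * (C * \<bar>v\<bar> ^ Suc (K + 2 * s))" using Cv by (intro mult_left_mono) auto
        also have "\<bar>v\<bar> ^ Suc (K + 2 * s) = dl n ^ (2 * Suc (K + 2 * s)) * \<bar>u\<bar> ^ Suc (K + 2 * s)"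
          by (simp only: v abs_mult power_mult_distrib power_mult) simp
        also have "real n ^ s * (C * (dl n ^ (2 * Suc (K + 2 * s)) * \<bar>u\<bar> ^ Suc (K + 2 * s)))
           = C * (real n ^ s * dl n ^ (4 * s)) * (dl n ^ (2 * K) * (dl n ^ 2 * \<bar>u\<bar> ^ Suc (K + 2 * s)))"
        proof -
          have "2 * Suc (K + 2 * s) = 4 * s + (2 * K + 2)" by simp
          then show ?thesis by (simp only: power_add mult_ac)
        qed
        also have "\<dots> \<le> C * (real n ^ s * dl n ^ (4 * s)) * (dl n ^ (2 * K) * 1)"
        proof -
          have "dl n ^ 2 * \<bar>u\<bar> ^ Suc (K + 2 * s) \<le> dl n * ln (real n) ^ Suc (K + 2 * s)"
            using d u by (intro mult_mono power_mono) (auto simp: power2_eq_square mult_left_le_one_le)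
          also have "\<dots> \<le> 1" using elim(2) by (simp add: mult.commute)
          finally show ?thesis using C0 d by (intro mult_left_mono) (auto simp: ns)
        qed
        finally show "cmod (of_nat n ^ s * g (u / sqrt (real n)) - (\<Sum>k\<le>K. of_real (dl n) ^ (2 * k) * poly (Abs_fps (\<lambda>k. monom (c (k + 2 * s) t) (k + 2 * s)) $ k) (\<i> * of_real u)))
          \<le> C * dl n ^ (2 * K)" unfolding e v_def[symmetric] by (simp add: ns)
      qed
    qed
  qed
qed

text \<open>Summands with j > K do not reach order K, so cutting at any J \<ge> K gives the same
  coefficients. The choice of J is left open because the remainder of \<open>f\<close> may demand
  more than K terms.\<close>

lemma expands_diagonal:
  assumes F: "\<And>j. expands t \<theta> (F j) (A j)"
    and A0: "\<And>j k t \<theta>. k < j \<Longrightarrow> A j t \<theta> $ k = 0"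
    and f: "\<And>K. \<exists>J\<ge>K. \<exists>C. \<forall>\<^sub>F n in sequentially. \<forall>u. \<bar>u\<bar> \<le> ln (real n) \<longrightarrow> cmod (f n u - (\<Sum>j\<le>J. F j n u)) \<le> C * dl n ^ (2 * K)"
  shows "expands t \<theta> f (\<lambda>t \<theta>. fps_diagonal (\<lambda>j. A j t \<theta>))"
  unfolding expands_def
proof (intro conjI allI)
  show "graded (\<lambda>t \<theta>. fps_diagonal (\<lambda>j. A j t \<theta>))"
    using F by (intro graded_diagonal expands_graded)
  fix K
  obtain J C where J: "J \<ge> K" and C: "\<forall>\<^sub>F n in sequentially. \<forall>u. \<bar>u\<bar> \<le> ln (real n) \<longrightarrow> cmod (f n u - (\<Sum>j\<le>J. F j n u)) \<le> C * dl n ^ (2 * K)"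
    using f by blast
  have "\<forall>j. \<exists>D. \<forall>\<^sub>F n in sequentially. \<forall>u. \<bar>u\<bar> \<le> ln (real n) \<longrightarrow>
     cmod (F j n u - partial_expansion t \<theta> (A j) K n u) \<le> D * dl n ^ (2 * K)"
    using F by (simp add: expands_def)
  then obtain D where D: "\<And>j. \<forall>\<^sub>F n in sequentially. \<forall>u. \<bar>u\<bar> \<le> ln (real n) \<longrightarrow>
     cmod (F j n u - partial_expansion t \<theta> (A j) K n u) \<le> D j * dl n ^ (2 * K)"
    using choice[where Q = "\<lambda>j D. \<forall>\<^sub>F n in sequentially. \<forall>u. \<bar>u\<bar> \<le> ln (real n) \<longrightarrow>
     cmod (F j n u - partial_expansion t \<theta> (A j) K n u) \<le> D * dl n ^ (2 * K)"] by blast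
  have "\<forall>\<^sub>F n in sequentially. \<forall>j\<in>{..J}. \<forall>u. \<bar>u\<bar> \<le> ln (real n) \<longrightarrow>
     cmod (F j n u - partial_expansion t \<theta> (A j) K n u) \<le> D j * dl n ^ (2 * K)"
    by (intro eventually_ball_finite ballI D) auto
  with C have "\<forall>\<^sub>F n in sequentially. \<forall>u. \<bar>u\<bar> \<le> ln (real n) \<longrightarrow>
     cmod (f n u - (\<Sum>k\<le>K. of_real (dl n) ^ (2 * k) * poly (fps_diagonal (\<lambda>j. A j t (\<theta> n)) $ k) (\<i> * of_real u))) \<le> (C + (\<Sum>j\<le>J. D j)) * dl n ^ (2 * K)"
  proof eventually_elim
    case (elim n)
    show ?case
    proof (intro allI impI)
      fix u assume u: "\<bar>u\<bar> \<le> ln (real n)"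
      let ?P = "\<lambda>j k. of_real (dl n) ^ (2 * k) * poly (A j t (\<theta> n) $ k) (\<i> * of_real u)"
      have "(\<Sum>k\<le>K. of_real (dl n) ^ (2 * k) * poly (fps_diagonal (\<lambda>j. A j t (\<theta> n)) $ k) (\<i> * of_real u)) = (\<Sum>k\<le>K. \<Sum>j\<le>k. ?P j k)"
        by (simp add: fps_diagonal_def poly_sum sum_distrib_left)
      also have "\<dots> = (\<Sum>k\<le>K. \<Sum>j\<le>J. ?P j k)"
        using J A0 by (intro sum.cong refl sum.mono_neutral_left) auto
      also have "\<dots> = (\<Sum>j\<le>J. \<Sum>k\<le>K. ?P j k)" by (rule sum.swap)
      finally have "f n u - (\<Sum>k\<le>K. of_real (dl n) ^ (2 * k) * poly (fps_diagonal (\<lambda>j. A j t (\<theta> n)) $ k) (\<i> * of_real u))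
        = (f n u - (\<Sum>j\<le>J. F j n u)) + (\<Sum>j\<le>J. F j n u - (\<Sum>k\<le>K. ?P j k))"
        by (simp add: sum_subtractf)
      also have "cmod \<dots> \<le> C * dl n ^ (2 * K) + (\<Sum>j\<le>J. D j * dl n ^ (2 * K))"
        using elim u by (intro order_trans[OF norm_triangle_ineq] add_mono order_trans[OF norm_sum] sum_mono) auto
      finally show "cmod (f n u - (\<Sum>k\<le>K. of_real (dl n) ^ (2 * k) * poly (fps_diagonal (\<lambda>j. A j t (\<theta> n)) $ k) (\<i> * of_real u)))
         \<le> (C + (\<Sum>j\<le>J. D j)) * dl n ^ (2 * K)"
        by (simp only: distrib_right sum_distrib_right)
    qed
  qed
  then show "\<exists>C. \<forall>\<^sub>F n in sequentially. \<forall>u. \<bar>u\<bar> \<le> ln (real n) \<longrightarrow>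
     cmod (f n u - (\<Sum>k\<le>K. of_real (dl n) ^ (2 * k) * poly (fps_diagonal (\<lambda>j. A j t (\<theta> n)) $ k) (\<i> * of_real u))) \<le> C * dl n ^ (2 * K)"
    by blast
qed

lemma expands_power:
  assumes A: "expands t \<theta> f A"
  shows "expands t \<theta> (\<lambda>n u. f n u ^ k) (\<lambda>t \<theta>. A t \<theta> ^ k)"
proof (induction k)
  case 0
  show ?case using expands_const[of "\<lambda>_ _. 1"] by (simp add: one_pCons[symmetric])
next
  case (Suc k)
  show ?case using expands_mult[OF \<theta> A Suc.IH] by simp
qed

text \<open>Without constant term the leading contribution is dl^2 times a polynomial bounded by
  1/dl.\<close>

lemma expands_small:
  assumes A: "expands t \<theta> f A" and A0: "\<And>t \<theta>. A t \<theta> $ 0 = 0"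
  shows "\<exists>C\<ge>0. \<forall>\<^sub>F n in sequentially. \<forall>u. \<bar>u\<bar> \<le> ln (real n) \<longrightarrow> cmod (f n u) \<le> C * dl n"
proof -
  obtain C where C: "C \<ge> 0" "\<forall>\<^sub>F n in sequentially. \<forall>u. \<bar>u\<bar> \<le> ln (real n) \<longrightarrow>
     cmod (f n u - partial_expansion t \<theta> A 1 n u) \<le> C * dl n ^ (2 * 1)"
    by (rule expandsD[OF A])
  have "\<forall>\<^sub>F n in sequentially. \<forall>u. \<bar>u\<bar> \<le> ln (real n) \<longrightarrow> cmod (f n u) \<le> (C + 1) * dl n"
    using C(2) graded_eventually_small[where t = t and k = 1 and \<theta> = \<theta>, OF \<theta> expands_graded[OF A]] eventually_ge_at_top[of 1]
  proof eventually_elim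
    case (elim n)
    note d = dl_pos[OF elim(3)] dl_le_1[OF elim(3)]
    show ?case
    proof (intro allI impI)
      fix u assume u: "\<bar>u\<bar> \<le> ln (real n)"
      let ?p = "poly (A t (\<theta> n) $ 1) (\<i> * of_real u)"
      have "cmod (f n u) \<le> cmod (of_real (dl n) ^ 2 * ?p) + cmod (f n u - of_real (dl n) ^ 2 * ?p)"
        by (rule norm_triangle_sub)
      also have "\<dots> \<le> dl n ^ 2 * (1 / dl n) + C * dl n ^ 2"
      proof (rule add_mono)
        show "cmod (of_real (dl n) ^ 2 * ?p) \<le> dl n ^ 2 * (1 / dl n)"
        proof -
          have "cmod ?p \<le> 1 / dl n" using elim(2) u by blast
          then have "dl n ^ 2 * cmod ?p \<le> dl n ^ 2 * (1 / dl n)" by (rule mult_left_mono) simp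
          then show ?thesis using d by (simp add: norm_mult norm_power)
        qed
        show "cmod (f n u - of_real (dl n) ^ 2 * ?p) \<le> C * dl n ^ 2"
          using elim(1) u A0 by simp
      qed
      also have "\<dots> \<le> dl n + C * dl n"
        using d C(1) by (intro add_mono mult_left_mono) (auto simp: power2_eq_square mult_left_le_one_le)
      finally show "cmod (f n u) \<le> (C + 1) * dl n" by (simp add: distrib_right)
    qed
  qed
  then show ?thesis using C(1) by (intro exI[of _ "C + 1"]) auto
qed

text \<open>The j-th powers start at order j, as the diagonal sum requires. Since f is only O(dl),
  the exponential series is cut at 2K to leave an error of order dl^(2K).\<close>

lemma expands_exp:
  assumes A: "expands t \<theta> f A" and A0: "\<And>t \<theta>. A t \<theta> $ 0 = 0"
  shows "expands t \<theta> (\<lambda>n u. exp (f n u)) (\<lambda>t \<theta>. fps_diagonal (\<lambda>j. fps_const [:1 / fact j:] * A t \<theta> ^ j))"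
proof (rule expands_diagonal[where F = "\<lambda>j n u. 1 / fact j * f n u ^ j" and A = "\<lambda>j t \<theta>. fps_const [:1 / fact j:] * A t \<theta> ^ j"])
  fix j
  have "fact j \<in> (\<rat> :: real set)" by (metis Rats_of_nat of_nat_fact)
  then have "explicit_coeff (\<lambda>_ _. 1 / fact j)"
    using explicit_coeff_of_rat[of "1 / fact j"] by simp
  then show "expands t \<theta> (\<lambda>n u. 1 / fact j * f n u ^ j) (\<lambda>t \<theta>. fps_const [:1 / fact j:] * A t \<theta> ^ j)"
    using expands_mult[OF \<theta> expands_const expands_power[OF A]] by blast
next
  fix j k t \<theta> assume "k < (j :: nat)"
  then have "(A t \<theta> ^ j) $ k = 0" using startsby_zero_power_prefix[OF A0] by blast
  then show "(fps_const [:1 / fact j:] * A t \<theta> ^ j) $ k = 0" by simp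
next
  fix K
  obtain C where C: "C \<ge> 0" "\<forall>\<^sub>F n in sequentially. \<forall>u. \<bar>u\<bar> \<le> ln (real n) \<longrightarrow> cmod (f n u) \<le> C * dl n"
    using expands_small[OF A A0] by blast
  have "\<forall>\<^sub>F n in sequentially. \<forall>u. \<bar>u\<bar> \<le> ln (real n) \<longrightarrow> cmod (exp (f n u) - (\<Sum>j\<le>2 * K. 1 / fact j * f n u ^ j)) \<le> (exp C * C ^ Suc (2 * K)) * dl n ^ (2 * K)"
    using C(2) eventually_ge_at_top[of 1]
  proof eventually_elim
    case (elim n)
    note d = dl_pos[OF elim(2)] dl_le_1[OF elim(2)]
    show ?case
    proof (intro allI impI)
      fix u assume u: "\<bar>u\<bar> \<le> ln (real n)"
      have fb: "cmod (f n u) \<le> C * dl n" using elim u by blast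
      also have "\<dots> \<le> C" using d C(1) by (simp add: mult_left_le)
      finally have fC: "cmod (f n u) \<le> C" .
      have "cmod (exp (f n u) - (\<Sum>j\<le>2 * K. f n u ^ j / fact j)) \<le> exp \<bar>Re (f n u)\<bar> * cmod (f n u) ^ Suc (2 * K) / fact (2 * K)"
        by (rule Taylor_exp)
      also have "\<dots> \<le> exp \<bar>Re (f n u)\<bar> * cmod (f n u) ^ Suc (2 * K) / 1"
        by (intro divide_left_mono fact_ge_1) auto
      also have "\<dots> \<le> exp C * (C * dl n) ^ Suc (2 * K)"
        unfolding div_by_1 using fb fC abs_Re_le_cmod[of "f n u"] by (intro mult_mono power_mono) auto
      also have "\<dots> \<le> exp C * C ^ Suc (2 * K) * dl n ^ (2 * K)"
      proof -
        have "dl n ^ Suc (2 * K) \<le> dl n ^ (2 * K)" using d by (intro power_decreasing) auto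
        then have "(exp C * C ^ Suc (2 * K)) * dl n ^ Suc (2 * K) \<le> exp C * C ^ Suc (2 * K) * dl n ^ (2 * K)"
          using C(1) by (intro mult_left_mono) auto
        then show ?thesis by (simp only: power_mult_distrib mult.assoc)
      qed
      finally show "cmod (exp (f n u) - (\<Sum>j\<le>2 * K. 1 / fact j * f n u ^ j)) \<le> (exp C * C ^ Suc (2 * K)) * dl n ^ (2 * K)"
        by simp
    qed
  qed
  then show "\<exists>J\<ge>K. \<exists>C. \<forall>\<^sub>F n in sequentially. \<forall>u. \<bar>u\<bar> \<le> ln (real n) \<longrightarrow> cmod (exp (f n u) - (\<Sum>j\<le>J. 1 / fact j * f n u ^ j)) \<le> C * dl n ^ (2 * K)"
    by (intro exI[of _ "2 * K"]) auto
qed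

end

text \<open>The moment of order \<open>m\<close> of \<open>\<i>u\<close>, where \<open>u\<close> is centred Gaussian with variance \<open>v\<close>.\<close>

definition gauss_moment :: "nat \<Rightarrow> real \<Rightarrow> real" where
  "gauss_moment m v = (if even m then (-1) ^ (m div 2) * fact m / (2 ^ (m div 2) * fact (m div 2)) * v ^ (m div 2) else 0)"

section \<open>Gaussian integration of an expansion\<close>

lemma gaussian_moment_integral:
  assumes \<sigma>: "\<sigma> > 0"
  shows "has_bochner_integral lborel (\<lambda>u. of_real (exp (- \<sigma>\<^sup>2 * u\<^sup>2 / 2)) * (\<i> * of_real u) ^ m)
     (complex_of_real (sqrt (2 * pi) / \<sigma> * gauss_moment m (1 / \<sigma>\<^sup>2)))"
proof -
  have nd: "normal_density 0 (1 / \<sigma>) u * (u - 0) ^ m = \<sigma> / sqrt (2 * pi) * (exp (- \<sigma>\<^sup>2 * u\<^sup>2 / 2) * u ^ m)" for u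
    using \<sigma> by (simp add: normal_density_def real_sqrt_divide real_sqrt_mult field_simps)
  define M where "M = (if even m then fact m / ((2 * \<sigma>\<^sup>2) ^ (m div 2) * fact (m div 2)) else 0)"
  have "has_bochner_integral lborel (\<lambda>u. normal_density 0 (1 / \<sigma>) u * (u - 0) ^ m) M"
  proof (cases "even m")
    case True
    then obtain k where k: "m = 2 * k" by blast
    show ?thesis using normal_moment_even[of "1 / \<sigma>" 0 k] \<sigma> by (simp add: k M_def power_divide)
  next
    case False
    then obtain k where k: "m = 2 * k + 1" by (blast elim: oddE)
    show ?thesis using normal_moment_odd[of "1 / \<sigma>" 0 k] \<sigma> by (simp add: k M_def)
  qed
  then have "has_bochner_integral lborel (\<lambda>u. (sqrt (2 * pi) / \<sigma>) * (\<sigma> / sqrt (2 * pi) * (exp (- \<sigma>\<^sup>2 * u\<^sup>2 / 2) * u ^ m))) (sqrt (2 * pi) / \<sigma> * M)"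
    unfolding nd by (rule has_bochner_integral_mult_right)
  then have "has_bochner_integral lborel (\<lambda>u. exp (- \<sigma>\<^sup>2 * u\<^sup>2 / 2) * u ^ m) (sqrt (2 * pi) / \<sigma> * M)"
    using \<sigma> by simp
  then have 1: "has_bochner_integral lborel (\<lambda>u. \<i> ^ m * complex_of_real (exp (- \<sigma>\<^sup>2 * u\<^sup>2 / 2) * u ^ m)) (\<i> ^ m * complex_of_real (sqrt (2 * pi) / \<sigma> * M))"
    by (intro has_bochner_integral_mult_right has_bochner_integral_of_real)
  have 2: "\<i> ^ m * complex_of_real (sqrt (2 * pi) / \<sigma> * M) = complex_of_real (sqrt (2 * pi) / \<sigma> * gauss_moment m (1 / \<sigma>\<^sup>2))"
  proof (cases "even m")
    case True
    then obtain k where k: "m = 2 * k" by blast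
    have "(\<i> ^ k)\<^sup>2 = (-1) ^ k" by (metis power2_i power_mult mult.commute)
    then show ?thesis using \<sigma> by (simp add: k M_def gauss_moment_def power_mult power_mult_distrib power_divide mult_ac)
  qed (simp add: M_def gauss_moment_def)
  have 3: "(\<lambda>u. \<i> ^ m * complex_of_real (exp (- \<sigma>\<^sup>2 * u\<^sup>2 / 2) * u ^ m)) = (\<lambda>u. of_real (exp (- \<sigma>\<^sup>2 * u\<^sup>2 / 2)) * (\<i> * of_real u) ^ m)"
    by (simp add: power_mult_distrib mult_ac)
  show ?thesis using 1 unfolding 2 3 .
qed

text \<open>Half of the Gaussian exponent serves as integrable weight; the other half pays for the
  range beyond ln n.\<close>

lemma gaussian_abs_moment_integrable:
  fixes \<sigma> :: real
  assumes \<sigma>: "\<sigma> > 0"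
  shows "integrable lborel (\<lambda>u. exp (- \<sigma>\<^sup>2 * u\<^sup>2 / 4) * \<bar>u\<bar> ^ m)"
proof -
  have "integrable lborel (\<lambda>u. cmod (of_real (exp (- (\<sigma> / sqrt 2)\<^sup>2 * u\<^sup>2 / 2)) * (\<i> * of_real u) ^ m))"
    using \<sigma> by (intro Bochner_Integration.integrable_norm integrable.intros[OF gaussian_moment_integral]) simp
  then show ?thesis by (simp add: norm_mult norm_power power_divide)
qed

text \<open>exp(-c (ln n)^2) = n^(-c ln n) lies below every fixed power of n.\<close>

lemma eventually_gauss_tail:
  assumes "c > 0"
  shows "\<forall>\<^sub>F n in sequentially. exp (- c * ln (real n) ^ 2) \<le> dl n ^ K"
proof -
  have "((\<lambda>n. exp (- c * ln (real n) ^ 2) * real n powr (real K / 4)) \<longlongrightarrow> 0) sequentially"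
    using assms by real_asymp
  then have "\<forall>\<^sub>F n in sequentially. exp (- c * ln (real n) ^ 2) * real n powr (real K / 4) < 1"
    by (rule order_tendstoD) simp
  then show ?thesis using eventually_ge_at_top[of 1]
  proof eventually_elim
    case (elim n)
    have "dl n ^ K = 1 / real n powr (real K / 4)"
    proof -
      have "dl n ^ K = real n powr (- (real K / 4))"
        unfolding dl_def using elim(2) by (subst powr_power) auto
      then show ?thesis by (simp add: powr_minus_divide)
    qed
    then show ?case using elim by (simp add: pos_le_divide_eq)
  qed
qed

text \<open>Extend the integrand by zero and compare on the whole line with the partial expansion,
  whose integrals are exact moments. Inside |u| \<le> ln n the difference is the expansion error,
  outside it is the polynomial part alone, which the Gaussian makes negligible.\<close>

lemma graded_gauss_expansion:
  fixes t :: real and \<theta> :: "nat \<Rightarrow> real"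
  assumes \<theta>: "\<And>n. 0 \<le> \<theta> n" "\<And>n. \<theta> n \<le> 1" and \<sigma>: "\<sigma> > 0"
    and W: "expands t \<theta> W A"
    and cont: "\<forall>\<^sub>F n in sequentially. continuous_on {- ln (real n)..ln (real n)} (W n)"
  shows "\<exists>C. \<forall>\<^sub>F n in sequentially.
     cmod ((LINT u:{- ln (real n)..ln (real n)}|lborel. of_real (exp (- \<sigma>\<^sup>2 * u\<^sup>2 / 2)) * W n u)
       - of_real (sqrt (2 * pi) / \<sigma>) * (\<Sum>k\<le>K. of_real (dl n) ^ (2 * k) *
           (\<Sum>m\<le>3*k. poly.coeff (A t (\<theta> n) $ k) m * of_real (gauss_moment m (1 / \<sigma>\<^sup>2)))))
     \<le> C * dl n ^ (2 * K)"
proof -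
  define G where "G = (\<lambda>u. exp (- \<sigma>\<^sup>2 * u\<^sup>2 / 2))"
  define G' where "G' = (\<lambda>u. exp (- \<sigma>\<^sup>2 * u\<^sup>2 / 4))"
  have G_int: "integrable lborel G"
    using gaussian_abs_moment_integrable[of "\<sigma> * sqrt 2" 0] \<sigma> by (simp add: G_def power_mult_distrib mult.commute)
  obtain C where C0: "C \<ge> 0" and C: "\<forall>\<^sub>F n in sequentially. \<forall>u. \<bar>u\<bar> \<le> ln (real n) \<longrightarrow>
     cmod (W n u - partial_expansion t \<theta> A K n u) \<le> C * dl n ^ (2 * K)"
    by (rule expandsD[OF W])
  have gr: "graded A" by (rule expands_graded[OF W])
  have "\<exists>D. \<forall>\<theta>. 0 \<le> \<theta> \<and> \<theta> \<le> 1 \<longrightarrow> cmod (poly.coeff (A t \<theta> $ k) m) \<le> D" for k m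
    by (rule explicit_coeff_bounded[OF gradedD1[OF gr]])
  then obtain D where D: "\<And>k m \<theta>. 0 \<le> \<theta> \<Longrightarrow> \<theta> \<le> 1 \<Longrightarrow> cmod (poly.coeff (A t \<theta> $ k) m) \<le> D k m" by metis
  define B where "B = (\<lambda>m. integral\<^sup>L lborel (\<lambda>u. G' u * \<bar>u\<bar> ^ m))"
  \<comment> \<open>The first summand covers the range |u| \<le> ln n, the second the polynomials
    beyond it, integrated against \<open>G'\<close>.\<close>
  define E where "E = C * integral\<^sup>L lborel G + (\<Sum>k\<le>K. \<Sum>m\<le>3*k. D k m * B m)"
  have ev: "\<forall>\<^sub>F n in sequentially. exp (- (\<sigma>\<^sup>2 / 4) * ln (real n) ^ 2) \<le> dl n ^ (2 * K)"
    using \<sigma> by (intro eventually_gauss_tail) simp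
  show ?thesis
  proof (rule exI[of _ E])
    show "\<forall>\<^sub>F n in sequentially.
     cmod ((LINT u:{- ln (real n)..ln (real n)}|lborel. of_real (exp (- \<sigma>\<^sup>2 * u\<^sup>2 / 2)) * W n u)
       - of_real (sqrt (2 * pi) / \<sigma>) * (\<Sum>k\<le>K. of_real (dl n) ^ (2 * k) *
           (\<Sum>m\<le>3*k. poly.coeff (A t (\<theta> n) $ k) m * of_real (gauss_moment m (1 / \<sigma>\<^sup>2)))))
     \<le> E * dl n ^ (2 * K)"
      using C cont ev eventually_ge_at_top[of 1]
    proof eventually_elim
      case (elim n)
      note d = dl_pos[OF elim(4)] dl_le_1[OF elim(4)]
      define R where "R = ln (real n)"
      define a where "a = (\<lambda>k m. of_real (dl n) ^ (2 * k) * poly.coeff (A t (\<theta> n) $ k) m)"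
      define S where "S = (\<lambda>u. \<Sum>k\<le>K. \<Sum>m\<le>3*k. a k m * (\<i> * of_real u) ^ m)"
      have S_eq: "S u = partial_expansion t \<theta> A K n u" for u
        by (simp add: S_def a_def graded_poly_eq[OF gr] sum_distrib_left mult.assoc)
      have a_bound: "cmod (a k m) \<le> D k m" for k m
      proof -
        have "cmod (a k m) \<le> 1 * D k m"
          unfolding a_def norm_mult using d D[OF \<theta>] by (intro mult_mono) (auto simp: norm_power power_le_one)
        then show ?thesis by simp
      qed
      have "has_bochner_integral lborel (\<lambda>u. \<Sum>k\<le>K. \<Sum>m\<le>3*k. a k m * (of_real (G u) * (\<i> * of_real u) ^ m))
         (\<Sum>k\<le>K. \<Sum>m\<le>3*k. a k m * complex_of_real (sqrt (2 * pi) / \<sigma> * gauss_moment m (1 / \<sigma>\<^sup>2)))"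
        unfolding G_def by (intro has_bochner_integral_sum has_bochner_integral_mult_right gaussian_moment_integral \<sigma>)
      moreover have "(\<lambda>u. \<Sum>k\<le>K. \<Sum>m\<le>3*k. a k m * (of_real (G u) * (\<i> * of_real u) ^ m)) = (\<lambda>u. of_real (G u) * S u)"
        by (simp add: S_def sum_distrib_left mult_ac)
      moreover have "(\<Sum>k\<le>K. \<Sum>m\<le>3*k. a k m * complex_of_real (sqrt (2 * pi) / \<sigma> * gauss_moment m (1 / \<sigma>\<^sup>2)))
         = of_real (sqrt (2 * pi) / \<sigma>) * (\<Sum>k\<le>K. of_real (dl n) ^ (2 * k) *
           (\<Sum>m\<le>3*k. poly.coeff (A t (\<theta> n) $ k) m * of_real (gauss_moment m (1 / \<sigma>\<^sup>2))))"
        unfolding sum_distrib_left by (intro sum.cong refl) (simp only: a_def of_real_mult mult_ac)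
      ultimately have GS: "has_bochner_integral lborel (\<lambda>u. of_real (G u) * S u) (of_real (sqrt (2 * pi) / \<sigma>) * (\<Sum>k\<le>K. of_real (dl n) ^ (2 * k) *
           (\<Sum>m\<le>3*k. poly.coeff (A t (\<theta> n) $ k) m * of_real (gauss_moment m (1 / \<sigma>\<^sup>2)))))"
        by (simp only:)
      define F where "F = (\<lambda>u. indicator {- R..R} u *\<^sub>R (of_real (G u) * W n u))"
      have F_int: "integrable lborel F"
        unfolding F_def using elim(2) unfolding R_def[symmetric] G_def
        by (intro borel_integrable_compact continuous_intros) auto
      define h where "h = (\<lambda>u. C * dl n ^ (2 * K) * G u + (\<Sum>k\<le>K. \<Sum>m\<le>3*k. D k m * (dl n ^ (2 * K) * (G' u * \<bar>u\<bar> ^ m))))"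
      have B_int: "integrable lborel (\<lambda>u. G' u * \<bar>u\<bar> ^ m)" for m
        unfolding G'_def by (rule gaussian_abs_moment_integrable[OF \<sigma>])
      have "has_bochner_integral lborel h (C * dl n ^ (2 * K) * integral\<^sup>L lborel G + (\<Sum>k\<le>K. \<Sum>m\<le>3*k. D k m * (dl n ^ (2 * K) * B m)))"
        unfolding h_def B_def
        by (intro has_bochner_integral_add has_bochner_integral_mult_right has_bochner_integral_sum has_bochner_integral_integrable G_int B_int)
      moreover have "C * dl n ^ (2 * K) * integral\<^sup>L lborel G + (\<Sum>k\<le>K. \<Sum>m\<le>3*k. D k m * (dl n ^ (2 * K) * B m)) = E * dl n ^ (2 * K)"
        unfolding E_def distrib_right sum_distrib_right by (simp only: mult_ac)
      ultimately have h_int: "integrable lborel h" and h_val: "integral\<^sup>L lborel h = E * dl n ^ (2 * K)"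
        by (simp_all add: has_bochner_integral_iff)
      have D0: "D k m \<ge> 0" for k m using a_bound[of k m] norm_ge_zero order_trans by blast
      have bound: "norm (F u - of_real (G u) * S u) \<le> h u" for u
      proof (cases "\<bar>u\<bar> \<le> R")
        case True
        have "norm (F u - of_real (G u) * S u) = G u * cmod (W n u - S u)"
          using True by (simp add: F_def G_def right_diff_distrib[symmetric] norm_mult indicator_def abs_le_iff)
        also have "\<dots> \<le> G u * (C * dl n ^ (2 * K))"
          using elim(1) True unfolding S_eq R_def by (intro mult_left_mono) (auto simp: G_def)
        also have "\<dots> \<le> h u"
        proof -
          have "(\<Sum>k\<le>K. \<Sum>m\<le>3*k. D k m * (dl n ^ (2 * K) * (G' u * \<bar>u\<bar> ^ m))) \<ge> 0"
            using D0 d by (intro sum_nonneg mult_nonneg_nonneg) (auto simp: G'_def)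
          then show ?thesis by (simp add: h_def mult_ac)
        qed
        finally show ?thesis .
      next
        case False
        \<comment> \<open>The exponent is split into equal halves, and one of them is estimated at
          the boundary R = ln n.\<close>
        have "G u \<le> dl n ^ (2 * K) * G' u"
        proof -
          have "R \<ge> 0" using elim(4) by (simp add: R_def)
          then have "R\<^sup>2 \<le> u\<^sup>2" using False by (simp add: abs_le_square_iff[symmetric])
          then have "- \<sigma>\<^sup>2 * u\<^sup>2 / 2 \<le> - (\<sigma>\<^sup>2 / 4) * R\<^sup>2 + - \<sigma>\<^sup>2 * u\<^sup>2 / 4"
            using mult_left_mono[of "R\<^sup>2" "u\<^sup>2" "\<sigma>\<^sup>2"] by simp
          then have "G u \<le> exp (- (\<sigma>\<^sup>2 / 4) * R\<^sup>2) * G' u"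
            unfolding G_def G'_def exp_add[symmetric] by simp
          also have "\<dots> \<le> dl n ^ (2 * K) * G' u"
            using elim(3) by (intro mult_right_mono) (auto simp: R_def G'_def)
          finally show ?thesis .
        qed
        note Gu = this
        have "u \<notin> {- R..R}" using False by auto
        then have "norm (F u - of_real (G u) * S u) = G u * cmod (S u)"
          by (simp add: F_def G_def norm_mult)
        also have "\<dots> \<le> G u * (\<Sum>k\<le>K. \<Sum>m\<le>3*k. D k m * \<bar>u\<bar> ^ m)"
        proof (intro mult_left_mono)
          show "cmod (S u) \<le> (\<Sum>k\<le>K. \<Sum>m\<le>3*k. D k m * \<bar>u\<bar> ^ m)"
            unfolding S_def
            by (intro order_trans[OF norm_sum] sum_mono) (simp add: norm_mult norm_power a_bound mult_right_mono)
        qed (simp add: G_def)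
        also have "\<dots> \<le> (dl n ^ (2 * K) * G' u) * (\<Sum>k\<le>K. \<Sum>m\<le>3*k. D k m * \<bar>u\<bar> ^ m)"
          using Gu D0 by (intro mult_right_mono sum_nonneg mult_nonneg_nonneg) auto
        also have "\<dots> = (\<Sum>k\<le>K. \<Sum>m\<le>3*k. D k m * (dl n ^ (2 * K) * (G' u * \<bar>u\<bar> ^ m)))"
          by (simp add: sum_distrib_left mult_ac)
        also have "\<dots> \<le> h u" using C0 d by (simp add: h_def G_def)
        finally show ?thesis .
      qed
      have "(LINT u:{- ln (real n)..ln (real n)}|lborel. of_real (exp (- \<sigma>\<^sup>2 * u\<^sup>2 / 2)) * W n u) = integral\<^sup>L lborel F"
        by (simp add: set_lebesgue_integral_def F_def G_def R_def)
      moreover have "integral\<^sup>L lborel F - integral\<^sup>L lborel (\<lambda>u. of_real (G u) * S u) = integral\<^sup>L lborel (\<lambda>u. F u - of_real (G u) * S u)"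
        using F_int GS by (intro Bochner_Integration.integral_diff[symmetric]) (auto simp: has_bochner_integral_iff)
      moreover have "cmod (integral\<^sup>L lborel (\<lambda>u. F u - of_real (G u) * S u)) \<le> integral\<^sup>L lborel h"
      proof (rule order_trans[OF Bochner_Integration.integral_norm_bound Bochner_Integration.integral_mono])
        show "integrable lborel (\<lambda>u. norm (F u - of_real (G u) * S u))"
          using F_int GS by (intro Bochner_Integration.integrable_norm Bochner_Integration.integrable_diff) (auto simp: has_bochner_integral_iff)
      qed (use h_int bound in auto)
      ultimately show ?case using GS h_val by (simp add: has_bochner_integral_iff)
    qed
  qed
qed

subsection \<open>The expansion of the integrand\<close>

lemma holomorphic_taylor_bound:
  assumes "f holomorphic_on S" "open S" "cball a r \<subseteq> S"
  shows "\<exists>C. \<forall>z\<in>cball a r. cmod (f z - (\<Sum>k\<le>K. (deriv ^^ k) f a / fact k * (z - a) ^ k)) \<le> C * cmod (z - a) ^ Suc K"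
proof -
  have "continuous_on (cball a r) ((deriv ^^ Suc K) f)"
    using assms by (intro holomorphic_on_imp_continuous_on[OF holomorphic_on_subset[OF holomorphic_higher_deriv]])
  then have "compact ((deriv ^^ Suc K) f ` cball a r)" by (rule compact_continuous_image) simp
  from compact_imp_bounded[OF this] obtain B where Bi: "\<forall>y\<in>(deriv ^^ Suc K) f ` cball a r. cmod y \<le> B"
    unfolding bounded_iff ..
  have B: "cmod ((deriv ^^ Suc K) f z) \<le> B" if "z \<in> cball a r" for z by (rule bspec[OF Bi imageI[OF that]])
  show ?thesis
  proof (intro exI[of _ "B / fact K"] ballI)
    fix z assume z: "z \<in> cball a r"
    then have "0 \<le> r" using order_trans[OF zero_le_dist[of a z]] by (simp del: zero_le_dist)
    then have a: "a \<in> cball a r" by simp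
    have "cmod ((deriv ^^ 0) f z - (\<Sum>i\<le>K. (deriv ^^ i) f a * (z - a) ^ i / fact i)) \<le> B * cmod (z - a) ^ Suc K / fact K"
    proof (rule complex_Taylor[where S = "cball a r" and f = "\<lambda>i. (deriv ^^ i) f" and B = B, OF convex_cball _ B a z])
      fix i x assume "x \<in> cball a r" "i \<le> K"
      then have "x \<in> S" using assms(3) by blast
      then show "((deriv ^^ i) f has_field_derivative (deriv ^^ Suc i) f x) (at x within cball a r)"
        using holomorphic_derivI[OF holomorphic_higher_deriv[OF assms(1,2)] assms(2)] by (simp add: has_field_derivative_at_within)
    qed
    then show "cmod (f z - (\<Sum>k\<le>K. (deriv ^^ k) f a / fact k * (z - a) ^ k)) \<le> B / fact K * cmod (z - a) ^ Suc K"
      by (simp add: mult_ac)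
  qed
qed

lemma strip_taylor_real:
  fixes f :: "complex \<Rightarrow> complex"
  assumes f: "f holomorphic_on strip" and d: "\<And>k. (deriv ^^ k) f (of_real t) = of_real (d k)"
  shows "\<exists>C r. r > 0 \<and> (\<forall>v. \<bar>v\<bar> \<le> r \<longrightarrow> cmod (f (of_real t + \<i> * of_real v) - (\<Sum>k\<le>K. of_real (d k / fact k) * (\<i> * of_real v) ^ k)) \<le> C * \<bar>v\<bar> ^ Suc K)"
proof -
  have sub: "cball (of_real t) 1 \<subseteq> strip"
  proof
    fix z assume "z \<in> cball (complex_of_real t) 1"
    then have "cmod (z - of_real t) \<le> 1" by (simp add: dist_norm norm_minus_commute)
    then have "\<bar>Im z\<bar> \<le> 1" using abs_Im_le_cmod[of "z - of_real t"] by simp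
    then show "z \<in> strip" using pi_gt3 by (simp add: strip_def)
  qed
  obtain C where C: "\<And>z. z \<in> cball (of_real t) 1 \<Longrightarrow>
    cmod (f z - (\<Sum>k\<le>K. (deriv ^^ k) f (of_real t) / fact k * (z - of_real t) ^ k)) \<le> C * cmod (z - of_real t) ^ Suc K"
    using holomorphic_taylor_bound[OF f strip_open sub] by blast
  have "cmod (f (of_real t + \<i> * of_real v) - (\<Sum>k\<le>K. of_real (d k / fact k) * (\<i> * of_real v) ^ k)) \<le> C * \<bar>v\<bar> ^ Suc K" if "\<bar>v\<bar> \<le> 1" for v
    using C[of "of_real t + \<i> * of_real v"] that by (simp add: d dist_norm norm_mult)
  then show ?thesis by (intro exI[of _ C] exI[of _ 1]) auto
qed

text \<open>Euler-Maclaurin with step w = z/n, divided by w. The main term is n LM_c(z), because z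
  LM_c(z) = \<Lambda>(z) - \<Lambda>(0) for a primitive \<Lambda> of \<open>L_c\<close>. The
  constant is uniform in v since all nodes lie in one compact box inside the strip.\<close>

lemma L_c_sum_expansion:
  assumes t: "t > 0"
  shows "\<exists>C. \<forall>n v. 1 \<le> n \<longrightarrow> \<bar>v\<bar> \<le> 1 \<longrightarrow>
    cmod ((\<Sum>k=1..n. L_c (of_nat k * (Complex t v / of_nat n))) - of_nat n * LM_c (Complex t v)
      - (\<Sum>j\<le>J. of_real (em_coeff (Suc j)) * (Complex t v / of_nat n) ^ j * ((deriv ^^ j) L_c (Complex t v) - of_real ((deriv ^^ j) L_D 0))))
    \<le> C * (1 / real n) ^ Suc J"
proof -
  define S where "S = cbox (Complex 0 (-1)) (Complex t 1)"
  have S_iff: "z \<in> S \<longleftrightarrow> 0 \<le> Re z \<and> Re z \<le> t \<and> \<bar>Im z\<bar> \<le> 1" for z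
    by (auto simp: S_def in_cbox_complex_iff)
  have S_strip: "S \<subseteq> strip" using pi_gt3 by (auto simp: S_iff strip_def)
  have S: "convex S" "compact S" by (simp_all add: S_def)
  obtain \<Lambda> where \<Lambda>': "\<And>z. z \<in> strip \<Longrightarrow> (\<Lambda> has_field_derivative L_c z) (at z within strip)"
    using holomorphic_convex_primitive'[OF strip_convex strip_open L_c_holomorphic] by blast
  have \<Lambda>: "(\<Lambda> has_field_derivative L_c z) (at z)" if "z \<in> strip" for z
    using \<Lambda>'[OF that] at_within_open[OF that strip_open] by simp
  have LM: "z * LM_c z = \<Lambda> z - \<Lambda> 0" if z: "z \<in> strip" for z
  proof -
    have "((\<lambda>y. z * L_c (of_real y * z)) has_integral (\<Lambda> (of_real 1 * z) - \<Lambda> (of_real 0 * z))) {0..1}"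
    proof (rule fundamental_theorem_of_calculus)
      fix y :: real assume y: "y \<in> {0..1}"
      then have "of_real y * z \<in> strip" using z by (simp add: mult_in_strip)
      from \<Lambda>[OF this] have "((\<lambda>w. \<Lambda> (w * z)) has_field_derivative L_c (of_real y * z) * z) (at (of_real y))"
        by (rule DERIV_chain2) (auto intro!: derivative_eq_intros)
      from has_vector_derivative_real_field[OF this]
      show "((\<lambda>y. \<Lambda> (of_real y * z)) has_vector_derivative z * L_c (of_real y * z)) (at y within {0..1})"
        by (simp add: mult.commute)
    qed simp
    from integral_unique[OF this] show ?thesis by (simp add: LM_c_def)
  qed
  \<comment> \<open>The sequence starts with the primitive, so corrections up to \<open>J\<close>
    need order \<open>Suc J\<close> of Euler-Maclaurin.\<close>
  define G where "G = (\<lambda>i. if i = 0 then \<Lambda> else (deriv ^^ (i - 1)) L_c)"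
  have dG: "(G i has_field_derivative G (Suc i) z) (at z within S)" if "z \<in> S" for i z
  proof -
    have z: "z \<in> strip" using that S_strip by blast
    have "(G i has_field_derivative G (Suc i) z) (at z)"
    proof (cases i)
      case 0
      then show ?thesis using \<Lambda>[OF z] by (simp add: G_def)
    next
      case (Suc m)
      then show ?thesis
        using holomorphic_derivI[OF holomorphic_higher_deriv[OF L_c_holomorphic strip_open] strip_open z] by (simp add: G_def)
    qed
    then show ?thesis by (rule has_field_derivative_at_within)
  qed
  have "compact ((deriv ^^ Suc (Suc J)) L_c ` S)"
    by (rule compact_continuous_image[OF holomorphic_on_imp_continuous_on[OF holomorphic_on_subset[OF holomorphic_higher_deriv[OF L_c_holomorphic strip_open] S_strip]] S(2)])
  from compact_imp_bounded[OF this] obtain B where Bi: "\<forall>y\<in>(deriv ^^ Suc (Suc J)) L_c ` S. cmod y \<le> B"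
    unfolding bounded_iff ..
  have B: "cmod ((deriv ^^ Suc (Suc J)) L_c z) \<le> B" if "z \<in> S" for z by (rule bspec[OF Bi imageI[OF that]])
  have BG: "\<forall>z\<in>S. cmod (G (Suc J + 2) z) \<le> B"
    using B by (simp add: G_def)
  obtain C where C: "C \<ge> 0" and EM: "\<forall>(S :: complex set) G w n B. convex S \<longrightarrow> (\<forall>k\<le>n. of_nat k * w \<in> S) \<longrightarrow>
     (\<forall>i. \<forall>x\<in>S. (G i has_field_derivative G (Suc i) x) (at x within S)) \<longrightarrow>
     (\<forall>x\<in>S. cmod (G (Suc J + 2) x) \<le> B) \<longrightarrow>
     cmod (w * (\<Sum>k=1..n. G 1 (of_nat k * w)) - (\<Sum>j\<le>Suc J. of_real (em_coeff j) * w ^ j * (G j (of_nat n * w) - G j 0)))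
       \<le> C * B * real n * cmod w ^ (Suc J + 2)"
    using euler_maclaurin[of "Suc J"] by blast
  have B0: "B \<ge> 0"
  proof -
    have "(0 :: complex) \<in> S" using t by (simp add: S_iff)
    then show ?thesis using B order_trans[OF norm_ge_zero] by blast
  qed
  show ?thesis
  proof (rule exI[of _ "C * B * (t + 1) ^ (J + 2)"], intro allI impI)
    fix n :: nat and v :: real assume n: "1 \<le> n" and v: "\<bar>v\<bar> \<le> 1"
    define z where "z = Complex t v"
    define w where "w = z / of_nat n"
    have z_strip: "z \<in> strip" using v pi_gt3 by (simp add: z_def strip_def)
    have z0: "z \<noteq> 0" using t by (auto simp: z_def complex_eq_iff)
    have w0: "w \<noteq> 0" using z0 n by (simp add: w_def)
    have nw: "of_nat n * w = z" using n by (simp add: w_def)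
    have zn: "cmod z \<le> t + 1" using cmod_le[of z] t v by (simp add: z_def)
    have wS: "\<forall>k\<le>n. of_nat k * w \<in> S"
    proof (intro allI impI)
      fix k assume k: "k \<le> n"
      have q: "0 \<le> real k / real n" "real k / real n \<le> 1" using k n by auto
      have "of_nat k * w = of_real (real k / real n) * z" by (simp add: w_def)
      then have "Re (of_nat k * w) = real k / real n * t" "Im (of_nat k * w) = real k / real n * v" by (simp_all add: z_def)
      moreover have "real k / real n * t \<le> 1 * t" using q t by (intro mult_right_mono) auto
      moreover have "real k / real n * \<bar>v\<bar> \<le> 1 * 1" using q v by (intro mult_mono) auto
      ultimately show "of_nat k * w \<in> S" using q t by (simp add: S_iff abs_mult)
    qed
    have "cmod (w * (\<Sum>k=1..n. G 1 (of_nat k * w)) - (\<Sum>j\<le>Suc J. of_real (em_coeff j) * w ^ j * (G j (of_nat n * w) - G j 0)))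
       \<le> C * B * real n * cmod w ^ (Suc J + 2)"
      using EM S(1) wS dG BG by blast
    also have "w * (\<Sum>k=1..n. G 1 (of_nat k * w)) - (\<Sum>j\<le>Suc J. of_real (em_coeff j) * w ^ j * (G j (of_nat n * w) - G j 0))
      = w * ((\<Sum>k=1..n. L_c (of_nat k * w)) - of_nat n * LM_c z
      - (\<Sum>j\<le>J. of_real (em_coeff (Suc j)) * w ^ j * ((deriv ^^ j) L_c z - of_real ((deriv ^^ j) L_D 0))))"
    proof -
      have "(\<Sum>j\<le>Suc J. of_real (em_coeff j) * w ^ j * (G j (of_nat n * w) - G j 0))
         = (\<Lambda> z - \<Lambda> 0) + (\<Sum>j\<le>J. of_real (em_coeff (Suc j)) * w ^ Suc j * ((deriv ^^ j) L_c z - (deriv ^^ j) L_c 0))"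
        by (subst sum.atMost_Suc_shift) (simp add: G_def nw)
      also have "\<Lambda> z - \<Lambda> 0 = w * (of_nat n * LM_c z)" using LM[OF z_strip] nw by (metis mult.assoc mult.commute)
      also have "(\<Sum>j\<le>J. of_real (em_coeff (Suc j)) * w ^ Suc j * ((deriv ^^ j) L_c z - (deriv ^^ j) L_c 0))
         = w * (\<Sum>j\<le>J. of_real (em_coeff (Suc j)) * w ^ j * ((deriv ^^ j) L_c z - of_real ((deriv ^^ j) L_D 0)))"
        using L_c_higher_deriv[of _ 0] by (simp add: sum_distrib_left mult_ac del: em_coeff.simps)
      finally show ?thesis by (simp add: G_def right_diff_distrib del: em_coeff.simps)
    qed
    finally have "cmod w * cmod ((\<Sum>k=1..n. L_c (of_nat k * w)) - of_nat n * LM_c z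
      - (\<Sum>j\<le>J. of_real (em_coeff (Suc j)) * w ^ j * ((deriv ^^ j) L_c z - of_real ((deriv ^^ j) L_D 0))))
      \<le> cmod w * (C * B * real n * cmod w ^ (J + 2))" by (simp add: norm_mult mult_ac del: em_coeff.simps)
    then have "cmod ((\<Sum>k=1..n. L_c (of_nat k * w)) - of_nat n * LM_c z
      - (\<Sum>j\<le>J. of_real (em_coeff (Suc j)) * w ^ j * ((deriv ^^ j) L_c z - of_real ((deriv ^^ j) L_D 0))))
      \<le> C * B * real n * cmod w ^ (J + 2)" by (rule mult_left_le_imp_le) (simp add: w0)
    also have "\<dots> = C * B * cmod z ^ (J + 2) * (1 / real n) ^ Suc J"
      using n by (simp add: w_def norm_divide power_divide field_simps)
    also have "\<dots> \<le> C * B * (t + 1) ^ (J + 2) * (1 / real n) ^ Suc J"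
      using C B0 zn by (intro mult_right_mono mult_left_mono power_mono) auto
    finally show "cmod ((\<Sum>k=1..n. L_c (of_nat k * (Complex t v / of_nat n))) - of_nat n * LM_c (Complex t v)
      - (\<Sum>j\<le>J. of_real (em_coeff (Suc j)) * (Complex t v / of_nat n) ^ j * ((deriv ^^ j) L_c (Complex t v) - of_real ((deriv ^^ j) L_D 0))))
      \<le> C * B * (t + 1) ^ (J + 2) * (1 / real n) ^ Suc J"
      by (simp only: w_def z_def)
  qed
qed

text \<open>The coefficient of n^(-j) in \<open>log_remainder\<close>: the Euler-Maclaurin
  correction, the Taylor terms of -n L_c(z/n) and of -L_c(z/n), and for j = 1 the linear terms z/n -
  \<theta> z/n.\<close>

definition em_term :: "nat \<Rightarrow> complex \<Rightarrow> real \<Rightarrow> complex" where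
  "em_term j z \<theta> = of_real (em_coeff (Suc j)) * z ^ j * ((deriv ^^ j) L_c z - of_real ((deriv ^^ j) L_D 0))
     - of_real ((deriv ^^ Suc j) L_D 0 / fact (Suc j)) * z ^ Suc j - of_real ((deriv ^^ j) L_D 0 / fact j) * z ^ j
     + of_real (of_bool (j = 1) * (1 - \<theta>)) * z"

text \<open>\<open>em_coeff 1 = 1/2\<close> yields L_c(z)/2, and L_D'(0) = 1/2 yields -z/2: the
  origin of H.\<close>

lemma em_term_0: "em_term 0 z \<theta> = H_c z"
proof -
  have d: "deriv L_D 0 = 1 / 2" using L_D_deriv_0_1 by simp
  show ?thesis by (simp add: d em_term_def H_c_def L_D_def diff_divide_distrib)
qed

text \<open>The exponent, with w = z/n, after removal of n LM_c(z) and of the linear term n x z. In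
  (n + 1) L_c(w) the n comes from the denominators of the n factors; the 1 and the term +w come from
  1 - exp(-w) = w exp(L_c(w) - w), and -\<theta> w from rounding n^2 x up.\<close>

definition log_remainder :: "nat \<Rightarrow> complex \<Rightarrow> real \<Rightarrow> complex" where
  "log_remainder n z \<theta> = (\<Sum>k=1..n. L_c (of_nat k * (z / of_nat n))) - of_nat n * LM_c z
     - (of_nat n + 1) * L_c (z / of_nat n) + z / of_nat n - of_real \<theta> * (z / of_nat n)"

lemma log_remainder_expansion:
  assumes t: "t > 0"
  shows "\<exists>C. \<forall>n v \<theta>. t + 1 \<le> real n \<longrightarrow> \<bar>v\<bar> \<le> 1 \<longrightarrow>
    cmod (log_remainder n (Complex t v) \<theta> - (\<Sum>j\<le>Suc J. (1 / of_nat n) ^ j * em_term j (Complex t v) \<theta>)) \<le> C * (1 / real n) ^ Suc (Suc J)"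
proof -
  obtain C where C: "\<And>n v. 1 \<le> n \<Longrightarrow> \<bar>v\<bar> \<le> 1 \<Longrightarrow>
    cmod ((\<Sum>k=1..n. L_c (of_nat k * (Complex t v / of_nat n))) - of_nat n * LM_c (Complex t v)
      - (\<Sum>j\<le>Suc J. of_real (em_coeff (Suc j)) * (Complex t v / of_nat n) ^ j * ((deriv ^^ j) L_c (Complex t v) - of_real ((deriv ^^ j) L_D 0))))
    \<le> C * (1 / real n) ^ Suc (Suc J)"
    using L_c_sum_expansion[OF t, of "Suc J"] by blast
  have sub: "cball 0 1 \<subseteq> strip"
  proof
    fix z assume "z \<in> cball (0 :: complex) 1"
    then have "\<bar>Im z\<bar> \<le> 1" using abs_Im_le_cmod[of z] by simp
    then show "z \<in> strip" using pi_gt3 by (simp add: strip_def)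
  qed
  define l where "l = (\<lambda>j. complex_of_real ((deriv ^^ j) L_D 0 / fact j))"
  have dl: "(deriv ^^ k) L_c 0 / fact k = l k" for k using L_c_higher_deriv[of k 0] by (simp add: l_def)
  \<comment> \<open>One Taylor order beyond \<open>Suc J\<close>, because \<open>L_c\<close> at z/n
    is multiplied by n.\<close>
  obtain D where D: "\<And>w. w \<in> cball 0 1 \<Longrightarrow> cmod (L_c w - (\<Sum>k\<le>Suc (Suc J). l k * w ^ k)) \<le> D * cmod w ^ Suc (Suc (Suc J))"
    using holomorphic_taylor_bound[OF L_c_holomorphic strip_open sub, of "Suc (Suc J)"] unfolding dl diff_zero by blast
  have D0: "D \<ge> 0" using D[of 1] order_trans[OF norm_ge_zero] by simp
  \<comment> \<open>Three sources of error: Euler-Maclaurin, the Taylor remainder times n + 1 \<le>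
    2n, and the top Taylor term of the single copy of L_c(w), which the expansion keeps only in n
    L_c(w).\<close>
  define E where "E = C + 2 * D * (t + 1) ^ (J + 3) + cmod (l (Suc (Suc J))) * (t + 1) ^ (J + 2)"
  show ?thesis
  proof (rule exI[of _ E], intro allI impI)
    fix n :: nat and v \<theta> :: real assume nt: "t + 1 \<le> real n" and v: "\<bar>v\<bar> \<le> 1"
    have n: "1 \<le> n" using nt t by simp
    define z where "z = Complex t v"
    define w where "w = z / of_nat n"
    define h where "h = 1 / real n"
    have w: "w = of_real h * z" by (simp add: w_def h_def)
    have h: "0 < h" "h \<le> 1" "of_nat n * complex_of_real h = 1" using n by (auto simp: h_def)
    have zn: "cmod z \<le> t + 1" using cmod_le[of z] t v by (simp add: z_def)
    have wn: "cmod w = h * cmod z" using h by (simp add: w norm_mult)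
    \<comment> \<open>Here \<open>t + 1 \<le> real n\<close> enters: z/n stays in the unit disc,
      where the Taylor bound holds.\<close>
    have "cmod w \<le> 1" using zn nt n by (simp add: w_def norm_divide divide_le_eq)
    then have "w \<in> cball 0 1" by simp
    note Dw = D[OF this]
    define L1 where "L1 = (\<Sum>k\<le>Suc (Suc J). l k * w ^ k)"
    define Q where "Q = (\<Sum>j\<le>Suc J. of_real (em_coeff (Suc j)) * w ^ j * ((deriv ^^ j) L_c z - of_real ((deriv ^^ j) L_D 0)))"
    have l0: "l 0 = 0" by (simp add: l_def L_D_def)
    have sum_eq: "(\<Sum>j\<le>Suc J. (1 / of_nat n) ^ j * em_term j z \<theta>) = Q - of_nat n * L1 - (L1 - l (Suc (Suc J)) * w ^ Suc (Suc J)) + w - of_real \<theta> * w"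
    proof -
      have e: "(1 / of_nat n) ^ j * em_term j z \<theta> = of_real (em_coeff (Suc j)) * w ^ j * ((deriv ^^ j) L_c z - of_real ((deriv ^^ j) L_D 0))
         - of_nat n * (l (Suc j) * w ^ Suc j) - l j * w ^ j + (if j = 1 then (1 - of_real \<theta>) * w else 0)" for j
      proof -
        have hj: "(1 / of_nat n) ^ j = complex_of_real h ^ j" by (simp add: h_def)
        have "of_nat n * (l (Suc j) * w ^ Suc j) = (of_nat n * of_real h) * (of_real h ^ j * (l (Suc j) * z ^ Suc j))"
          unfolding w power_mult_distrib by (simp add: mult_ac)
        then have a: "of_nat n * (l (Suc j) * w ^ Suc j) = of_real h ^ j * (l (Suc j) * z ^ Suc j)" using h by simp
        have b: "(if j = 1 then (1 - of_real \<theta>) * w else 0) = of_real h ^ j * (of_real (of_bool (j = 1) * (1 - \<theta>)) * z)"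
          by (simp add: w)
        show ?thesis unfolding a b hj em_term_def l_def w power_mult_distrib by (simp add: algebra_simps h(3) del: em_coeff.simps)
      qed
      have "(\<Sum>j\<le>Suc J. of_nat n * (l (Suc j) * w ^ Suc j)) = of_nat n * L1"
        unfolding L1_def by (subst sum.atMost_Suc_shift[of _ "Suc J"]) (simp add: l0 sum_distrib_left distrib_left)
      moreover have "(\<Sum>j\<le>Suc J. l j * w ^ j) = L1 - l (Suc (Suc J)) * w ^ Suc (Suc J)" by (simp add: L1_def)
      moreover have "(\<Sum>j\<le>Suc J. if j = 1 then (1 - of_real \<theta>) * w else 0) = w - of_real \<theta> * w"
        by (simp add: sum.delta left_diff_distrib del: sum.atMost_Suc)
      ultimately show ?thesis unfolding e Q_def by (simp only: sum.distrib sum_subtractf) (simp only: add_diff_eq)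
    qed
    have "log_remainder n z \<theta> - (\<Sum>j\<le>Suc J. (1 / of_nat n) ^ j * em_term j z \<theta>) =
      ((\<Sum>k=1..n. L_c (of_nat k * w)) - of_nat n * LM_c z - Q) - (of_nat n + 1) * (L_c w - L1) - l (Suc (Suc J)) * w ^ Suc (Suc J)"
      unfolding sum_eq log_remainder_def w_def[symmetric] by (simp add: algebra_simps)
    also have "cmod \<dots> \<le> C * h ^ Suc (Suc J) + 2 * D * (t + 1) ^ (J + 3) * h ^ Suc (Suc J) + cmod (l (Suc (Suc J))) * (t + 1) ^ (J + 2) * h ^ Suc (Suc J)"
    proof (rule order_trans[OF norm_triangle_ineq4 add_mono[OF order_trans[OF norm_triangle_ineq4 add_mono]]])
      show "cmod ((\<Sum>k=1..n. L_c (of_nat k * w)) - of_nat n * LM_c z - Q) \<le> C * h ^ Suc (Suc J)"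
        using C[OF n v] unfolding Q_def w_def z_def h_def by simp
      have "cmod ((of_nat n + 1) * (L_c w - L1)) = (real n + 1) * cmod (L_c w - L1)"
        by (simp add: norm_mult) (metis norm_of_nat of_nat_Suc add.commute)
      also have "\<dots> \<le> (2 * real n) * (D * (h * (t + 1)) ^ Suc (Suc (Suc J)))"
      proof (intro mult_mono)
        have "cmod w ^ Suc (Suc (Suc J)) \<le> (h * (t + 1)) ^ Suc (Suc (Suc J))"
          using wn zn h by (intro power_mono) auto
        then have "D * cmod w ^ Suc (Suc (Suc J)) \<le> D * (h * (t + 1)) ^ Suc (Suc (Suc J))" using D0 by (rule mult_left_mono)
        then show "cmod (L_c w - L1) \<le> D * (h * (t + 1)) ^ Suc (Suc (Suc J))" using Dw unfolding L1_def by linarith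
      qed (use n in auto)
      also have "\<dots> = 2 * D * (t + 1) ^ (J + 3) * h ^ Suc (Suc J)"
        using n unfolding power_mult_distrib by (simp add: h_def numeral_3_eq_3 field_simps)
      finally show "cmod ((of_nat n + 1) * (L_c w - L1)) \<le> 2 * D * (t + 1) ^ (J + 3) * h ^ Suc (Suc J)" .
      have "cmod (l (Suc (Suc J)) * w ^ Suc (Suc J)) = cmod (l (Suc (Suc J))) * cmod z ^ (J + 2) * h ^ Suc (Suc J)"
        by (simp add: norm_mult norm_power wn power_mult_distrib del: power_Suc) 
      also have "\<dots> \<le> cmod (l (Suc (Suc J))) * (t + 1) ^ (J + 2) * h ^ Suc (Suc J)"
        using zn h by (intro mult_right_mono mult_left_mono power_mono) auto
      finally show "cmod (l (Suc (Suc J)) * w ^ Suc (Suc J)) \<le> cmod (l (Suc (Suc J))) * (t + 1) ^ (J + 2) * h ^ Suc (Suc J)" .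
    qed
    also have "\<dots> = E * h ^ Suc (Suc J)" by (simp only: E_def distrib_right)
    finally show "cmod (log_remainder n (Complex t v) \<theta> - (\<Sum>j\<le>Suc J. (1 / of_nat n) ^ j * em_term j (Complex t v) \<theta>)) \<le> E * (1 / real n) ^ Suc (Suc J)"
      unfolding z_def h_def .
  qed
qed

text \<open>The formal series below live in \<open>\<epsilon> = n\<^sup>-\<^sup>1\<^sup>/\<^sup>2\<close>, with coefficients polynomials in \<open>s = \<i>u\<close>, where the
  integration variable is \<open>z = t + \<i>u\<epsilon>\<close>.\<close>

definition local_coeff :: "(nat \<Rightarrow> real \<Rightarrow> real) \<Rightarrow> nat set \<Rightarrow> nat \<Rightarrow> real \<Rightarrow> complex" where
  "local_coeff d I k t = (if k \<in> I then 0 else of_real (d k t / fact k))"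

text \<open>With s factors n = \<epsilon>^(-2) in front, the Taylor term of order k + 2s lands in
  order k.\<close>

definition local_series :: "nat \<Rightarrow> (nat \<Rightarrow> real \<Rightarrow> complex) \<Rightarrow> real \<Rightarrow> complex poly fps" where
  "local_series s c t = Abs_fps (\<lambda>k. monom (c (k + 2 * s) t) (k + 2 * s))"

definition const_series :: "complex \<Rightarrow> complex poly fps" where
  "const_series c = fps_const [:c:]"

definition z_series :: "real \<Rightarrow> complex poly fps" where
  "z_series = local_series 0 (\<lambda>k t. if k = 0 then of_real t else if k = 1 then 1 else 0)"

text \<open>Mirrors \<open>em_term\<close> with subtractions written as additions of negated
  constants, since the calculus of expansions offers sums, products and powers.\<close>

definition em_series :: "nat \<Rightarrow> real \<Rightarrow> real \<Rightarrow> complex poly fps" where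
  "em_series j t \<theta> = const_series (of_real (em_coeff (Suc j))) * z_series t ^ j *
       (local_series 0 (local_coeff (\<lambda>k. (deriv ^^ (k + j)) L_D) {}) t + const_series (of_real (- (deriv ^^ j) L_D 0)))
     + const_series (of_real (- (deriv ^^ Suc j) L_D 0 / fact (Suc j))) * z_series t ^ Suc j
     + const_series (of_real (- (deriv ^^ j) L_D 0 / fact j)) * z_series t ^ j
     + const_series (of_real (of_bool (j = 1) * (1 - \<theta>))) * z_series t"

text \<open>n times the saddle phase plus the remaining logarithm. The Taylor orders excluded by {0,
  1, 2} and {0} are those that the prefactor, the saddle equation and the Gaussian weight take care
  of, so no constant term is left.\<close>

definition exponent_series :: "real \<Rightarrow> real \<Rightarrow> complex poly fps" where
  "exponent_series t \<theta> = local_series 1 (local_coeff (\<lambda>k. (deriv ^^ k) L_M) {0, 1, 2}) t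
     + fps_diagonal (\<lambda>j. if j = 0 then local_series 0 (local_coeff (\<lambda>k. (deriv ^^ k) H) {0}) t
         else (fps_X ^ 2) ^ j * em_series j t \<theta>)"

text \<open>The geometric series of t/z in \<epsilon>, times the formal exponential.\<close>

definition integrand_series :: "real \<Rightarrow> real \<Rightarrow> complex poly fps" where
  "integrand_series t \<theta> = local_series 0 (\<lambda>k t. of_real ((- 1 / t) ^ k)) t
     * fps_diagonal (\<lambda>j. fps_const [:1 / fact j:] * exponent_series t \<theta> ^ j)"

definition z_path :: "real \<Rightarrow> nat \<Rightarrow> real \<Rightarrow> complex" where
  "z_path t n u = of_real t + \<i> * of_real (u / sqrt (real n))"

text \<open>\<open>LM_c\<close> without its Taylor polynomial of degree 2; the plus sign is due to
  (\<i>v)^2 = -v^2.\<close>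

definition saddle_phase :: "real \<Rightarrow> real \<Rightarrow> complex" where
  "saddle_phase t v = LM_c (of_real t + \<i> * of_real v) - of_real (L_M t) - of_real ((deriv ^^ 1) L_M t) * (\<i> * of_real v)
     + of_real ((deriv ^^ 2) L_M t / 2 * v\<^sup>2)"

text \<open>The integrand divided by prefactor and Gaussian weight. Having t/z in place of 1/z makes
  its leading coefficient 1.\<close>

definition reduced_integrand :: "real \<Rightarrow> (nat \<Rightarrow> real) \<Rightarrow> nat \<Rightarrow> real \<Rightarrow> complex" where
  "reduced_integrand t \<theta> n u = of_real t / z_path t n u *
     exp (of_nat n * saddle_phase t (u / sqrt (real n)) + (log_remainder n (z_path t n u) (\<theta> n) - of_real (H t)))"

lemma z_path_Complex: "z_path t n u = Complex t (u / sqrt (real n))"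
  by (simp add: z_path_def complex_eq_iff)

lemma explicit_local_coeff:
  assumes "\<And>k. k \<notin> I \<Longrightarrow> explicit_formula (\<lambda>t \<theta>. d k t)"
  shows "explicit_coeff (\<lambda>t \<theta>. local_coeff d I k t)"
proof (cases "k \<in> I")
  case False
  have "fact k \<in> (\<rat> :: real set)" by (metis Rats_of_nat of_nat_fact)
  then have "explicit_formula (\<lambda>t \<theta>. 1 / fact k)" by (intro rat_const) auto
  from explicit_coeffI[OF explicit_formula.mult[OF this assms[OF False]]] False
  show ?thesis by (simp add: local_coeff_def)
qed (simp add: local_coeff_def)

lemma exponent_series_0: "exponent_series t' \<theta>' $ 0 = 0"
  by (simp add: exponent_series_def local_series_def local_coeff_def fps_diagonal_def)

context
  fixes t :: real and \<theta> :: "nat \<Rightarrow> real"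
  assumes \<theta>: "\<And>n. 0 \<le> \<theta> n" "\<And>n. \<theta> n \<le> 1" and t: "t > 0"
begin

lemmas exp_intros = expands_mult[OF \<theta>] expands_add[OF \<theta>] expands_power[OF \<theta>]

lemma expands_const_series:
  assumes "explicit_coeff c"
  shows "expands t \<theta> (\<lambda>n u. c t (\<theta> n)) (\<lambda>t \<theta>. const_series (c t \<theta>))"
  unfolding const_series_def by (rule expands_const[OF \<theta> assms])

lemma expands_rat_series:
  assumes "c \<in> \<rat>"
  shows "expands t \<theta> (\<lambda>n u. of_real c) (\<lambda>t \<theta>. const_series (of_real c))"
  using expands_const_series[OF explicit_coeff_of_rat[OF assms]] .

lemma expands_local_series:
  assumes c: "\<And>k. explicit_coeff (\<lambda>t \<theta>. c k t)"
    and g: "\<And>K. \<exists>C r. r > 0 \<and> (\<forall>v. \<bar>v\<bar> \<le> r \<longrightarrow> cmod (g v - (\<Sum>k\<le>K. c k t * (\<i> * of_real v) ^ k)) \<le> C * \<bar>v\<bar> ^ Suc K)"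
  shows "expands t \<theta> (\<lambda>n u. g (u / sqrt (real n))) (\<lambda>t \<theta>. local_series 0 c t)"
  using expands_local[OF \<theta>, where s = 0 and c = c and t = t and g = g] c g by (simp add: local_series_def)

lemma expands_holomorphic:
  assumes f: "f holomorphic_on strip" and d: "\<And>k. (deriv ^^ k) f (of_real t) = of_real (d k t)"
    and e: "\<And>k. explicit_formula (\<lambda>t \<theta>. d k t)"
  shows "expands t \<theta> (\<lambda>n u. f (z_path t n u)) (\<lambda>t \<theta>. local_series 0 (local_coeff d {}) t)"
  unfolding z_path_def
  by (rule expands_local_series)
    (use explicit_local_coeff[of "{}" d] e strip_taylor_real[OF f d] in \<open>simp_all add: local_coeff_def\<close>)

lemma expands_z: "expands t \<theta> (z_path t) (\<lambda>t \<theta>. z_series t)"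
proof -
  let ?c = "\<lambda>(k::nat) t. if k = 0 then complex_of_real t else if k = 1 then 1 else 0"
  have "expands t \<theta> (\<lambda>n u. (\<lambda>v. of_real t + \<i> * of_real v) (u / sqrt (real n))) (\<lambda>t \<theta>. local_series 0 ?c t)"
  proof (rule expands_local_series)
    show "explicit_coeff (\<lambda>t \<theta>. ?c k t)" for k
      using explicit_coeffI[OF explicit_formula.point] by (cases "k = 0"; cases "k = 1") simp_all
    fix K
    show "\<exists>C r. r > 0 \<and> (\<forall>v. \<bar>v\<bar> \<le> r \<longrightarrow> cmod (of_real t + \<i> * of_real v - (\<Sum>k\<le>K. ?c k t * (\<i> * of_real v) ^ k)) \<le> C * \<bar>v\<bar> ^ Suc K)"
    proof (cases K)
      case 0
      then show ?thesis by (intro exI[of _ 1]) (simp add: norm_mult)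
    next
      case (Suc J)
      have "(\<Sum>k\<le>Suc J. ?c k t * (\<i> * of_real v) ^ k) = of_real t + \<i> * of_real v" for v
        unfolding sum.atMost_Suc_shift by (simp add: sum.atMost_shift)
      then show ?thesis unfolding Suc by (intro exI[of _ 0] exI[of _ 1]) simp
    qed
  qed
  then show ?thesis by (simp add: z_series_def z_path_def[abs_def])
qed

text \<open>Geometric series in q = -\<i>v/t. Since Re(1 - q) = 1, the remainder q^(K+1)/(1 - q) is
  controlled for every real v, and any radius will do.\<close>

lemma expands_inverse_z: "expands t \<theta> (\<lambda>n u. of_real t / z_path t n u) (\<lambda>t \<theta>. local_series 0 (\<lambda>k t. of_real ((- 1 / t) ^ k)) t)"
  unfolding z_path_def
proof (rule expands_local_series)
  fix k
  have "explicit_coeff (\<lambda>t \<theta>. (of_real (-1) * of_real (1 / t)) ^ k)"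
    by (intro explicit_coeff_power explicit_coeff_cmult explicit_coeffI[OF inv_point]) auto
  then show "explicit_coeff (\<lambda>t \<theta>. of_real ((- 1 / t) ^ k))" by simp
next
  fix K
  show "\<exists>C r. r > 0 \<and> (\<forall>v. \<bar>v\<bar> \<le> r \<longrightarrow> cmod (of_real t / (of_real t + \<i> * of_real v) - (\<Sum>k\<le>K. of_real ((- 1 / t) ^ k) * (\<i> * of_real v) ^ k)) \<le> C * \<bar>v\<bar> ^ Suc K)"
  proof (intro exI[of _ "1 / t ^ Suc K"] exI[of _ 1] conjI allI impI)
    fix v :: real
    define q where "q = - (\<i> * of_real v) / complex_of_real t"
    have d: "1 - q = (of_real t + \<i> * of_real v) / of_real t" using t by (simp add: q_def field_simps)
    have re: "Re (of_real t + \<i> * of_real v) = t" by simp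
    have nz: "of_real t + \<i> * of_real v \<noteq> (0 :: complex)" using re t by (metis less_irrefl zero_complex.sel(1))
    have q1: "q \<noteq> 1" using d nz t by auto
    have n1: "cmod (1 - q) \<ge> 1"
    proof -
      have "t \<le> cmod (of_real t + \<i> * of_real v)" using complex_Re_le_cmod[of "of_real t + \<i> * of_real v"] re by simp
      then show ?thesis using t by (simp add: d norm_divide)
    qed
    have "(\<Sum>k\<le>K. of_real ((- 1 / t) ^ k) * (\<i> * of_real v) ^ k) = (\<Sum>k<Suc K. q ^ k)"
      unfolding lessThan_Suc_atMost by (intro sum.cong refl) (simp add: q_def power_mult_distrib[symmetric] power_divide[symmetric])
    also have "\<dots> = (1 - q ^ Suc K) / (1 - q)" using q1 by (simp only: sum_gp_strict if_False)
    also have "of_real t / (of_real t + \<i> * of_real v) - \<dots> = q ^ Suc K / (1 - q)"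
    proof -
      have "of_real t / (of_real t + \<i> * of_real v) = 1 / (1 - q)" using t by (simp add: d)
      then show ?thesis by (simp add: diff_divide_distrib)
    qed
    finally have "cmod (of_real t / (of_real t + \<i> * of_real v) - (\<Sum>k\<le>K. of_real ((- 1 / t) ^ k) * (\<i> * of_real v) ^ k)) = cmod q ^ Suc K / cmod (1 - q)"
      by (simp only: norm_divide norm_power)
    also have "\<dots> \<le> cmod q ^ Suc K / 1" using n1 by (intro divide_left_mono) auto
    also have "\<dots> = 1 / t ^ Suc K * \<bar>v\<bar> ^ Suc K" using t by (simp add: q_def norm_divide norm_mult power_divide)
    finally show "cmod (of_real t / (of_real t + \<i> * of_real v) - (\<Sum>k\<le>K. of_real ((- 1 / t) ^ k) * (\<i> * of_real v) ^ k)) \<le> 1 / t ^ Suc K * \<bar>v\<bar> ^ Suc K" .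
  qed (use t in simp)
qed

text \<open>For j = 0 the undifferentiated \<open>L_D\<close> would occur, which
  \<open>explicit_formula\<close> does not provide; that term is H and is treated in
  \<open>expands_H\<close> with its value at t subtracted.\<close>

lemma expands_em_term:
  assumes j: "j \<ge> 1"
  shows "expands t \<theta> (\<lambda>n u. em_term j (z_path t n u) (\<theta> n)) (em_series j)"
proof -
  have R: "(deriv ^^ k) L_D 0 / fact k \<in> \<rat>" for k
    using L_D_deriv_0_Rats[of k] by (metis Rats_divide Rats_of_nat of_nat_fact)
  have 1: "expands t \<theta> (\<lambda>n u. of_real (em_coeff (Suc j))) (\<lambda>t \<theta>. const_series (of_real (em_coeff (Suc j))))"
    by (intro expands_rat_series em_coeff_Rats)
  have 2: "expands t \<theta> (\<lambda>n u. (deriv ^^ j) L_c (z_path t n u)) (\<lambda>t \<theta>. local_series 0 (local_coeff (\<lambda>k. (deriv ^^ (k + j)) L_D) {}) t)"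
  proof (rule expands_holomorphic)
    show "(deriv ^^ j) L_c holomorphic_on strip" by (intro holomorphic_higher_deriv L_c_holomorphic strip_open)
    show "(deriv ^^ k) ((deriv ^^ j) L_c) (of_real t) = of_real ((deriv ^^ (k + j)) L_D t)" for k
      using L_c_higher_deriv[of "k + j" t] by (simp add: funpow_add)
    show "explicit_formula (\<lambda>t \<theta>. (deriv ^^ (k + j)) L_D t)" for k using j by (intro deriv_L_D) simp
  qed
  have 3: "expands t \<theta> (\<lambda>n u. of_real (- (deriv ^^ j) L_D 0)) (\<lambda>t \<theta>. const_series (of_real (- (deriv ^^ j) L_D 0)))"
    by (intro expands_rat_series Rats_minus_iff[THEN iffD2] L_D_deriv_0_Rats)
  have 4: "expands t \<theta> (\<lambda>n u. of_real (- (deriv ^^ k) L_D 0 / fact k)) (\<lambda>t \<theta>. const_series (of_real (- (deriv ^^ k) L_D 0 / fact k)))" for k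
    using R[of k] by (intro expands_rat_series) simp
  have "explicit_formula (\<lambda>t \<theta>. of_bool (j = 1) * (1 + (-1) * \<theta>))"
    by (intro explicit_formula.mult explicit_formula.add rat_const frac_var) auto
  from expands_const_series[OF explicit_coeffI[OF this]]
  have 5: "expands t \<theta> (\<lambda>n u. of_real (of_bool (j = 1) * (1 - \<theta> n))) (\<lambda>t \<theta>. const_series (of_real (of_bool (j = 1) * (1 - \<theta>))))"
    by simp
  have "expands t \<theta> (\<lambda>n u. of_real (em_coeff (Suc j)) * z_path t n u ^ j * ((deriv ^^ j) L_c (z_path t n u) + of_real (- (deriv ^^ j) L_D 0))
     + of_real (- (deriv ^^ Suc j) L_D 0 / fact (Suc j)) * z_path t n u ^ Suc j + of_real (- (deriv ^^ j) L_D 0 / fact j) * z_path t n u ^ j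
     + of_real (of_bool (j = 1) * (1 - \<theta> n)) * z_path t n u) (\<lambda>t \<theta>. em_series j t \<theta>)"
    unfolding em_series_def by (intro exp_intros 1 2 3 4 5 expands_z)
  then show ?thesis by (simp add: em_term_def del: em_coeff.simps)
qed

lemma expands_H: "expands t \<theta> (\<lambda>n u. H_c (z_path t n u) - of_real (H t)) (\<lambda>t \<theta>. local_series 0 (local_coeff (\<lambda>k. (deriv ^^ k) H) {0}) t)"
  unfolding z_path_def
proof (rule expands_local_series)
  show "explicit_coeff (\<lambda>t \<theta>. local_coeff (\<lambda>k. (deriv ^^ k) H) {0} k t)" for k
    by (rule explicit_local_coeff) (auto intro: deriv_H)
  fix K
  have d: "(deriv ^^ k) H_c (of_real t) = of_real ((deriv ^^ k) H t)" for k
    by (rule higher_deriv_of_real(1)[OF H_c_holomorphic strip_open of_real_in_strip H_c_of_real])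
  have s: "(\<Sum>k\<le>K. local_coeff (\<lambda>k. (deriv ^^ k) H) {0} k t * x ^ k) = (\<Sum>k\<le>K. of_real ((deriv ^^ k) H t / fact k) * x ^ k) - of_real (H t)" for x
    by (subst (1 2) sum.atMost_shift) (simp add: local_coeff_def)
  show "\<exists>C r. r > 0 \<and> (\<forall>v. \<bar>v\<bar> \<le> r \<longrightarrow> cmod (H_c (of_real t + \<i> * of_real v) - of_real (H t) - (\<Sum>k\<le>K. local_coeff (\<lambda>k. (deriv ^^ k) H) {0} k t * (\<i> * of_real v) ^ k)) \<le> C * \<bar>v\<bar> ^ Suc K)"
    using strip_taylor_real[OF H_c_holomorphic d, of K] unfolding s by simp
qed

lemma expands_phase:
  "expands t \<theta> (\<lambda>n u. of_nat n * saddle_phase t (u / sqrt (real n))) (\<lambda>t \<theta>. local_series 1 (local_coeff (\<lambda>k. (deriv ^^ k) L_M) {0, 1, 2}) t)"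
proof -
  let ?c = "local_coeff (\<lambda>k. (deriv ^^ k) L_M) {0, 1, 2}"
  have T: "\<exists>C r. r > 0 \<and> (\<forall>v. \<bar>v\<bar> \<le> r \<longrightarrow> cmod (saddle_phase t v - (\<Sum>k\<le>K. ?c k t * (\<i> * of_real v) ^ k)) \<le> C * \<bar>v\<bar> ^ Suc K)" if K: "K \<ge> 2" for K
  proof -
    obtain J where J: "K = Suc (Suc J)" using K by (auto simp: numeral_2_eq_2 Suc_le_eq gr0_conv_Suc dest!: less_imp_Suc_add)
    have s: "(\<Sum>k\<le>K. of_real ((deriv ^^ k) L_M t / fact k) * (\<i> * of_real v) ^ k) = (\<Sum>k\<le>K. ?c k t * (\<i> * of_real v) ^ k)
        + (of_real (L_M t) + of_real ((deriv ^^ 1) L_M t) * (\<i> * of_real v) - of_real ((deriv ^^ 2) L_M t / 2 * v\<^sup>2))" for v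
    proof -
      have "(\<Sum>k\<le>K. of_real ((deriv ^^ k) L_M t / fact k) * (\<i> * of_real v) ^ k) - (\<Sum>k\<le>K. ?c k t * (\<i> * of_real v) ^ k)
        = (\<Sum>k\<le>K. if k \<in> {0, 1, 2} then of_real ((deriv ^^ k) L_M t / fact k) * (\<i> * of_real v) ^ k else 0)"
        unfolding sum_subtractf[symmetric] by (intro sum.cong refl) (simp add: local_coeff_def)
      also have "\<dots> = (\<Sum>k\<in>{0, 1, 2}. of_real ((deriv ^^ k) L_M t / fact k) * (\<i> * of_real v) ^ k)"
        using K by (intro sum.mono_neutral_cong_right) auto
      also have "\<dots> = of_real (L_M t) + of_real ((deriv ^^ 1) L_M t) * (\<i> * of_real v) - of_real ((deriv ^^ 2) L_M t / 2 * v\<^sup>2)"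
        by (simp add: power_mult_distrib)
      finally show ?thesis by (simp only: diff_eq_eq add.commute)
    qed
    show ?thesis
      using strip_taylor_real[OF LM_c_holomorphic LM_c_higher_deriv, of t K] unfolding s saddle_phase_def
      by (simp add: algebra_simps)
  qed
  have c0: "?c 0 t' = 0 \<and> ?c 1 t' = 0 \<and> ?c 2 t' = 0" for t' by (simp add: local_coeff_def)
  \<comment> \<open>For K < 2 the polynomial is zero, and the cubic bound obtained at K = 2 is more
    than enough when |v| \<le> 1.\<close>
  have T': "\<exists>C r. r > 0 \<and> (\<forall>v. \<bar>v\<bar> \<le> r \<longrightarrow> cmod (saddle_phase t v - (\<Sum>k\<le>K. ?c k t * (\<i> * of_real v) ^ k)) \<le> C * \<bar>v\<bar> ^ Suc K)" for K
  proof (cases "K \<ge> 2")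
    case False
    obtain C r where r: "r > 0" and C: "\<And>v. \<bar>v\<bar> \<le> r \<Longrightarrow> cmod (saddle_phase t v - (\<Sum>k\<le>2. ?c k t * (\<i> * of_real v) ^ k)) \<le> C * \<bar>v\<bar> ^ Suc 2"
      using T[of 2] by auto
    have z: "(\<Sum>k\<le>K. ?c k t * (\<i> * of_real v) ^ k) = 0" if "K \<le> 2" for v K
      using that by (intro sum.neutral) (auto simp: local_coeff_def)
    show ?thesis
    proof (rule exI[of _ "\<bar>C\<bar>"], rule exI[of _ "min r 1"], intro conjI allI impI)
      fix v assume v: "\<bar>v\<bar> \<le> min r 1"
      have "cmod (saddle_phase t v) \<le> C * \<bar>v\<bar> ^ Suc 2" using C[of v] v unfolding z[OF order_refl] by simp
      also have "\<dots> \<le> \<bar>C\<bar> * \<bar>v\<bar> ^ Suc K"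
        using v False by (intro mult_mono power_decreasing) auto
      finally show "cmod (saddle_phase t v - (\<Sum>k\<le>K. ?c k t * (\<i> * of_real v) ^ k)) \<le> \<bar>C\<bar> * \<bar>v\<bar> ^ Suc K"
        using False by (subst z) simp_all
    qed (use r in auto)
  qed (rule T)
  have e: "explicit_coeff (\<lambda>t \<theta>. ?c k t)" for k
    by (rule explicit_local_coeff) (auto intro: deriv_L_M)
  show ?thesis using expands_local[OF \<theta>, where s = 1 and c = ?c and t = t and g = "saddle_phase t", OF _ e T'] c0 by (simp add: local_series_def)
qed

text \<open>The summand of index j carries n^(-j) = \<epsilon>^(2j), so it starts late enough for
  the diagonal sum.\<close>

lemma expands_remainder:
  "expands t \<theta> (\<lambda>n u. log_remainder n (z_path t n u) (\<theta> n) - of_real (H t))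
    (\<lambda>t \<theta>. fps_diagonal (\<lambda>j. if j = 0 then local_series 0 (local_coeff (\<lambda>k. (deriv ^^ k) H) {0}) t else (fps_X ^ 2) ^ j * em_series j t \<theta>))"
proof (rule expands_diagonal[OF \<theta>, where F = "\<lambda>j n u. if j = 0 then H_c (z_path t n u) - of_real (H t) else (1 / of_nat n) ^ j * em_term j (z_path t n u) (\<theta> n)"
      and A = "\<lambda>j t \<theta>. if j = 0 then local_series 0 (local_coeff (\<lambda>k. (deriv ^^ k) H) {0}) t else (fps_X ^ 2) ^ j * em_series j t \<theta>"])
  fix j
  show "expands t \<theta> (\<lambda>n u. if j = 0 then H_c (z_path t n u) - of_real (H t) else (1 / of_nat n) ^ j * em_term j (z_path t n u) (\<theta> n))
     (\<lambda>t \<theta>. if j = 0 then local_series 0 (local_coeff (\<lambda>k. (deriv ^^ k) H) {0}) t else (fps_X ^ 2) ^ j * em_series j t \<theta>)"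
  proof (cases "j = 0")
    case False
    have "expands t \<theta> (\<lambda>n u. (1 / of_nat n) ^ j * em_term j (z_path t n u) (\<theta> n)) (\<lambda>t \<theta>. (fps_X ^ 2) ^ j * em_series j t \<theta>)"
      using False by (intro exp_intros expands_inverse_n[OF \<theta>] expands_em_term) simp
    then show ?thesis using False by simp
  qed (simp add: expands_H)
next
  fix j k :: nat and t \<theta> assume "k < j"
  then show "(if j = 0 then local_series 0 (local_coeff (\<lambda>k. (deriv ^^ k) H) {0}) t else (fps_X ^ 2) ^ j * em_series j t \<theta>) $ k = 0"
    by (simp add: power_mult[symmetric] fps_X_power_mult_nth)
next
  fix K
  obtain C where C: "\<And>n v \<theta>. t + 1 \<le> real n \<Longrightarrow> \<bar>v\<bar> \<le> 1 \<Longrightarrow>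
    cmod (log_remainder n (Complex t v) \<theta> - (\<Sum>j\<le>Suc K. (1 / of_nat n) ^ j * em_term j (Complex t v) \<theta>)) \<le> C * (1 / real n) ^ Suc (Suc K)"
    using log_remainder_expansion[OF t, of K] by blast
  have "\<forall>\<^sub>F n in sequentially. \<forall>u. \<bar>u\<bar> \<le> ln (real n) \<longrightarrow> cmod (log_remainder n (z_path t n u) (\<theta> n) - of_real (H t)
     - (\<Sum>j\<le>Suc K. if j = 0 then H_c (z_path t n u) - of_real (H t) else (1 / of_nat n) ^ j * em_term j (z_path t n u) (\<theta> n))) \<le> \<bar>C\<bar> * dl n ^ (2 * K)"
    using eventually_ge_at_top[of "nat \<lceil>t + 1\<rceil>"] eventually_ln_power_dl[of 1 1] eventually_ge_at_top[of 1]
  proof eventually_elim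
    case (elim n)
    note d = dl_pos[OF elim(3)] dl_le_1[OF elim(3)]
    have nt: "t + 1 \<le> real n" using elim(1) by linarith
    show ?case
    proof (intro allI impI)
      fix u assume u: "\<bar>u\<bar> \<le> ln (real n)"
      have "\<bar>u / sqrt (real n)\<bar> = \<bar>u\<bar> * dl n ^ 2" using dl_power2[OF elim(3)] by (simp add: abs_divide)
      also have "\<dots> \<le> ln (real n) * dl n" using u d elim(3) by (intro mult_mono) (auto simp: power2_eq_square mult_left_le_one_le)
      also have "\<dots> \<le> 1" using elim(2) by simp
      finally have v: "\<bar>u / sqrt (real n)\<bar> \<le> 1" .
      have "log_remainder n (z_path t n u) (\<theta> n) - of_real (H t)
         - (\<Sum>j\<le>Suc K. if j = 0 then H_c (z_path t n u) - of_real (H t) else (1 / of_nat n) ^ j * em_term j (z_path t n u) (\<theta> n))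
        = log_remainder n (z_path t n u) (\<theta> n) - (\<Sum>j\<le>Suc K. (1 / of_nat n) ^ j * em_term j (z_path t n u) (\<theta> n))"
        by (subst (1 2) sum.atMost_Suc_shift) (simp add: em_term_0)
      also have "cmod \<dots> \<le> C * (1 / real n) ^ Suc (Suc K)" unfolding z_path_Complex by (rule C[OF nt v])
      also have "\<dots> \<le> \<bar>C\<bar> * dl n ^ (2 * K)"
      proof (intro mult_mono)
        have "(1 / real n) ^ Suc (Suc K) = dl n ^ (4 * Suc (Suc K))" using elim(3) by (simp only: power_mult dl_power4)
        also have "\<dots> \<le> dl n ^ (2 * K)" using d by (intro power_decreasing) auto
        finally show "(1 / real n) ^ Suc (Suc K) \<le> dl n ^ (2 * K)" .
      qed auto
      finally show "cmod (log_remainder n (z_path t n u) (\<theta> n) - of_real (H t)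
         - (\<Sum>j\<le>Suc K. if j = 0 then H_c (z_path t n u) - of_real (H t) else (1 / of_nat n) ^ j * em_term j (z_path t n u) (\<theta> n))) \<le> \<bar>C\<bar> * dl n ^ (2 * K)" .
    qed
  qed
  then show "\<exists>J\<ge>K. \<exists>C. \<forall>\<^sub>F n in sequentially. \<forall>u. \<bar>u\<bar> \<le> ln (real n) \<longrightarrow> cmod (log_remainder n (z_path t n u) (\<theta> n) - of_real (H t)
     - (\<Sum>j\<le>J. if j = 0 then H_c (z_path t n u) - of_real (H t) else (1 / of_nat n) ^ j * em_term j (z_path t n u) (\<theta> n))) \<le> C * dl n ^ (2 * K)"
    by (intro exI[of _ "Suc K"]) auto
qed

lemma expands_reduced_integrand: "expands t \<theta> (reduced_integrand t \<theta>) integrand_series"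
proof -
  have "expands t \<theta> (\<lambda>n u. of_nat n * saddle_phase t (u / sqrt (real n)) + (log_remainder n (z_path t n u) (\<theta> n) - of_real (H t))) exponent_series"
    using expands_add[OF \<theta> expands_phase expands_remainder] by (simp add: exponent_series_def[abs_def])
  from expands_mult[OF \<theta> expands_inverse_z expands_exp[OF \<theta> this exponent_series_0]]
  show ?thesis by (simp add: reduced_integrand_def[abs_def] integrand_series_def[abs_def])
qed

end

subsection \<open>The Laplace method\<close>

text \<open>Each factor is the quotient of \<open>expm1q\<close> at kw and at w, and on the strip
  both are exponentials of \<open>L_c\<close>.\<close>

lemma maj_mgf_eq_exp:
  assumes w: "\<And>k. k \<le> n \<Longrightarrow> of_nat k * w \<in> strip" and w0: "exp w \<noteq> 1"
  shows "maj_mgf n w = exp ((\<Sum>k=1..n. L_c (of_nat k * w)) - of_nat n * L_c w)"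
proof (cases "n = 0")
  case False
  then have ws: "w \<in> strip" using w[of 1] by simp
  have wn: "w \<noteq> 0" using w0 by auto
  have q0: "expm1q w \<noteq> 0" using exp_L_c[OF ws] by (metis exp_not_eq_zero)
  have "(\<Sum>j<k. exp w ^ j) / of_nat k = exp (L_c (of_nat k * w) - L_c w)" if k: "k \<in> {1..n}" for k
  proof -
    have kn: "of_nat k \<noteq> (0 :: complex)" using k by simp
    have "(exp w - 1) * (\<Sum>j<k. exp w ^ j) = exp (of_nat k * w) - 1"
      by (simp add: power_diff_1_eq exp_of_nat_mult)
    then have "(w * expm1q w) * (\<Sum>j<k. exp w ^ j) = (of_nat k * w) * expm1q (of_nat k * w)"
      by (simp only: expm1q_mult)
    then have "(\<Sum>j<k. exp w ^ j) / of_nat k = expm1q (of_nat k * w) / expm1q w"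
      using wn q0 kn by (simp add: field_simps)
    also have "\<dots> = exp (L_c (of_nat k * w) - L_c w)"
      using k w ws by (simp add: exp_diff exp_L_c)
    finally show ?thesis .
  qed
  then have "maj_mgf n w = (\<Prod>k=1..n. exp (L_c (of_nat k * w) - L_c w))" unfolding maj_mgf_def by (intro prod.cong) auto
  also have "\<dots> = exp (\<Sum>k=1..n. L_c (of_nat k * w) - L_c w)" by (simp add: exp_sum)
  finally show ?thesis by (simp add: sum_subtractf)
qed (simp add: maj_mgf_def)

definition tail_integrand :: "nat \<Rightarrow> nat \<Rightarrow> complex \<Rightarrow> complex" where
  "tail_integrand n N w = maj_mgf n w * exp (- of_nat N * w) / (1 - exp (- w))"

text \<open>An exact identity. With N = n^2 x + \<theta> one has N w = n x z + \<theta> w, and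
  L_M'(t) = x cancels the linear term of the phase. The factor n/t comes from 1/w = n/z and the t
  put into \<open>reduced_integrand\<close>.\<close>

lemma tail_integrand_central:
  fixes x t \<theta> :: real
  assumes t: "t > 0" and n: "n \<ge> 1" and v: "\<bar>u / sqrt (real n)\<bar> \<le> 1"
    and x: "(deriv ^^ 1) L_M t = x" and N: "real N = (real n)\<^sup>2 * x + \<theta>' n"
  shows "tail_integrand n N (z_path t n u / of_nat n) =
     of_real (real n / t * exp (real n * L_M t - real n * x * t + H t)) * (of_real (exp (- (deriv ^^ 2) L_M t * u\<^sup>2 / 2)) * reduced_integrand t \<theta>' n u)"
proof -
  define z where "z = z_path t n u"
  define w where "w = z / of_nat n"
  define S where "S = (\<Sum>k=1..n. L_c (of_nat k * w))"
  have zC: "z = Complex t (u / sqrt (real n))" by (simp add: z_def z_path_Complex)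
  have z_strip: "z \<in> strip" using v pi_gt3 by (simp add: zC strip_def)
  have kw: "of_nat k * w \<in> strip" if "k \<le> n" for k
  proof -
    have "of_nat k * w = of_real (real k / real n) * z" by (simp add: w_def)
    then show ?thesis using that n mult_in_strip[OF z_strip, of "real k / real n"] by simp
  qed
  have ws: "w \<in> strip" using kw[of 1] n by simp
  have z0: "z \<noteq> 0" using t by (auto simp: zC complex_eq_iff)
  have w0: "w \<noteq> 0" using z0 n by (simp add: w_def)
  have rw: "Re w > 0" using t n by (simp add: w_def zC)
  have e1: "exp w \<noteq> 1"
  proof
    assume "exp w = 1"
    then have "cmod (exp w) = 1" by simp
    then show False using rw by (simp add: norm_exp_eq_Re)
  qed
  have mg: "maj_mgf n w = exp (S - of_nat n * L_c w)" unfolding S_def by (rule maj_mgf_eq_exp[OF kw e1])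
  have "1 - exp (- w) = exp (- w) * (exp w - 1)" by (simp add: right_diff_distrib exp_add[symmetric])
  also have "\<dots> = exp (- w) * (w * exp (L_c w))" by (simp add: expm1q_mult exp_L_c[OF ws])
  finally have den: "1 - exp (- w) = w * exp (L_c w - w)" by (simp add: exp_diff exp_minus divide_inverse mult_ac)
  have Nw: "of_nat N * w = of_nat n * of_real x * z + of_real (\<theta>' n) * w"
  proof -
    have "of_nat N = complex_of_real (real N)" by simp
    also have "\<dots> = of_nat n * of_nat n * of_real x + of_real (\<theta>' n)" unfolding N by (simp add: power2_eq_square)
    finally show ?thesis using n by (simp add: w_def field_simps)
  qed
  have "tail_integrand n N w = exp (S - of_nat n * L_c w) * exp (- (of_nat n * of_real x * z + of_real (\<theta>' n) * w)) / (w * exp (L_c w - w))"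
    unfolding tail_integrand_def mg den by (simp add: Nw)
  also have "\<dots> = exp (S - of_nat n * L_c w - (of_nat n * of_real x * z + of_real (\<theta>' n) * w) - (L_c w - w)) / w"
    by (simp add: exp_diff exp_minus exp_add field_simps)
  also have "S - of_nat n * L_c w - (of_nat n * of_real x * z + of_real (\<theta>' n) * w) - (L_c w - w)
     = of_real (real n * L_M t - real n * x * t + H t) + of_real (- (deriv ^^ 2) L_M t * u\<^sup>2 / 2)
       + (of_nat n * saddle_phase t (u / sqrt (real n)) + (log_remainder n z (\<theta>' n) - of_real (H t)))"
  proof -
    have sq: "of_nat n * complex_of_real ((deriv ^^ 2) L_M t / 2 * (u / sqrt (real n))\<^sup>2) = of_real ((deriv ^^ 2) L_M t * u\<^sup>2 / 2)"
    proof -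
      have "real n * ((deriv ^^ 2) L_M t / 2 * (u / sqrt (real n))\<^sup>2) = (deriv ^^ 2) L_M t * u\<^sup>2 / 2"
        using n by (simp add: power_divide)
      then show ?thesis by (metis of_real_mult of_real_of_nat_eq)
    qed
    have zv: "\<i> * complex_of_real (u / sqrt (real n)) = z - of_real t" by (simp add: z_def z_path_def)
    have zt: "of_real t + (z - of_real t) = z" by simp
    have ph: "of_nat n * saddle_phase t (u / sqrt (real n)) = of_nat n * (LM_c z - of_real (L_M t) - of_real x * (z - of_real t)) + of_real ((deriv ^^ 2) L_M t * u\<^sup>2 / 2)"
      unfolding saddle_phase_def x zv zt distrib_left[of _ _ "of_real _"] sq ..
    have lr: "log_remainder n z (\<theta>' n) = S - of_nat n * LM_c z - (of_nat n + 1) * L_c w + w - of_real (\<theta>' n) * w"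
      by (simp add: log_remainder_def S_def w_def)
    show ?thesis unfolding ph lr by (simp add: algebra_simps)
  qed
  also have "exp \<dots> / w = of_real (real n / t * exp (real n * L_M t - real n * x * t + H t)) * (of_real (exp (- (deriv ^^ 2) L_M t * u\<^sup>2 / 2)) * reduced_integrand t \<theta>' n u)"
  proof -
    have "exp (of_real a + of_real b + Y) / w = of_real (real n / t * exp a) * (of_real (exp b) * (of_real t / z * exp Y))" for a b Y
      using t n z0 by (simp add: exp_add w_def exp_of_real[symmetric])
    then show ?thesis unfolding reduced_integrand_def z_def[symmetric] .
  qed
  finally show ?thesis unfolding w_def z_def .
qed

text \<open>The remaining factors do no harm: |exp(-N w)| depends on Re w only, and |1 - exp(-w)| is
  smallest at the real point.\<close>

lemma tail_integrand_bound:
  assumes t: "t > 0"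
  shows "\<exists>c>0. \<forall>n\<ge>8. \<forall>N a. \<bar>a\<bar> \<le> pi \<longrightarrow>
    cmod (tail_integrand n N (Complex (t / real n) a)) \<le> cmod (tail_integrand n N (of_real (t / real n))) * exp (- c * real n * min 1 ((real n * a)\<^sup>2))"
proof -
  obtain c where c: "c > 0" and b: "\<And>n a. n \<ge> 8 \<Longrightarrow> \<bar>a\<bar> \<le> pi \<Longrightarrow>
    cmod (maj_mgf n (Complex (t / real n) a)) \<le> cmod (maj_mgf n (of_real (t / real n))) * exp (- c * real n * min 1 ((real n * a)\<^sup>2))"
    using maj_mgf_tail_bound[OF t] by blast
  show ?thesis
  proof (intro exI[of _ c] conjI allI impI)
    fix n N :: nat and a :: real assume n: "8 \<le> n" and a: "\<bar>a\<bar> \<le> pi"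
    define \<tau> where "\<tau> = t / real n"
    have \<tau>: "\<tau> > 0" using t n by (simp add: \<tau>_def)
    have d0: "1 - exp (- \<tau>) > 0" using \<tau> by simp
    have d: "1 - exp (- \<tau>) \<le> cmod (1 - exp (- Complex \<tau> a))"
      using norm_triangle_ineq2[of 1 "exp (- Complex \<tau> a)"] by (simp add: norm_exp_eq_Re)
    have dr: "cmod (1 - exp (- complex_of_real \<tau>)) = 1 - exp (- \<tau>)"
    proof -
      have "1 - exp (- complex_of_real \<tau>) = of_real (1 - exp (- \<tau>))" by (simp add: exp_of_real[symmetric])
      then show ?thesis using d0 by (simp only: norm_of_real abs_of_pos)
    qed
    have eN: "cmod (exp (- of_nat N * Complex \<tau> a)) = cmod (exp (- of_nat N * complex_of_real \<tau>))"
      by (simp add: norm_exp_eq_Re)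
    have "cmod (tail_integrand n N (Complex \<tau> a)) = cmod (maj_mgf n (Complex \<tau> a)) * cmod (exp (- of_nat N * complex_of_real \<tau>)) / cmod (1 - exp (- Complex \<tau> a))"
      unfolding tail_integrand_def norm_divide norm_mult eN ..
    also have "\<dots> \<le> (cmod (maj_mgf n (of_real \<tau>)) * exp (- c * real n * min 1 ((real n * a)\<^sup>2))) * cmod (exp (- of_nat N * complex_of_real \<tau>)) / (1 - exp (- \<tau>))"
      using b[OF n a] d d0 unfolding \<tau>_def[symmetric] by (intro frac_le mult_right_mono) auto
    also have "\<dots> = cmod (tail_integrand n N (of_real \<tau>)) * exp (- c * real n * min 1 ((real n * a)\<^sup>2))"
      unfolding tail_integrand_def norm_divide norm_mult dr by simp
    finally show "cmod (tail_integrand n N (Complex (t / real n) a)) \<le> cmod (tail_integrand n N (of_real (t / real n))) * exp (- c * real n * min 1 ((real n * a)\<^sup>2))"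
      unfolding \<tau>_def .
  qed (rule c)
qed

lemma tail_integrand_continuous:
  assumes "\<tau> > 0"
  shows "continuous_on A (\<lambda>a. tail_integrand n N (Complex \<tau> a))"
proof -
  have "1 - exp (- Complex \<tau> a) \<noteq> 0" for a
  proof
    assume "1 - exp (- Complex \<tau> a) = 0"
    then have "cmod (exp (- Complex \<tau> a)) = 1" by simp
    then show False using assms by (simp add: norm_exp_eq_Re)
  qed
  then show ?thesis unfolding tail_integrand_def maj_mgf_def Complex_eq
    by (intro continuous_intros) (auto simp: Complex_eq)
qed

text \<open>Substitute a = u/n^(3/2), as Im z = n a = u/sqrt n; the Jacobian is the denominator.
  Outside the central range the integrand is at most B on a set of length at most 2 pi.\<close>

lemma prob_major_index_split:
  assumes t: "t > 0" and n: "n \<ge> 1" and R: "0 \<le> R" "R / (real n * sqrt (real n)) \<le> pi"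
    and B: "\<And>a. R / (real n * sqrt (real n)) \<le> \<bar>a\<bar> \<Longrightarrow> \<bar>a\<bar> \<le> pi \<Longrightarrow> cmod (tail_integrand n N (Complex (t / real n) a)) \<le> B"
  shows "cmod (of_real (2 * pi * measure_pmf.prob (major_index_pmf n) {M. N \<le> M})
     - (LINT u:{- R..R}|lborel. tail_integrand n N (z_path t n u / of_nat n)) / of_real (real n * sqrt (real n))) \<le> 2 * pi * B"
proof -
  define \<tau> where "\<tau> = t / real n"
  have \<tau>: "\<tau> > 0" using t n by (simp add: \<tau>_def)
  define c where "c = real n * sqrt (real n)"
  have c: "c > 0" using n by (simp add: c_def)
  define b where "b = R / c"
  have b: "0 \<le> b" "b \<le> pi" using R c by (simp_all add: b_def c_def)
  define f where "f = (\<lambda>a. tail_integrand n N (Complex \<tau> a))"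
  have cont: "continuous_on A f" for A unfolding f_def by (rule tail_integrand_continuous[OF \<tau>])
  have int: "f integrable_on {l..r}" for l r by (rule integrable_continuous_real[OF cont])
  have B0: "B \<ge> 0" using order_trans[OF norm_ge_zero B[of pi]] b by (simp add: b_def c_def)
  have "(f has_integral of_real (2 * pi * measure_pmf.prob (major_index_pmf n) {M. N \<le> M})) {-pi..pi}"
    using prob_major_index_integral[OF \<tau>, of n N] by (simp add: f_def tail_integrand_def)
  then have "of_real (2 * pi * measure_pmf.prob (major_index_pmf n) {M. N \<le> M}) = integral {-pi..pi} f"
    by (simp only: integral_unique)
  also have "\<dots> = integral {-pi..-b} f + (integral {-b..b} f + integral {b..pi} f)"
    using b int by (simp add: Henstock_Kurzweil_Integration.integral_combine)
  finally have split: "of_real (2 * pi * measure_pmf.prob (major_index_pmf n) {M. N \<le> M}) - integral {-b..b} f = integral {-pi..-b} f + integral {b..pi} f"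
    by simp
  have i1: "cmod (integral {-pi..-b} f) \<le> B * (- b - - pi)"
    using b B cont by (intro integral_bound) (auto simp: f_def \<tau>_def b_def c_def)
  have i2: "cmod (integral {b..pi} f) \<le> B * (pi - b)"
    using b B cont by (intro integral_bound) (auto simp: f_def \<tau>_def b_def c_def)
  have "cmod (integral {-pi..-b} f + integral {b..pi} f) \<le> B * (- b - - pi) + B * (pi - b)"
    by (rule order_trans[OF norm_triangle_ineq add_mono[OF i1 i2]])
  also have "\<dots> = B * (2 * (pi - b))" by (simp add: algebra_simps)
  also have "\<dots> \<le> B * (2 * pi)" using B0 b by (intro mult_left_mono) auto
  finally have m: "cmod (of_real (2 * pi * measure_pmf.prob (major_index_pmf n) {M. N \<le> M}) - integral {-b..b} f) \<le> 2 * pi * B"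
    unfolding split by (simp add: mult_ac)
  have "integral {-b..b} f = (LINT u:{- R..R}|lborel. tail_integrand n N (z_path t n u / of_nat n)) / of_real c"
  proof -
    have fz: "f (u / c) = tail_integrand n N (z_path t n u / of_nat n)" for u
    proof -
      have "Complex \<tau> (u / c) = z_path t n u / of_nat n"
        by (simp add: z_path_Complex \<tau>_def c_def complex_eq_iff)
      then show ?thesis by (simp add: f_def)
    qed
    have "((\<lambda>u. f ((1 / c) * u)) has_integral (1 / \<bar>1 / c\<bar>) *\<^sub>R integral {-b..b} f) ((\<lambda>u. u / (1 / c)) ` {-b..b})"
      using c by (intro has_integral_stretch_real integrable_integral int) auto
    moreover have "(\<lambda>u. u / (1 / c)) ` {-b..b} = {- R..R}"
      using c image_mult_atLeastAtMost[of c "-b" b] by (simp add: b_def mult.commute)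
    ultimately have I: "((\<lambda>u. f (u / c)) has_integral (of_real c * integral {-b..b} f)) {- R..R}"
      using c by (simp add: scaleR_conv_of_real)
    have "continuous_on {- R..R} (\<lambda>u. f (u / c))"
      by (rule continuous_on_compose2[OF cont[of UNIV]]) (use c in \<open>auto intro!: continuous_intros\<close>)
    then have "set_integrable lborel {- R..R} (\<lambda>u. f (u / c))"
      unfolding set_integrable_def by (intro borel_integrable_compact) auto
    then have "(LINT u:{- R..R}|lborel. f (u / c)) = integral {- R..R} (\<lambda>u. f (u / c))"
      by (rule set_borel_integral_eq_integral)
    also have "\<dots> = of_real c * integral {-b..b} f" using I by (rule integral_unique)
    finally show ?thesis using c by (simp add: fz)
  qed
  then show ?thesis using m unfolding c_def by simp
qed

section \<open>The coefficients of the expansion\<close>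

definition laplace_coeff :: "nat \<Rightarrow> real \<Rightarrow> real \<Rightarrow> complex" where
  "laplace_coeff k t \<theta> = (\<Sum>m\<le>3*k. poly.coeff (integrand_series t \<theta> $ k) m * of_real (gauss_moment m (1 / (deriv ^^ 2) L_M t)))"

text \<open>The index is 2k because \<epsilon>^(2k) = n^(-k). The coefficient is real, so
  \<open>Re\<close> only changes its type.\<close>

definition sharp_coeff :: "nat \<Rightarrow> real \<Rightarrow> real \<Rightarrow> real" where
  "sharp_coeff k t \<theta> = Re (laplace_coeff (2 * k) t \<theta>)"

text \<open>\<open>graded\<close> refers to no particular t and no sequence \<theta>, so the single
  instance t = 1, \<theta> = 0 suffices.\<close>

lemma graded_integrand_series: "graded integrand_series"
  using expands_graded[OF expands_reduced_integrand[of "\<lambda>_. 0" 1]] by simp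

lemma explicit_laplace_coeff: "explicit_coeff (laplace_coeff k)"
proof -
  have F: "fact j \<in> (\<rat> :: real set)" for j by (metis Rats_of_nat of_nat_fact)
  have "explicit_coeff (\<lambda>t \<theta>. of_real (gauss_moment m (1 / (deriv ^^ 2) L_M t)))" for m
  proof (cases "even m")
    case True
    have "explicit_coeff (\<lambda>t \<theta>. of_real ((-1) ^ (m div 2) * fact m / (2 ^ (m div 2) * fact (m div 2))) * of_real (1 / (deriv ^^ 2) L_M t) ^ (m div 2))"
      by (intro explicit_coeff_cmult explicit_coeff_power explicit_coeffI[OF inv_variance] Rats_divide Rats_mult Rats_power F) auto
    then show ?thesis using True by (simp add: gauss_moment_def)
  qed (simp add: gauss_moment_def)
  then show ?thesis unfolding laplace_coeff_def[abs_def]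
    by (intro explicit_coeff_sum explicit_coeff_mult gradedD1[OF graded_integrand_series]) auto
qed

lemma laplace_coeff_real: "laplace_coeff k t \<theta> = of_real (Re (laplace_coeff k t \<theta>))"
proof -
  obtain g where "laplace_coeff k = (\<lambda>t \<theta>. complex_of_real (g t \<theta>))"
    using explicit_laplace_coeff by (auto simp: explicit_coeff_def)
  then show ?thesis by simp
qed

lemma explicit_sharp_coeff: "explicit_formula (sharp_coeff k)"
proof -
  obtain g where "explicit_formula g" "laplace_coeff (2 * k) = (\<lambda>t \<theta>. complex_of_real (g t \<theta>))"
    using explicit_laplace_coeff by (auto simp: explicit_coeff_def)
  then show ?thesis by (simp add: sharp_coeff_def[abs_def])
qed

lemma laplace_coeff_odd: "odd k \<Longrightarrow> laplace_coeff k t \<theta> = 0"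
  unfolding laplace_coeff_def
proof (intro sum.neutral ballI)
  fix m assume "odd k" "m \<in> {..3*k}"
  then show "poly.coeff (integrand_series t \<theta> $ k) m * complex_of_real (gauss_moment m (1 / (deriv ^^ 2) L_M t)) = 0"
    using gradedD2[OF graded_integrand_series, of t \<theta> k m]
    by (cases "poly.coeff (integrand_series t \<theta> $ k) m = 0") (auto simp: gauss_moment_def)
qed

text \<open>Odd orders in \<epsilon> vanish, so 2q orders in \<epsilon> amount to q orders in
  1/n.\<close>

lemma laplace_coeff_sum:
  assumes "n \<ge> 1"
  shows "(\<Sum>k\<le>2*q. of_real (dl n) ^ (2 * k) * laplace_coeff k t \<theta>) = of_real (\<Sum>j\<le>q. sharp_coeff j t \<theta> / real n ^ j)"
proof (induction q)
  case 0
  then show ?case using laplace_coeff_real[of 0 t \<theta>] by (simp add: sharp_coeff_def)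
next
  case (Suc q)
  have "2 * (2 * Suc q) = 4 * Suc q" by simp
  then have "dl n ^ (2 * (2 * Suc q)) = (dl n ^ 4) ^ Suc q" by (simp only: power_mult)
  also have "\<dots> = 1 / real n ^ Suc q" using dl_power4[OF assms] by (simp add: power_divide)
  finally have d: "dl n ^ (2 * (2 * Suc q)) = 1 / real n ^ Suc q" .
  have "of_real (dl n) ^ (2 * (2 * Suc q)) * laplace_coeff (2 * Suc q) t \<theta> = of_real (sharp_coeff (Suc q) t \<theta> / real n ^ Suc q)"
  proof -
    have "of_real (dl n) ^ (2 * (2 * Suc q)) = complex_of_real (1 / real n ^ Suc q)"
      unfolding d[symmetric] by (rule of_real_power[symmetric])
    moreover have "laplace_coeff (2 * Suc q) t \<theta> = of_real (sharp_coeff (Suc q) t \<theta>)"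
      unfolding sharp_coeff_def by (rule laplace_coeff_real)
    ultimately show ?thesis by (simp only: of_real_mult[symmetric]) simp
  qed
  moreover have "(\<Sum>k\<le>2 * Suc q. of_real (dl n) ^ (2 * k) * laplace_coeff k t \<theta>) =
     (\<Sum>k\<le>2 * q. of_real (dl n) ^ (2 * k) * laplace_coeff k t \<theta>) + of_real (dl n) ^ (2 * Suc (2 * q)) * laplace_coeff (Suc (2 * q)) t \<theta>
      + of_real (dl n) ^ (2 * (2 * Suc q)) * laplace_coeff (2 * Suc q) t \<theta>"
  proof -
    have "2 * Suc q = Suc (Suc (2 * q))" by simp
    then show ?thesis by (simp only: sum.atMost_Suc)
  qed
  moreover have "laplace_coeff (Suc (2 * q)) t \<theta> = 0" by (rule laplace_coeff_odd) simp
  ultimately show ?case using Suc.IH by simp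
qed

lemma exponential_series_low:
  fixes X :: "complex poly fps"
  assumes "X $ 0 = 0"
  defines "E \<equiv> fps_diagonal (\<lambda>j. fps_const [:1 / fact j:] * X ^ j)"
  shows "E $ 0 = 1" "E $ 1 = X $ 1" "E $ 2 = X $ 2 + smult (1/2) (X $ 1 * X $ 1)"
proof -
  have one: "[:1:] = (1 :: complex poly)" by (simp add: one_pCons)
  show "E $ 0 = 1" by (simp add: E_def fps_diagonal_def one)
  show "E $ 1 = X $ 1" by (simp add: E_def fps_diagonal_def one)
  have "(X ^ 2) $ 2 = X $ 1 * X $ 1"
    using assms(1) by (simp add: power2_eq_square fps_mult_nth numeral_2_eq_2)
  then show "E $ 2 = X $ 2 + smult (1/2) (X $ 1 * X $ 1)"
    by (simp add: E_def fps_diagonal_def one numeral_2_eq_2)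
qed

text \<open>In s = \<i>u, the exponent has first order a1 s + a3 s^3 and second order b0 + b2 s^2 +
  b4 s^4; it is exponentiated and multiplied by t/z = 1 - \<epsilon> s/t + \<epsilon>^2 s^2/t^2 -
  .... In \<open>b0\<close>, 1/12 is \<open>em_coeff 2\<close>, the 1/2 next to L_D'(t) is L_D'(0),
  1/24 is L_D''(0)/2, and t/2 is L_D'(0) t.\<close>

lemma integrand_series_low:
  fixes t \<theta> :: real
  defines "a1 \<equiv> (deriv ^^ 1) H t" and "a3 \<equiv> (deriv ^^ 3) L_M t / 6"
    and "b0 \<equiv> t * ((deriv ^^ 1) L_D t - 1/2) / 12 - t\<^sup>2 / 24 - t / 2 + (1 - \<theta>) * t"
    and "b2 \<equiv> (deriv ^^ 2) H t / 2" and "b4 \<equiv> (deriv ^^ 4) L_M t / 24"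
  shows "integrand_series t \<theta> $ 0 = 1"
    and "integrand_series t \<theta> $ 2 = map_poly of_real [:b0, 0, b2 + a1\<^sup>2 / 2 - a1 / t + 1 / t\<^sup>2, 0, b4 + a1 * a3 - a3 / t, 0, a3\<^sup>2 / 2:]"
proof -
  define X where "X = exponent_series t \<theta>"
  have X0: "X $ 0 = 0" unfolding X_def by (rule exponent_series_0)
  have em: "em_series 1 t \<theta> $ 0 = [:of_real b0:]"
  proof -
    have "deriv L_D 0 = 1 / 2" "deriv (deriv L_D) 0 = 1 / 12"
      using L_D_deriv_0_1 L_D_deriv_0_2 by (simp_all add: numeral_2_eq_2)
    note d = this
    show ?thesis
    by (simp add: em_series_def d z_series_def const_series_def local_series_def local_coeff_def b0_def
        numeral_2_eq_2 monom_0 fact_numeral power2_eq_square algebra_simps fps_power_zeroth) (simp add: field_simps)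
  qed
  have X1: "X $ 1 = [:0, of_real a1, 0, of_real a3:]"
    by (simp add: X_def exponent_series_def local_series_def local_coeff_def fps_diagonal_def a1_def a3_def
        monom_Suc monom_0 eval_nat_numeral fps_X_power_mult_nth fact_numeral)
  have "(fps_X ^ 2 * em_series 1 t \<theta>) $ 2 = [:of_real b0:]" unfolding fps_X_power_mult_nth using em by simp
  moreover have "((fps_X ^ 2) ^ 2 * em_series 2 t \<theta>) $ 2 = 0"
    by (simp add: power_mult[symmetric] fps_X_power_mult_nth del: power_mult_numeral)
  ultimately have X2: "X $ 2 = [:of_real b0, 0, of_real b2, 0, of_real b4:]"
    by (simp add: X_def exponent_series_def local_series_def local_coeff_def fps_diagonal_def b2_def b4_def
        monom_Suc monom_0 eval_nat_numeral fact_numeral)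
  note E = exponential_series_low[OF X0]
  show "integrand_series t \<theta> $ 0 = 1"
    unfolding integrand_series_def X_def[symmetric] by (simp add: E local_series_def)
  show "integrand_series t \<theta> $ 2 = map_poly of_real [:b0, 0, b2 + a1\<^sup>2 / 2 - a1 / t + 1 / t\<^sup>2, 0, b4 + a1 * a3 - a3 / t, 0, a3\<^sup>2 / 2:]"
  proof -
    let ?T = "local_series 0 (\<lambda>k t. complex_of_real ((- 1 / t) ^ k)) t"
    let ?E = "fps_diagonal (\<lambda>j. fps_const [:1 / fact j:] * X ^ j)"
    have T: "?T $ 0 = 1" "?T $ 1 = [:0, of_real (- 1 / t):]" "?T $ 2 = [:0, 0, of_real (1 / t\<^sup>2):]"
      by (simp_all add: local_series_def monom_Suc monom_0 eval_nat_numeral)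
    have "integrand_series t \<theta> $ 2 = ?T $ 0 * ?E $ 2 + ?T $ 1 * ?E $ 1 + ?T $ 2 * ?E $ 0"
      unfolding integrand_series_def X_def[symmetric] by (simp add: fps_mult_nth numeral_2_eq_2)
    also have "\<dots> = map_poly of_real [:b0, 0, b2 + a1\<^sup>2 / 2 - a1 / t + 1 / t\<^sup>2, 0, b4 + a1 * a3 - a3 / t, 0, a3\<^sup>2 / 2:]"
      unfolding T E X1 X2 by (simp add: map_poly_pCons power2_eq_square algebra_simps)
    finally show ?thesis .
  qed
qed

lemma sharp_coeff_0: "sharp_coeff 0 t \<theta> = 1"
  by (simp add: sharp_coeff_def laplace_coeff_def integrand_series_low(1) gauss_moment_def)

lemma sharp_coeff_1:
  assumes "1/4 < x" "x < 1/2"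
  shows "sharp_coeff 1 (saddle x) (upfrac ((real n)\<^sup>2 * x)) = first_coeff n x"
proof -
  define t where "t = saddle x"
  define \<theta> where "\<theta> = upfrac ((real n)\<^sup>2 * x)"
  define v where "v = (deriv ^^ 2) L_M t"
  have t: "t > 0" unfolding t_def by (rule saddle_props[OF assms])
  have v: "v > 0" unfolding v_def by (rule L_M_deriv2_pos)
  have s2: "(sigma_M x)\<^sup>2 = v" using v by (simp add: sigma_M_def t_def v_def)
  \<comment> \<open>Moments of \<i>u and not of u, hence the alternating signs.\<close>
  have gm: "gauss_moment 0 y = 1" "gauss_moment 2 y = - y" "gauss_moment 4 y = 3 * y\<^sup>2" "gauss_moment 6 y = - 15 * y ^ 3" for y
    by (simp_all add: gauss_moment_def fact_numeral)
  have rc: "poly.coeff (map_poly complex_of_real p) m = of_real (poly.coeff p m)" for p m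
    by (simp add: coeff_map_poly)
  have s6: "{..6::nat} = {0, 1, 2, 3, 4, 5, 6}" by auto
  have c6: "poly.coeff [:c0, 0, c2, 0, c4, 0, c6:] 0 = c0" "poly.coeff [:c0, 0, c2, 0, c4, 0, c6:] 1 = 0"
    "poly.coeff [:c0, 0, c2, 0, c4, 0, c6:] 2 = c2" "poly.coeff [:c0, 0, c2, 0, c4, 0, c6:] 3 = 0"
    "poly.coeff [:c0, 0, c2, 0, c4, 0, c6:] 4 = c4" "poly.coeff [:c0, 0, c2, 0, c4, 0, c6:] 5 = 0"
    "poly.coeff [:c0, 0, c2, 0, c4, 0, c6:] 6 = c6" for c0 c2 c4 c6 :: real
    by (simp_all add: eval_nat_numeral)
  have "sharp_coeff 1 t \<theta> =
      (t * ((deriv ^^ 1) L_D t - 1/2) / 12 - t\<^sup>2 / 24 - t / 2 + (1 - \<theta>) * t)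
      + ((deriv ^^ 2) H t / 2 + ((deriv ^^ 1) H t)\<^sup>2 / 2 - (deriv ^^ 1) H t / t + 1 / t\<^sup>2) * (- (1 / v))
      + ((deriv ^^ 4) L_M t / 24 + (deriv ^^ 1) H t * ((deriv ^^ 3) L_M t / 6) - (deriv ^^ 3) L_M t / 6 / t) * (3 * (1 / v)\<^sup>2)
      + ((deriv ^^ 3) L_M t / 6)\<^sup>2 / 2 * (- 15 * (1 / v) ^ 3)"
    unfolding sharp_coeff_def laplace_coeff_def v_def[symmetric]
    by (simp only: mult_1_right integrand_series_low(2) rc of_real_mult[symmetric] of_real_sum[symmetric] Re_complex_of_real)
      (simp add: s6 c6 gm del: funpow.simps)
  also have "\<dots> = first_coeff n x"
    unfolding first_coeff_def Let_def s2 t_def[symmetric] \<theta>_def[symmetric]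
    using t v by (simp add: field_simps power2_eq_square power3_eq_cube)
  finally show ?thesis unfolding t_def \<theta>_def .
qed

text \<open>The prefactor \<open>pref\<close> is the constant in front of the central integrand,
  times the Gaussian integral sqrt(2 pi)/\<sigma>, divided by 2 pi and by the Jacobian
  n^(3/2).\<close>

lemma laplace_expansion:
  assumes x: "1/4 < x" "x < 1/2"
  defines "t \<equiv> saddle x" and "\<theta> \<equiv> (\<lambda>n. upfrac ((real n)\<^sup>2 * x))"
  defines "P \<equiv> (\<lambda>n. measure_pmf.prob (major_index_pmf n) {M. real M / (real n)\<^sup>2 \<ge> x})"
    and "pref \<equiv> (\<lambda>n. exp (- real n * I_M x + H t) / (sigma_M x * t * sqrt (2 * pi * real n)))"
  shows "\<exists>C. \<forall>\<^sub>F n in sequentially. cmod (of_real (P n / pref n) - (\<Sum>k\<le>K. of_real (dl n) ^ (2 * k) * laplace_coeff k t (\<theta> n))) \<le> C * dl n ^ (2 * K)"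
proof -
  have t: "t > 0" and tx: "(deriv ^^ 1) L_M t = x" unfolding t_def by (rule saddle_props[OF x])+
  define \<sigma> where "\<sigma> = sigma_M x"
  have \<sigma>: "\<sigma> > 0" using L_M_deriv2_pos[of t] by (simp add: \<sigma>_def sigma_M_def t_def)
  have \<sigma>2: "\<sigma>\<^sup>2 = (deriv ^^ 2) L_M t" using L_M_deriv2_pos[of t] by (simp add: \<sigma>_def sigma_M_def t_def)
  have \<theta>01: "0 \<le> \<theta> n" "\<theta> n \<le> 1" for n unfolding \<theta>_def upfrac_def by linarith+
  \<comment> \<open>M_n is an integer, so the threshold can be rounded up; this is where
    \<open>upfrac\<close> enters.\<close>
  define N where "N = (\<lambda>n. nat \<lceil>(real n)\<^sup>2 * x\<rceil>)"
  have N: "real (N n) = (real n)\<^sup>2 * x + \<theta> n" for n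
  proof -
    have "0 \<le> (real n)\<^sup>2 * x" using x by simp
    then have "0 \<le> \<lceil>(real n)\<^sup>2 * x\<rceil>" by linarith
    then show ?thesis by (simp add: N_def \<theta>_def upfrac_def)
  qed
  have P: "P n = measure_pmf.prob (major_index_pmf n) {M. N n \<le> M}" if "n \<ge> 1" for n
  proof -
    have "real M / (real n)\<^sup>2 \<ge> x \<longleftrightarrow> N n \<le> M" for M
    proof -
      have "real M / (real n)\<^sup>2 \<ge> x \<longleftrightarrow> (real n)\<^sup>2 * x \<le> real M" using that by (simp add: pos_le_divide_eq mult.commute)
      also have "\<dots> \<longleftrightarrow> N n \<le> M" unfolding N_def by (simp add: nat_le_iff ceiling_le_iff)
      finally show ?thesis .
    qed
    then show ?thesis by (simp add: P_def)
  qed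
  define pref0 where "pref0 = (\<lambda>n. real n / t * exp (real n * L_M t - real n * x * t + H t))"
  define W where "W = reduced_integrand t \<theta>"
  have W: "expands t \<theta> W integrand_series" unfolding W_def by (rule expands_reduced_integrand[OF \<theta>01 t])
  have ev_sqrt: "\<forall>\<^sub>F n in sequentially. ln (real n) \<le> sqrt (real n)" by real_asymp
  have central: "tail_integrand n (N n) (z_path t n u / of_nat n) = of_real (pref0 n) * (of_real (exp (- \<sigma>\<^sup>2 * u\<^sup>2 / 2)) * W n u)"
    if n: "n \<ge> 1" and ln: "ln (real n) \<le> sqrt (real n)" and u: "\<bar>u\<bar> \<le> ln (real n)" for n u
    unfolding pref0_def \<sigma>2 W_def
  proof (rule tail_integrand_central[where \<theta>' = \<theta>, OF t n _ tx N])
    show "\<bar>u / sqrt (real n)\<bar> \<le> 1" using n ln u by (simp add: abs_divide divide_le_eq)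
  qed
  have p0: "pref0 n > 0" if "n \<ge> 1" for n using that t by (simp add: pref0_def)
  \<comment> \<open>W inherits continuity from \<open>tail_integrand\<close>: on this range it is
    the quotient by factors that never vanish.\<close>
  have cont: "\<forall>\<^sub>F n in sequentially. continuous_on {- ln (real n)..ln (real n)} (W n)"
    using ev_sqrt eventually_ge_at_top[of 1]
  proof eventually_elim
    case (elim n)
    have tn: "t / real n > 0" using t elim by simp
    have "continuous_on {- ln (real n)..ln (real n)} (\<lambda>u. tail_integrand n (N n) (Complex (t / real n) (u / (real n * sqrt (real n)))))"
      by (rule continuous_on_compose2[OF tail_integrand_continuous[OF tn, of UNIV]])
        (use elim in \<open>auto intro!: continuous_intros\<close>)
    then have c1: "continuous_on {- ln (real n)..ln (real n)} (\<lambda>u. tail_integrand n (N n) (Complex (t / real n) (u / (real n * sqrt (real n)))) /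
        (of_real (pref0 n) * of_real (exp (- \<sigma>\<^sup>2 * u\<^sup>2 / 2))))"
      using p0[OF elim(2)] by (intro continuous_on_divide continuous_intros) auto
    have c2: "tail_integrand n (N n) (Complex (t / real n) (u / (real n * sqrt (real n)))) /
        (of_real (pref0 n) * of_real (exp (- \<sigma>\<^sup>2 * u\<^sup>2 / 2))) = W n u" if "u \<in> {- ln (real n)..ln (real n)}" for u
    proof -
      have "Complex (t / real n) (u / (real n * sqrt (real n))) = z_path t n u / of_nat n"
        by (simp add: z_path_Complex complex_eq_iff)
      moreover have "\<bar>u\<bar> \<le> ln (real n)" using that by auto
      ultimately show ?thesis using central[OF elim(2,1)] p0[OF elim(2)] by simp
    qed
    show ?case by (rule continuous_on_eq[OF c1 c2])
  qed
  define J where "J = (\<lambda>n. LINT u:{- ln (real n)..ln (real n)}|lborel. of_real (exp (- \<sigma>\<^sup>2 * u\<^sup>2 / 2)) * W n u)"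
  obtain C where C: "\<forall>\<^sub>F n in sequentially. cmod (J n - of_real (sqrt (2 * pi) / \<sigma>) * (\<Sum>k\<le>K. of_real (dl n) ^ (2 * k) * laplace_coeff k t (\<theta> n))) \<le> C * dl n ^ (2 * K)"
    using graded_gauss_expansion[OF \<theta>01 \<sigma> W cont, of K] unfolding J_def laplace_coeff_def \<sigma>2 by blast
  obtain c where c: "c > 0" and tail: "\<And>n N a. n \<ge> 8 \<Longrightarrow> \<bar>a\<bar> \<le> pi \<Longrightarrow>
    cmod (tail_integrand n N (Complex (t / real n) a)) \<le> cmod (tail_integrand n N (of_real (t / real n))) * exp (- c * real n * min 1 ((real n * a)\<^sup>2))"
    using tail_integrand_bound[OF t] by blast
  \<comment> \<open>Order 0 suffices here: the leading coefficient is 1, so |W n 0| \<le> D + 1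
    bounds the integrand at the real saddle point, to which the tail bound refers.\<close>
  obtain D where D: "D \<ge> 0" "\<forall>\<^sub>F n in sequentially. \<forall>u. \<bar>u\<bar> \<le> ln (real n) \<longrightarrow>
     cmod (W n u - partial_expansion t \<theta> integrand_series 0 n u) \<le> D * dl n ^ (2 * 0)"
    by (rule expandsD[OF W])
  \<comment> \<open>The six extra powers of \<open>dl n\<close> cancel the factor n^(3/2) that
    division by \<open>pref\<close> puts on the tail error.\<close>
  have ev_gauss: "\<forall>\<^sub>F n in sequentially. exp (- c * ln (real n) ^ 2) \<le> dl n ^ (2 * K + 6)"
    by (rule eventually_gauss_tail[OF c])
  have "\<forall>\<^sub>F n in sequentially. cmod (of_real (P n / pref n) - (\<Sum>k\<le>K. of_real (dl n) ^ (2 * k) * laplace_coeff k t (\<theta> n)))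
     \<le> (\<sigma> / sqrt (2 * pi) * C + \<sigma> * sqrt (2 * pi) * (D + 1)) * dl n ^ (2 * K)"
    using C D(2) ev_gauss ev_sqrt eventually_ge_at_top[of 8]
  proof eventually_elim
    case (elim n)
    have n1: "n \<ge> 1" using elim(5) by simp
    have l0: "ln (real n) \<ge> 0" using n1 by simp
    note d = dl_pos[OF n1]
    define B where "B = pref0 n * (D + 1) * exp (- c * ln (real n) ^ 2)"
    have W0: "cmod (W n 0) \<le> D + 1"
    proof -
      have "cmod (W n 0 - 1) \<le> D"
        using elim(2)[rule_format, of 0] l0 by (simp add: integrand_series_low(1))
      then show ?thesis using norm_triangle_sub[of "W n 0" 1] by simp
    qed
    have z0: "z_path t n 0 / of_nat n = of_real (t / real n)" by (simp add: z_path_def)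
    have T0: "cmod (tail_integrand n (N n) (of_real (t / real n))) \<le> pref0 n * (D + 1)"
      using central[OF n1 elim(4), of 0] l0 W0 p0[OF n1] unfolding z0 by (simp add: norm_mult mult_left_mono)
    have sq: "ln (real n) ^ 2 \<le> real n"
      using power_mono[OF elim(4) l0, of 2] by simp
    have split: "cmod (of_real (2 * pi * measure_pmf.prob (major_index_pmf n) {M. N n \<le> M})
     - (LINT u:{- ln (real n)..ln (real n)}|lborel. tail_integrand n (N n) (z_path t n u / of_nat n)) / of_real (real n * sqrt (real n))) \<le> 2 * pi * B"
    proof (rule prob_major_index_split[OF t n1 l0])
      have "ln (real n) / (real n * sqrt (real n)) \<le> sqrt (real n) / (real n * sqrt (real n))"
        using elim(4) by (intro divide_right_mono) auto
      also have "\<dots> \<le> 1" using n1 by simp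
      also have "\<dots> \<le> pi" using pi_gt3 by simp
      finally show "ln (real n) / (real n * sqrt (real n)) \<le> pi" .
      fix a assume a: "ln (real n) / (real n * sqrt (real n)) \<le> \<bar>a\<bar>" "\<bar>a\<bar> \<le> pi"
      have "ln (real n) / sqrt (real n) = real n * (ln (real n) / (real n * sqrt (real n)))" using n1 by simp
      also have "\<dots> \<le> real n * \<bar>a\<bar>" using a by (intro mult_left_mono) auto
      finally have "(ln (real n) / sqrt (real n))\<^sup>2 \<le> (real n * \<bar>a\<bar>)\<^sup>2" using l0 by (intro power_mono) auto
      then have "ln (real n) ^ 2 / real n \<le> (real n * a)\<^sup>2" by (simp add: power_divide power_mult_distrib)
      \<comment> \<open>So the minimum with 1 in the tail bound does not fall below (ln n)^2/n
        anywhere outside the central range.\<close>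
      moreover have "ln (real n) ^ 2 / real n \<le> 1" using sq n1 by simp
      ultimately have "real n * (ln (real n) ^ 2 / real n) \<le> real n * min 1 ((real n * a)\<^sup>2)"
        by (intro mult_left_mono) auto
      then have m: "ln (real n) ^ 2 \<le> real n * min 1 ((real n * a)\<^sup>2)" using n1 by simp
      have "cmod (tail_integrand n (N n) (Complex (t / real n) a)) \<le> cmod (tail_integrand n (N n) (of_real (t / real n))) * exp (- c * real n * min 1 ((real n * a)\<^sup>2))"
        by (rule tail[OF elim(5) a(2)])
      also have "\<dots> \<le> (pref0 n * (D + 1)) * exp (- c * ln (real n) ^ 2)"
        using T0 mult_left_mono[OF m less_imp_le[OF c]] D(1) p0[OF n1] by (intro mult_mono) (auto simp: mult.assoc)
      finally show "cmod (tail_integrand n (N n) (Complex (t / real n) a)) \<le> B" by (simp add: B_def)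
    qed
    have LJ: "(LINT u:{- ln (real n)..ln (real n)}|lborel. tail_integrand n (N n) (z_path t n u / of_nat n)) = of_real (pref0 n) * J n"
    proof -
      have "(LINT u:{- ln (real n)..ln (real n)}|lborel. tail_integrand n (N n) (z_path t n u / of_nat n)) =
        (LINT u:{- ln (real n)..ln (real n)}|lborel. of_real (pref0 n) * (of_real (exp (- \<sigma>\<^sup>2 * u\<^sup>2 / 2)) * W n u))"
      proof (intro set_lebesgue_integral_cong allI impI)
        fix u assume "u \<in> {- ln (real n)..ln (real n)}"
        then have "\<bar>u\<bar> \<le> ln (real n)" by auto
        then show "tail_integrand n (N n) (z_path t n u / of_nat n) = of_real (pref0 n) * (of_real (exp (- \<sigma>\<^sup>2 * u\<^sup>2 / 2)) * W n u)"
          by (rule central[OF n1 elim(4)])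
      qed simp
      then show ?thesis by (simp only: J_def set_integral_mult_right)
    qed
    define q where "q = 1 / (2 * pi * pref n)"
    have pref_eq: "pref n = pref0 n / (real n * (\<sigma> * sqrt (2 * pi) * sqrt (real n)))"
    proof -
      have "- real n * I_M x = real n * L_M t - real n * x * t" unfolding I_M_eq[OF tx] by (simp add: algebra_simps)
      then show ?thesis using n1 t \<sigma> by (simp add: pref_def pref0_def \<sigma>_def[symmetric] real_sqrt_mult mult_ac)
    qed
    have pf: "pref n > 0" unfolding pref_eq using p0[OF n1] n1 \<sigma> by simp
    have q: "q > 0" using pf by (simp add: q_def)
    have qB: "q * (2 * pi * B) = \<sigma> * sqrt (2 * pi) * (D + 1) * (real n * sqrt (real n) * exp (- c * ln (real n) ^ 2))"
      using p0[OF n1] n1 \<sigma> unfolding q_def B_def pref_eq by (simp add: field_simps)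
    have qJ: "q * pref0 n / (real n * sqrt (real n)) = \<sigma> / sqrt (2 * pi)"
    proof -
      have "sqrt (2 * pi) * sqrt (2 * pi) = 2 * pi" by simp
      then show ?thesis using p0[OF n1] n1 \<sigma> unfolding q_def pref_eq by (simp add: field_simps)
    qed
    have n6: "real n * sqrt (real n) * dl n ^ 6 = 1"
    proof -
      have "dl n ^ 6 = dl n ^ 4 * dl n ^ 2" by (simp add: power_add[symmetric])
      then show ?thesis using n1 dl_power4[OF n1] dl_power2[OF n1] by simp
    qed
    have e1: "cmod (of_real (P n / pref n) - of_real (\<sigma> / sqrt (2 * pi)) * J n) \<le> \<sigma> * sqrt (2 * pi) * (D + 1) * dl n ^ (2 * K)"
    proof -
      have "of_real (P n / pref n) - of_real (\<sigma> / sqrt (2 * pi)) * J n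
         = of_real q * (of_real (2 * pi * P n) - of_real (pref0 n) * J n / of_real (real n * sqrt (real n)))"
      proof -
        have "P n / pref n = q * (2 * pi * P n)" using pf by (simp add: q_def)
        then show ?thesis unfolding qJ[symmetric] by (simp add: right_diff_distrib)
      qed
      also have "cmod \<dots> \<le> q * (2 * pi * B)"
        using split q unfolding LJ P[OF n1, symmetric] by (simp only: norm_mult norm_of_real abs_of_pos mult_left_mono less_imp_le)
      also have "\<dots> \<le> \<sigma> * sqrt (2 * pi) * (D + 1) * (real n * sqrt (real n) * dl n ^ (2 * K + 6))"
        unfolding qB using elim(3) \<sigma> D(1) by (intro mult_left_mono) auto
      also have "real n * sqrt (real n) * dl n ^ (2 * K + 6) = (real n * sqrt (real n) * dl n ^ 6) * dl n ^ (2 * K)"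
        by (simp add: power_add)
      also have "\<dots> = dl n ^ (2 * K)" unfolding n6 by simp
      finally show ?thesis .
    qed
    define S where "S = (\<Sum>k\<le>K. of_real (dl n) ^ (2 * k) * laplace_coeff k t (\<theta> n))"
    have e2: "cmod (of_real (\<sigma> / sqrt (2 * pi)) * J n - S) \<le> \<sigma> / sqrt (2 * pi) * C * dl n ^ (2 * K)"
    proof -
      have "S = of_real (\<sigma> / sqrt (2 * pi)) * (of_real (sqrt (2 * pi) / \<sigma>) * S)" using \<sigma> by simp
      then have "of_real (\<sigma> / sqrt (2 * pi)) * J n - S = of_real (\<sigma> / sqrt (2 * pi)) * (J n - of_real (sqrt (2 * pi) / \<sigma>) * S)"
        by (simp only: right_diff_distrib)
      then have "cmod (of_real (\<sigma> / sqrt (2 * pi)) * J n - S) = \<sigma> / sqrt (2 * pi) * cmod (J n - of_real (sqrt (2 * pi) / \<sigma>) * S)"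
        using \<sigma> by (simp only: norm_mult norm_of_real) simp
      also have "\<dots> \<le> \<sigma> / sqrt (2 * pi) * (C * dl n ^ (2 * K))"
        using elim(1) \<sigma> unfolding S_def by (intro mult_left_mono) auto
      finally show ?thesis by simp
    qed
    have "cmod (of_real (P n / pref n) - S) \<le> cmod (of_real (P n / pref n) - of_real (\<sigma> / sqrt (2 * pi)) * J n) + cmod (of_real (\<sigma> / sqrt (2 * pi)) * J n - S)"
      using norm_triangle_ineq[of "of_real (P n / pref n) - of_real (\<sigma> / sqrt (2 * pi)) * J n" "of_real (\<sigma> / sqrt (2 * pi)) * J n - S"] by simp
    also have "\<dots> \<le> \<sigma> * sqrt (2 * pi) * (D + 1) * dl n ^ (2 * K) + \<sigma> / sqrt (2 * pi) * C * dl n ^ (2 * K)" using e1 e2 by (rule add_mono)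
    finally show ?case unfolding S_def by (simp add: distrib_right add.commute)
  qed
  then show ?thesis by blast
qed

theorem theorem2p2:
  shows "\<exists>F :: nat \<Rightarrow> real \<Rightarrow> real \<Rightarrow> real. (\<forall>k. explicit_formula (F k)) \<and>
    (\<forall>x p. 1/4 < x \<and> x < 1/2 \<and> 1 \<le> p \<longrightarrow>
      (\<exists>!t. (L_M has_real_derivative x) (at t)) \<and>
      (\<exists>m :: nat \<Rightarrow> nat \<Rightarrow> real.
        (\<exists>r :: nat \<Rightarrow> real. r \<in> O(\<lambda>n. 1 / real n ^ (p + 1)) \<and>
          (\<forall>\<^sub>F n in sequentially.
            measure_pmf.prob (major_index_pmf n) {M. real M / (real n)\<^sup>2 \<ge> x} =
              exp (- real n * I_M x + H (saddle x))
                / (sigma_M x * saddle x * sqrt (2 * pi * real n))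
              * (1 + (\<Sum>k=1..p. m n k / real n ^ k) + r n))) \<and>
        (\<forall>n\<ge>2. \<forall>k\<in>{1..p}. m n k = F k (saddle x) (upfrac ((real n)\<^sup>2 * x))) \<and>
        (\<forall>n\<ge>2. m n 1 = first_coeff n x)))"
proof (intro exI[of _ sharp_coeff] conjI allI impI explicit_sharp_coeff)
  fix x :: real and p :: nat
  assume "1/4 < x \<and> x < 1/2 \<and> 1 \<le> p"
  then have x: "1/4 < x" "x < 1/2" by auto
  show "\<exists>!t. (L_M has_real_derivative x) (at t)" by (rule ex1_saddle[OF x])
  define t where "t = saddle x"
  define \<theta> where "\<theta> = (\<lambda>n. upfrac ((real n)\<^sup>2 * x))"
  define P where "P = (\<lambda>n. measure_pmf.prob (major_index_pmf n) {M. real M / (real n)\<^sup>2 \<ge> x})"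
  define pref where "pref = (\<lambda>n. exp (- real n * I_M x + H t) / (sigma_M x * t * sqrt (2 * pi * real n)))"
  define m where "m = (\<lambda>n k. sharp_coeff k t (\<theta> n))"
  \<comment> \<open>Defined as the exact remainder, so the identity is immediate and only the size
    of \<open>r\<close> needs proof.\<close>
  define r where "r = (\<lambda>n. P n / pref n - 1 - (\<Sum>k=1..p. m n k / real n ^ k))"
  have \<theta>01: "0 \<le> \<theta> n" "\<theta> n \<le> 1" for n unfolding \<theta>_def upfrac_def by linarith+
  have t: "t > 0" unfolding t_def by (rule saddle_props[OF x])
  have s: "sigma_M x > 0" using L_M_deriv2_pos[of t] by (simp add: sigma_M_def t_def)
  \<comment> \<open>Order 2(p + 1) in \<epsilon> is taken because the error is then n^(-(p+1)), as
    required; the last term of this expansion is one too many and goes into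
    \<open>r\<close>.\<close>
  obtain C where C: "\<forall>\<^sub>F n in sequentially. cmod (of_real (P n / pref n) - (\<Sum>k\<le>2 * (p + 1). of_real (dl n) ^ (2 * k) * laplace_coeff k t (\<theta> n))) \<le> C * dl n ^ (2 * (2 * (p + 1)))"
    using laplace_expansion[OF x, of "2 * (p + 1)"] unfolding P_def pref_def t_def \<theta>_def by blast
  \<comment> \<open>The surplus coefficient varies with n only through \<theta> in [0,1], hence is
    bounded, and its term is O(n^(-(p+1))).\<close>
  obtain D where D: "\<And>y. 0 \<le> y \<Longrightarrow> y \<le> 1 \<Longrightarrow> \<bar>sharp_coeff (p + 1) t y\<bar> \<le> D"
    using explicit_formula_bounded[OF explicit_sharp_coeff[of "p + 1"], of t] by blast
  have "\<forall>\<^sub>F n in sequentially. norm (r n) \<le> (C + D) * norm (1 / real n ^ (p + 1))"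
    using C eventually_ge_at_top[of 1]
  proof eventually_elim
    case (elim n)
    have "(\<Sum>j\<le>p + 1. sharp_coeff j t (\<theta> n) / real n ^ j) = 1 + (\<Sum>k=1..p. m n k / real n ^ k) + sharp_coeff (p + 1) t (\<theta> n) / real n ^ (p + 1)"
    proof -
      have "(\<Sum>j\<le>p. sharp_coeff j t (\<theta> n) / real n ^ j) = 1 + (\<Sum>k=1..p. m n k / real n ^ k)"
        unfolding atMost_atLeast0 by (subst sum.atLeast_Suc_atMost) (simp_all add: sharp_coeff_0 m_def)
      then show ?thesis by simp
    qed
    then have "r n = (P n / pref n - (\<Sum>j\<le>p + 1. sharp_coeff j t (\<theta> n) / real n ^ j)) + sharp_coeff (p + 1) t (\<theta> n) / real n ^ (p + 1)"
      by (simp add: r_def)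
    also have "norm \<dots> \<le> C * (1 / real n ^ (p + 1)) + D * (1 / real n ^ (p + 1))"
    proof (intro order_trans[OF norm_triangle_ineq] add_mono)
      have "2 * (2 * (p + 1)) = 4 * (p + 1)" by simp
      then have "dl n ^ (2 * (2 * (p + 1))) = (dl n ^ 4) ^ (p + 1)" by (simp only: power_mult)
      also have "\<dots> = 1 / real n ^ (p + 1)" unfolding dl_power4[OF elim(2)] by (simp add: power_divide)
      finally have dp: "dl n ^ (2 * (2 * (p + 1))) = 1 / real n ^ (p + 1)" .
      show "norm (P n / pref n - (\<Sum>j\<le>p + 1. sharp_coeff j t (\<theta> n) / real n ^ j)) \<le> C * (1 / real n ^ (p + 1))"
        using elim(1) unfolding laplace_coeff_sum[OF elim(2)] dp of_real_diff[symmetric] norm_of_real by simp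
      show "norm (sharp_coeff (p + 1) t (\<theta> n) / real n ^ (p + 1)) \<le> D * (1 / real n ^ (p + 1))"
        using divide_right_mono[OF D[OF \<theta>01], of "real n ^ (p + 1)" n] by (simp add: abs_divide)
    qed
    also have "\<dots> = (C + D) * norm (1 / real n ^ (p + 1))" by (simp add: distrib_right add_divide_distrib)
    finally show ?case .
  qed
  then have r: "r \<in> O(\<lambda>n. 1 / real n ^ (p + 1))" by (rule bigoI)
  have eq: "\<forall>\<^sub>F n in sequentially. P n = pref n * (1 + (\<Sum>k=1..p. m n k / real n ^ k) + r n)"
    using eventually_ge_at_top[of 1]
  proof eventually_elim
    case (elim n)
    then have "pref n \<noteq> 0" using t s by (simp add: pref_def)
    then show ?case by (simp add: r_def)
  qed
  show "\<exists>m :: nat \<Rightarrow> nat \<Rightarrow> real.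
        (\<exists>r :: nat \<Rightarrow> real. r \<in> O(\<lambda>n. 1 / real n ^ (p + 1)) \<and>
          (\<forall>\<^sub>F n in sequentially.
            measure_pmf.prob (major_index_pmf n) {M. real M / (real n)\<^sup>2 \<ge> x} =
              exp (- real n * I_M x + H (saddle x))
                / (sigma_M x * saddle x * sqrt (2 * pi * real n))
              * (1 + (\<Sum>k=1..p. m n k / real n ^ k) + r n))) \<and>
        (\<forall>n\<ge>2. \<forall>k\<in>{1..p}. m n k = sharp_coeff k (saddle x) (upfrac ((real n)\<^sup>2 * x))) \<and>
        (\<forall>n\<ge>2. m n 1 = first_coeff n x)"
  proof (intro exI[of _ m] conjI exI[of _ r] r)
    show "\<forall>\<^sub>F n in sequentially.
            measure_pmf.prob (major_index_pmf n) {M. real M / (real n)\<^sup>2 \<ge> x} =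
              exp (- real n * I_M x + H (saddle x))
                / (sigma_M x * saddle x * sqrt (2 * pi * real n))
              * (1 + (\<Sum>k=1..p. m n k / real n ^ k) + r n)"
      using eq unfolding P_def pref_def t_def .
    show "\<forall>n\<ge>2. m n 1 = first_coeff n x"
      unfolding m_def t_def \<theta>_def using sharp_coeff_1[OF x] by blast
  qed (simp add: m_def t_def \<theta>_def)
qed

end
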